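(* (a) Let $(\mathcal{B},\cdot,\Delta,\ell_2^{\Delta},Q)$ be a dGBV algebra over $\mathbb{C}$, let $\underline t=\{t^\alpha\}$ be coordinates of the tangent space of the Maurer-Cartan deformation functor attached to the shifted DGLA $(\mathcal{B},\Delta+Q,\ell_2^{\Delta+Q})$, let $\Gamma\in\mathcal{B}[\![\underline t]\!]$ be a solution of the Maurer-Cartan equation $(\Delta+Q)(\Gamma)+\frac12\ell_2^{\Delta+Q}(\Gamma,\Gamma)=0$, and let $\boldsymbol\zeta\in\mathcal{B}^0[\![\underline t]\!][\![\hbar]\!]$ be a weak primitive form associated to $\Gamma$, with coefficients $\mathbf{A}_{\alpha\beta}{}^\rho={}^0A_{\alpha\beta}{}^\rho+{}^1A_{\alpha\beta}{}^\rho\hbar$. Then (Commutativity) $$\mathbf{A}_{\alpha\beta}{}^\rho=\mathbf{A}_{\beta\alpha}{}^\rho .$$ Moreover, if ${}^1A_{\alpha\beta}{}^\rho=0$ (for all indices), then (Associativity) and (Potential) hold: $$\sum_\rho{}^0A_{\alpha\beta}{}^\rho\,{}^0A_{\rho\gamma}{}^\delta=\sum_\rho{}^0A_{\beta\gamma}{}^\rho\,{}^0A_{\rho\alpha}{}^\delta,\qquad \frac{\partial}{\partial t^\alpha}{}^0A_{\gamma\beta}{}^\rho=\frac{\partial}{\partial t^\gamma}{}^0A_{\alpha\beta}{}^\rho .$$ (b) In the concrete case of the dGBV algebra $\mathcal{A}_0$ of a smooth projective Calabi-Yau complete intersection $X$ (see context), take $\Gamma=L=\sum_{\rho\in I}u_\rho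 t^\rho$ with $wt(L)=1$, where the $u_\rho$ represent a $\mathbb{C}$-basis of $\mathcal{A}_0^0/Q_S(\mathcal{A}_0^{-1})$, and let $\boldsymbol\zeta={}^0\zeta+{}^1\zeta\hbar$ with ${}^0\zeta,{}^1\zeta\in\mathcal{A}_0^0[\![\underline t]\!]$, ${}^0\zeta|_{\underline t=0}=1$ and $wt(\boldsymbol\zeta)=0$. Suppose $\boldsymbol\zeta$ is a weak primitive form, with $$\hbar\nabla_\beta\hbar\nabla_\alpha\boldsymbol\zeta=\sum_{\rho\in I}\big({}^0A_{\alpha\beta}{}^\rho+{}^1A_{\alpha\beta}{}^\rho\hbar\big)\hbar\nabla_\rho\boldsymbol\zeta+(Q_{S+L}+\hbar\Delta)\big({}^0\Lambda_{\alpha\beta}+{}^1\Lambda_{\alpha\beta}\hbar\big),$$ ${}^0A_{\alpha\beta}{}^\rho,{}^1A_{\alpha\beta}{}^\rho\in\mathbb{C}[\![\underline t]\!]$, ${}^0\Lambda_{\alpha\beta},{}^1\Lambda_{\alpha\beta}\in\mathcal{A}_0^{-1}[\![\underline t]\!]$. If ${}^1A_{\alpha\beta}{}^\rho=0$ for all $\alpha,\beta,\rho\in I$, then for every $\delta$ the quantities $\sum_{\rho}{}^0A_{\alpha\beta}{}^\rho\,{}^0A_{\gamma\rho}{}^\delta$ and $\partial_\gamma\,{}^0A_{\alpha\beta}{}^\delta$ are invariant under permutations of $\alpha,\beta,\gamma$, ${}^0A_{\alpha\beta}{}^\rho={}^0A_{\beta\alpha}{}^\rho$, and $\partial_\alpha\circ\partial_\beta=\sum_\rho{}^0A_{\alpha\beta}{}^\rho\partial_\rho$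 defines a formal $F$-manifold structure on $\mathbb{H}=H^{n-k}_{\mathrm{prim}}(X,\mathbb{C})\simeq\mathcal{A}_0^0/Q_S(\mathcal{A}_0^{-1})$.
   Context: dGBV algebra: a unital $\mathbb{Z}$-graded super-commutative associative algebra $(\mathcal{B},\cdot)$ with linear maps $\Delta,Q$ of degree $1$ such that, with $\ell_2^{K}(a,b):=K(a\cdot b)-K(a)\cdot b-(-1)^{|a|}a\cdot K(b)$ for a linear map $K$ of degree 1, (i) $(\mathcal{B},\Delta,\ell_2^\Delta)$ is a shifted DGLA (the degree-shifted version of a differential graded Lie algebra, with bracket of degree $1$), (ii) $(\mathcal{B},\cdot,\ell_2^\Delta)$ is a Gerstenhaber algebra, i.e. writing $[\,,]=\ell_2^\Delta$: $[a,b]=(-1)^{|a||b|}[b,a]$, $[a,[b,c]]=(-1)^{|a|+1}[[a,b],c]+(-1)^{(|a|+1)(|b|+1)}[b,[a,c]]$, $[a,b\cdot c]=[a,b]\cdot c+(-1)^{(|a|+1)|b|}b\cdot[a,c]$, and (iii) $Q^2=0$, $Q(a\cdot b)=Q(a)\cdot b+(-1)^{|a|}a\cdot Q(b)$. All operators are extended linearly over power series in the formal variables $\underline t,\hbar$. Gauss-Manin connection: $\hbar\nabla_\alpha:=\hbar\,e^{-\Gamma/\hbar}\frac{\partial}{\partial t^\alpha}e^{\Gamma/\hbar}$, i.e. $\hbar\nabla_\alpha w=\hbar\,\partial_\alpha w+(\partial_\alpha\Gamma)w$ with $\partial_\alpha=\partial/\partial t^\alpha$, acting on the cohomology of $\mathcal{B}[\![\underline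 t]\!](\!(\hbar)\!)$ with differential $\hbar\Delta+Q+\ell_2^\Delta(\Gamma,\cdot)$. Weak primitive form associated to $\Gamma$: an element $\boldsymbol\zeta\in\mathcal{B}^0[\![\underline t]\!][\![\hbar]\!]$ such that (1) $\{\hbar\nabla_\alpha\boldsymbol\zeta\}$ is a $\mathbb{C}[\![\underline t]\!][\![\hbar]\!]$-basis of $H^0\big(\mathcal{B}[\![\underline t]\!][\![\hbar]\!],\hbar\Delta+Q+\ell_2^\Delta(\Gamma,\cdot)\big)$, so that there are unique $\mathbf{A}_{\alpha\beta}{}^\rho\in\mathbb{C}[\![\underline t]\!][\![\hbar]\!]$ with $\hbar\nabla_\beta\hbar\nabla_\alpha\boldsymbol\zeta=\sum_\rho\mathbf{A}_{\alpha\beta}{}^\rho\,\hbar\nabla_\rho\boldsymbol\zeta+(\hbar\Delta+Q+\ell_2^\Delta(\Gamma,\cdot))(\mathbf{\Lambda}_{\alpha\beta})$ for some $\mathbf{\Lambda}_{\alpha\beta}$; and (2) $\mathbf{A}_{\alpha\beta}{}^\rho={}^0A_{\alpha\beta}{}^\rho+{}^1A_{\alpha\beta}{}^\rho\hbar$ with ${}^0A_{\alpha\beta}{}^\rho,{}^1A_{\alpha\beta}{}^\rho\in\mathbb{C}[\![\underline t]\!]$. Concrete case in (b): let $n\ge k\ge1$ and let $G_1,\dots,G_k\in\mathbb{C}[x_0,\dots,x_n]$ be homogeneous of degrees $d_1,\dots,d_k$ with $\sum d_i=n+1$, defining a smooth complete intersection $X\subset\mathbf{P}^n$ of dimension $n-k$.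 Put $N=n+k+1$, $(q_1,\dots,q_N)=(y_1,\dots,y_k,x_0,\dots,x_n)$, $S=\sum_\ell y_\ell G_\ell(\underline x)$, $\mathcal{A}=\mathbb{C}[q_1,\dots,q_N][\eta_1,\dots,\eta_N]$ (super-commutative, $|q_i|=0$, $|\eta_i|=-1$), $\mathcal{A}^j$ the degree $j$ part, $\Delta=\sum_i\frac{\partial}{\partial q_i}\frac{\partial}{\partial\eta_i}$, $Q_f=\sum_i\frac{\partial f}{\partial q_i}\frac{\partial}{\partial\eta_i}$. Charge: $ch(y_i)=-d_i$, $ch(x_j)=1$, $ch(\eta_i)=-ch(q_i)$; $\mathcal{A}_0$ is the charge $0$ part, with $Q=Q_S$, so $Q+\ell_2^\Delta(L,\cdot)=Q_{S+L}$. Weight: $wt(y_i)=1$, $wt(x_j)=0$, $wt(\eta_i)=1-wt(q_i)$, $wt(\hbar)=1$; the $u_\rho$ are weight-homogeneous and $wt(L)=1$ means that $t^\rho$ has weight $1-wt(u_\rho)$. Here $\hbar\nabla_\alpha w=\hbar\partial_\alpha w+u_\alpha w$, and the $t^\alpha$ are viewed as formal coordinates on $\mathbb{H}$. Formal $F$-manifold structure: an associative, commutative, $\mathbb{C}[\![\underline t]\!]$-bilinear product $\circ$ on formal vector fields such that for all vector fields $X,Y,Z,W$: $[X\circ Y,Z\circ W]-[X\circ Y,Z]\circ W-Z\circ[X\circ Y,W]-X\circ[Y,Z\circ W]+X\circ[Y,Z]\circ W+X\circ Z\circ[Y,W]-Y\circ[X,Z\circ W]+Y\circ[X,Z]\circ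 W+Y\circ Z\circ[X,W]=0$. *)

theory Defs
  imports
    Complex_Main
    "HOL-Library.Poly_Mapping"
    "HOL-Computational_Algebra.Formal_Power_Series"
begin

section \<open>Formal power series in a family of commuting variables\<close>

text \<open>
  \<open>('i, 'a) mps\<close> is \<open>'a[[t]]\<close> with one variable \<open>t\<^sup>\<alpha>\<close> for each \<open>\<alpha> :: 'i\<close>; a monomial in the
  \<open>t\<^sup>\<alpha>\<close> is a finitely supported exponent vector. The variables are central, also for
  noncommutative \<open>'a\<close>. The ring \<open>'a[[t]][[\<hbar>]]\<close> is \<open>('i, 'a) mps fps\<close>, with \<open>\<hbar> = fps_X\<close>.
\<close>

typedef ('i, 'a) mps = "UNIV :: (('i \<Rightarrow>\<^sub>0 nat) \<Rightarrow> 'a) set"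
  morphisms mps_nth Abs_mps
  by simp

setup_lifting type_definition_mps

lemma mps_eqI: "(\<And>m. mps_nth f m = mps_nth g m) \<Longrightarrow> f = g"
  by (metis ext mps_nth_inject)

lemma mps_nth_Abs_mps [simp]: "mps_nth (Abs_mps f) m = f m"
  by (simp add: Abs_mps_inverse)

lemma finite_pm_splits: "finite {(a, b). a + b = (m :: 'i \<Rightarrow>\<^sub>0 nat)}"
proof -
  let ?F = "{f. \<forall>x. (x \<in> Poly_Mapping.keys m \<longrightarrow> f x \<in> {..Max (insert 0 (range (Poly_Mapping.lookup m)))}) \<and>
                    (x \<notin> Poly_Mapping.keys m \<longrightarrow> f x = 0)}"
  have fr: "finite (range (Poly_Mapping.lookup m))"
  proof -
    have "range (Poly_Mapping.lookup m) \<subseteq> insert 0 (Poly_Mapping.lookup m ` Poly_Mapping.keys m)"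
      by (auto simp: in_keys_iff)
    then show ?thesis
      by (rule finite_subset) simp
  qed
  have fin: "finite ?F"
    by (rule finite_set_of_finite_funs) simp_all
  have "inj_on (\<lambda>p. (Poly_Mapping.lookup (fst p), Poly_Mapping.lookup (snd p))) {(a, b). a + b = m}"
    by (auto simp: inj_on_def Poly_Mapping.lookup_inject)
  moreover have "(\<lambda>p. (Poly_Mapping.lookup (fst p), Poly_Mapping.lookup (snd p))) ` {(a, b). a + b = m} \<subseteq> ?F \<times> ?F"
  proof (clarsimp, intro conjI allI impI)
    fix a b :: "'i \<Rightarrow>\<^sub>0 nat" and x
    assume m: "m = a + b"
    have le: "Poly_Mapping.lookup (a + b) x \<le> Max (insert 0 (range (Poly_Mapping.lookup (a + b))))"
      using fr by (intro Max_ge) (auto simp: m)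
    show "Poly_Mapping.lookup a x \<le> Max (insert 0 (range (Poly_Mapping.lookup (a + b))))"
      using le by (simp add: lookup_add)
    show "Poly_Mapping.lookup b x \<le> Max (insert 0 (range (Poly_Mapping.lookup (a + b))))"
      using le by (simp add: lookup_add)
    show "Poly_Mapping.lookup a x = 0" if "x \<notin> Poly_Mapping.keys (a + b)"
      using that by (simp add: in_keys_iff lookup_add)
    show "Poly_Mapping.lookup b x = 0" if "x \<notin> Poly_Mapping.keys (a + b)"
      using that by (simp add: in_keys_iff lookup_add)
  qed
  ultimately show ?thesis
    using fin by (meson finite_SigmaI finite_subset inj_on_finite)
qed

instantiation mps :: (type, zero) zero
begin
lift_definition zero_mps :: "('a, 'b) mps" is "\<lambda>_. 0" .
instance ..
end

instantiation mps :: (type, "{zero, one}") one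
begin
lift_definition one_mps :: "('a, 'b) mps" is "\<lambda>m. if m = 0 then 1 else 0" .
instance ..
end

instantiation mps :: (type, plus) plus
begin
lift_definition plus_mps :: "('a, 'b) mps \<Rightarrow> ('a, 'b) mps \<Rightarrow> ('a, 'b) mps"
  is "\<lambda>f g m. f m + g m" .
instance ..
end

instantiation mps :: (type, minus) minus
begin
lift_definition minus_mps :: "('a, 'b) mps \<Rightarrow> ('a, 'b) mps \<Rightarrow> ('a, 'b) mps"
  is "\<lambda>f g m. f m - g m" .
instance ..
end

instantiation mps :: (type, uminus) uminus
begin
lift_definition uminus_mps :: "('a, 'b) mps \<Rightarrow> ('a, 'b) mps" is "\<lambda>f m. - f m" .
instance ..
end

instantiation mps :: (type, "{comm_monoid_add, times}") times
begin
lift_definition times_mps :: "('a, 'b) mps \<Rightarrow> ('a, 'b) mps \<Rightarrow> ('a, 'b) mps"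
  is "\<lambda>f g m. \<Sum>(a, b) \<in> {(a, b). a + b = m}. f a * g b" .
instance ..
end

lemma mps_nth_simps [simp]:
  "mps_nth 0 m = 0"
  "mps_nth (f + g) m = mps_nth f m + mps_nth g m"
  "mps_nth (f - g) m = mps_nth f m - mps_nth g m"
  "mps_nth (- f) m = - mps_nth f m"
  by (simp_all add: zero_mps.rep_eq plus_mps.rep_eq minus_mps.rep_eq uminus_mps.rep_eq)

lemma mps_nth_one: "mps_nth 1 m = (if m = 0 then 1 else 0)"
  by (simp add: one_mps.rep_eq)

lemma mps_nth_mult:
  "mps_nth (f * g) m = (\<Sum>(a, b) \<in> {(a, b). a + b = m}. mps_nth f a * mps_nth g b)"
  by (simp only: times_mps.rep_eq)

instance mps :: (type, ab_group_add) ab_group_add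
  by standard (rule mps_eqI; simp add: algebra_simps)+

lemma mps_mult_assoc:
  fixes f g h :: "('i, 'a :: ring_1) mps"
  shows "(f * g) * h = f * (g * h)"
proof (rule mps_eqI)
  fix m :: "'i \<Rightarrow>\<^sub>0 nat"
  let ?S = "\<lambda>m. {(a, b). a + b = (m :: 'i \<Rightarrow>\<^sub>0 nat)}"
  have "mps_nth ((f * g) * h) m =
      (\<Sum>p\<in>?S m. \<Sum>q\<in>?S (fst p). mps_nth f (fst q) * mps_nth g (snd q) * mps_nth h (snd p))"
    by (simp add: mps_nth_mult sum_distrib_right case_prod_unfold)
  also have "\<dots> = (\<Sum>(p, q)\<in>(SIGMA p:?S m. ?S (fst p)).
      mps_nth f (fst q) * mps_nth g (snd q) * mps_nth h (snd p))"
    by (rule sum.Sigma) (auto simp: finite_pm_splits)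
  also have "\<dots> = (\<Sum>(p, q)\<in>(SIGMA p:?S m. ?S (snd p)).
      mps_nth f (fst p) * (mps_nth g (fst q) * mps_nth h (snd q)))"
    by (rule sum.reindex_bij_witness[
          where i = "\<lambda>(p, q). ((fst p + fst q, snd q), (fst p, fst q))"
            and j = "\<lambda>(p, q). ((fst q, snd q + snd p), (snd q, snd p))"])
      (auto simp: ac_simps)
  also have "\<dots> = (\<Sum>p\<in>?S m. \<Sum>q\<in>?S (snd p).
      mps_nth f (fst p) * (mps_nth g (fst q) * mps_nth h (snd q)))"
    by (rule sum.Sigma[symmetric]) (auto simp: finite_pm_splits)
  also have "\<dots> = mps_nth (f * (g * h)) m"
    by (simp add: mps_nth_mult sum_distrib_left case_prod_unfold)
  finally show "mps_nth ((f * g) * h) m = mps_nth (f * (g * h)) m" .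
qed

lemma mps_one_mult:
  fixes f :: "('i, 'a :: ring_1) mps"
  shows "1 * f = f" and "f * 1 = f"
proof -
  show "1 * f = f"
  proof (rule mps_eqI)
    fix m
    have "mps_nth (1 * f) m = (\<Sum>(a, b) \<in> {(0 :: 'i \<Rightarrow>\<^sub>0 nat, m)}. mps_nth 1 a * mps_nth f b)"
      unfolding mps_nth_mult
      by (rule sum.mono_neutral_right) (auto simp: mps_nth_one finite_pm_splits split: if_splits)
    then show "mps_nth (1 * f) m = mps_nth f m"
      by (simp add: mps_nth_one)
  qed
  show "f * 1 = f"
  proof (rule mps_eqI)
    fix m
    have "mps_nth (f * 1) m = (\<Sum>(a, b) \<in> {(m, 0 :: 'i \<Rightarrow>\<^sub>0 nat)}. mps_nth f a * mps_nth 1 b)"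
      unfolding mps_nth_mult
      by (rule sum.mono_neutral_right) (auto simp: mps_nth_one finite_pm_splits split: if_splits)
    then show "mps_nth (f * 1) m = mps_nth f m"
      by (simp add: mps_nth_one)
  qed
qed

instance mps :: (type, ring_1) ring_1
proof
  fix f g h :: "('a, 'b) mps"
  show "f * g * h = f * (g * h)"
    by (rule mps_mult_assoc)
  show "1 * f = f" "f * 1 = f"
    by (rule mps_one_mult)+
  show "(f + g) * h = f * h + g * h"
    by (rule mps_eqI) (simp add: mps_nth_mult distrib_right sum.distrib case_prod_unfold)
  show "f * (g + h) = f * g + f * h"
    by (rule mps_eqI) (simp add: mps_nth_mult distrib_left sum.distrib case_prod_unfold)
  have "mps_nth (0 :: ('a, 'b) mps) 0 \<noteq> mps_nth 1 0"
    by (simp add: mps_nth_one)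
  then show "(0 :: ('a, 'b) mps) \<noteq> 1"
    by metis
qed

instance mps :: (type, comm_ring_1) comm_ring_1
proof
  fix f g :: "('a, 'b) mps"
  show "f * g = g * f"
  proof (rule mps_eqI)
    fix m
    show "mps_nth (f * g) m = mps_nth (g * f) m"
      unfolding mps_nth_mult
      by (rule sum.reindex_bij_witness[where i = "\<lambda>(a, b). (b, a)" and j = "\<lambda>(a, b). (b, a)"])
        (auto simp: ac_simps)
  qed
qed (auto simp: distrib_right)

definition mps_const :: "'a \<Rightarrow> ('i, 'a :: zero) mps" where
  "mps_const a = Abs_mps (\<lambda>m. if m = 0 then a else 0)"

definition mps_var :: "'i \<Rightarrow> ('i, 'a :: {zero, one}) mps" where
  "mps_var \<alpha> = Abs_mps (\<lambda>m. if m = Poly_Mapping.single \<alpha> 1 then 1 else 0)"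

definition mps_map :: "('a \<Rightarrow> 'b) \<Rightarrow> ('i, 'a) mps \<Rightarrow> ('i, 'b) mps" where
  "mps_map h f = Abs_mps (\<lambda>m. h (mps_nth f m))"

definition fps_map :: "('a \<Rightarrow> 'b) \<Rightarrow> 'a fps \<Rightarrow> 'b fps" where
  "fps_map h F = Abs_fps (\<lambda>n. h (fps_nth F n))"

definition mps_deriv :: "'i \<Rightarrow> ('i, 'a :: semiring_1) mps \<Rightarrow> ('i, 'a) mps" where
  "mps_deriv \<alpha> f =
     Abs_mps (\<lambda>m. of_nat (Suc (Poly_Mapping.lookup m \<alpha>)) * mps_nth f (m + Poly_Mapping.single \<alpha> 1))"

definition hbar_lin :: "'a \<Rightarrow> 'a \<Rightarrow> 'a :: semiring_1 fps" where
  "hbar_lin a b = fps_const a + fps_const b * fps_X"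


section \<open>dGBV algebras\<close>

definition sg :: "int \<Rightarrow> 'a :: ring_1" where
  "sg j = (if even j then 1 else - 1)"

text \<open>
  A unital complex algebra is given by a ring together with its structure map \<open>cst\<close> from the
  complex numbers, so that \<open>c \<cdot> a = cst c * a\<close>. The algebra is \<open>B = (\<Oplus>j. G j)\<close>, which may be
  a proper subring of the ambient type. Multilinear maps on \<open>B\<close> are determined by their
  restrictions to homogeneous elements, and all conditions are stated there. Centrality of
  \<open>cst c\<close> in \<open>B\<close> is the case \<open>i = 0\<close> of super-commutativity.
\<close>

locale graded_superalgebra =
  fixes cst :: "complex \<Rightarrow> 'b :: ring_1"
    and G :: "int \<Rightarrow> 'b set"
  assumes cst_one: "cst 1 = 1"
    and cst_add: "cst (c + c') = cst c + cst c'"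
    and cst_mult: "cst (c * c') = cst c * cst c'"
    and zero_in: "0 \<in> G j"
    and add_in: "a \<in> G j \<Longrightarrow> b \<in> G j \<Longrightarrow> a + b \<in> G j"
    and scale_in: "a \<in> G j \<Longrightarrow> cst c * a \<in> G j"
    and direct: "finite J \<Longrightarrow> (\<And>j. j \<in> J \<Longrightarrow> f j \<in> G j) \<Longrightarrow> (\<Sum>j\<in>J. f j) = 0 \<Longrightarrow>
                   j \<in> J \<Longrightarrow> f j = 0"
    and one_in: "1 \<in> G 0"
    and mult_in: "a \<in> G i \<Longrightarrow> b \<in> G j \<Longrightarrow> a * b \<in> G (i + j)"
    and supercomm: "a \<in> G i \<Longrightarrow> b \<in> G j \<Longrightarrow> a * b = sg (i * j) * (b * a)"

definition degree_one_map ::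
    "(complex \<Rightarrow> 'b :: ring_1) \<Rightarrow> (int \<Rightarrow> 'b set) \<Rightarrow> ('b \<Rightarrow> 'b) \<Rightarrow> bool" where
  "degree_one_map cst G K \<longleftrightarrow>
     (\<forall>j. \<forall>a\<in>G j. K a \<in> G (j + 1)) \<and>
     (\<forall>j. \<forall>a\<in>G j. \<forall>b\<in>G j. K (a + b) = K a + K b) \<and>
     (\<forall>j c. \<forall>a\<in>G j. K (cst c * a) = cst c * K a)"

text \<open>
  Brackets take the degree of their first argument as an extra parameter: \<open>br i a b\<close> is
  \<open>[a, b]\<close> for \<open>a\<close> of degree \<open>i\<close>. In particular \<open>ell2 K i a b\<close> is \<open>\<ell>\<^sub>2\<^sup>K(a, b)\<close> for
  \<open>|a| = i\<close>. It is used with the same formula in \<open>B\<close>, \<open>B[[t]]\<close> and \<open>B[[t]][[\<hbar>]]\<close>.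
\<close>

definition ell2 :: "('r :: ring_1 \<Rightarrow> 'r) \<Rightarrow> int \<Rightarrow> 'r \<Rightarrow> 'r \<Rightarrow> 'r" where
  "ell2 K i a b = K (a * b) - K a * b - sg i * (a * K b)"

definition bilinear_bracket ::
    "(complex \<Rightarrow> 'b :: ring_1) \<Rightarrow> (int \<Rightarrow> 'b set) \<Rightarrow> (int \<Rightarrow> 'b \<Rightarrow> 'b \<Rightarrow> 'b) \<Rightarrow> bool" where
  "bilinear_bracket cst G br \<longleftrightarrow>
     (\<forall>i j. \<forall>a\<in>G i. \<forall>b\<in>G j. br i a b \<in> G (i + j + 1)) \<and>
     (\<forall>i j. \<forall>a\<in>G i. \<forall>a'\<in>G i. \<forall>b\<in>G j. br i (a + a') b = br i a b + br i a' b) \<and>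
     (\<forall>i j. \<forall>a\<in>G i. \<forall>b\<in>G j. \<forall>b'\<in>G j. br i a (b + b') = br i a b + br i a b') \<and>
     (\<forall>i j c. \<forall>a\<in>G i. \<forall>b\<in>G j. br i (cst c * a) b = cst c * br i a b \<and>
                                    br i a (cst c * b) = cst c * br i a b)"

definition bracket_symmetric :: "(int \<Rightarrow> 'b :: ring_1 set) \<Rightarrow> (int \<Rightarrow> 'b \<Rightarrow> 'b \<Rightarrow> 'b) \<Rightarrow> bool" where
  "bracket_symmetric G br \<longleftrightarrow>
     (\<forall>i j. \<forall>a\<in>G i. \<forall>b\<in>G j. br i a b = sg (i * j) * br j b a)"

definition bracket_jacobi :: "(int \<Rightarrow> 'b :: ring_1 set) \<Rightarrow> (int \<Rightarrow> 'b \<Rightarrow> 'b \<Rightarrow> 'b) \<Rightarrow> bool" where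
  "bracket_jacobi G br \<longleftrightarrow>
     (\<forall>i j l. \<forall>a\<in>G i. \<forall>b\<in>G j. \<forall>c\<in>G l.
        br i a (br j b c) =
          sg (i + 1) * br (i + j + 1) (br i a b) c +
          sg ((i + 1) * (j + 1)) * br j b (br i a c))"

definition bracket_poisson :: "(int \<Rightarrow> 'b :: ring_1 set) \<Rightarrow> (int \<Rightarrow> 'b \<Rightarrow> 'b \<Rightarrow> 'b) \<Rightarrow> bool" where
  "bracket_poisson G br \<longleftrightarrow>
     (\<forall>i j l. \<forall>a\<in>G i. \<forall>b\<in>G j. \<forall>c\<in>G l.
        br i a (b * c) = br i a b * c + sg ((i + 1) * j) * (b * br i a c))"

text \<open>
  Differential graded Lie algebras in the convention where both the differential and the
  (graded symmetric) bracket have degree 1. The sign of the Leibniz rule is the one obtained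
  by shifting, \<open>d[a, b] + [da, b] + (-1)\<^bsup>|a|\<^esup>[a, db] = 0\<close>.
\<close>

definition shifted_dgla ::
    "(complex \<Rightarrow> 'b :: ring_1) \<Rightarrow> (int \<Rightarrow> 'b set) \<Rightarrow> ('b \<Rightarrow> 'b) \<Rightarrow> (int \<Rightarrow> 'b \<Rightarrow> 'b \<Rightarrow> 'b) \<Rightarrow> bool" where
  "shifted_dgla cst G d br \<longleftrightarrow>
     degree_one_map cst G d \<and>
     (\<forall>j. \<forall>a\<in>G j. d (d a) = 0) \<and>
     bilinear_bracket cst G br \<and> bracket_symmetric G br \<and> bracket_jacobi G br \<and>
     (\<forall>i j. \<forall>a\<in>G i. \<forall>b\<in>G j. d (br i a b) = - br (i + 1) (d a) b - sg i * br i a (d b))"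

definition gerstenhaber_bracket ::
    "(complex \<Rightarrow> 'b :: ring_1) \<Rightarrow> (int \<Rightarrow> 'b set) \<Rightarrow> (int \<Rightarrow> 'b \<Rightarrow> 'b \<Rightarrow> 'b) \<Rightarrow> bool" where
  "gerstenhaber_bracket cst G br \<longleftrightarrow>
     bilinear_bracket cst G br \<and> bracket_symmetric G br \<and> bracket_jacobi G br \<and>
     bracket_poisson G br"

locale dgbv_algebra = graded_superalgebra cst G
  for cst :: "complex \<Rightarrow> 'b :: ring_1" and G :: "int \<Rightarrow> 'b set" +
  fixes \<Delta> Q :: "'b \<Rightarrow> 'b"
  assumes dgla: "shifted_dgla cst G \<Delta> (ell2 \<Delta>)"
    and gerstenhaber: "gerstenhaber_bracket cst G (ell2 \<Delta>)"
    and Q_map: "degree_one_map cst G Q"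
    and Q_square: "a \<in> G j \<Longrightarrow> Q (Q a) = 0"
    and Q_leibniz: "a \<in> G i \<Longrightarrow> b \<in> G j \<Longrightarrow> Q (a * b) = Q a * b + sg i * (a * Q b)"


section \<open>Bases of quotients\<close>

text \<open>The classes of the \<open>v \<alpha>\<close> form a basis of the quotient module \<open>Z / N\<close>.\<close>

definition basis_mod ::
    "('r :: zero \<Rightarrow> 'm \<Rightarrow> 'm) \<Rightarrow> 'm set \<Rightarrow> 'm set \<Rightarrow> ('i \<Rightarrow> 'm :: ab_group_add) \<Rightarrow> bool" where
  "basis_mod act Z N v \<longleftrightarrow>
     (\<forall>\<alpha>. v \<alpha> \<in> Z) \<and>
     (\<forall>w\<in>Z. \<exists>!c :: 'i \<Rightarrow>\<^sub>0 'r. w - (\<Sum>\<alpha>\<in>Poly_Mapping.keys c. act (Poly_Mapping.lookup c \<alpha>) (v \<alpha>)) \<in> N)"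


section \<open>Maurer-Cartan elements and the Gauss-Manin connection\<close>

text \<open>\<open>G\<^sup>j[[t]]\<close> and \<open>G\<^sup>j[[t]][[\<hbar>]]\<close>\<close>

definition mser :: "(int \<Rightarrow> 'b set) \<Rightarrow> int \<Rightarrow> ('i, 'b) mps set" where
  "mser G j = {f. \<forall>m. mps_nth f m \<in> G j}"

definition hser :: "(int \<Rightarrow> 'b set) \<Rightarrow> int \<Rightarrow> ('i, 'b) mps fps set" where
  "hser G j = {w. \<forall>n. fps_nth w n \<in> mser G j}"

text \<open>Linear extension of a map over \<open>t\<close> and \<open>\<hbar>\<close>, and the scalar action of \<open>\<complex>[[t]][[\<hbar>]]\<close>\<close>

definition hext :: "('a \<Rightarrow> 'b) \<Rightarrow> ('i, 'a) mps fps \<Rightarrow> ('i, 'b) mps fps" where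
  "hext K = fps_map (mps_map K)"

definition hact ::
    "(complex \<Rightarrow> 'b :: ring_1) \<Rightarrow> ('i, complex) mps fps \<Rightarrow> ('i, 'b) mps fps \<Rightarrow> ('i, 'b) mps fps" where
  "hact cst r w = hext cst r * w"

text \<open>
  The tangent space of the Maurer-Cartan deformation functor of \<open>(B, K, \<ell>)\<close> is its value on
  the dual numbers \<open>\<complex>[\<epsilon>]\<close>. Since \<open>\<epsilon>\<^sup>2 = 0\<close>, an element \<open>\<epsilon>u\<close> with \<open>u\<close> of degree 0 is Maurer-Cartan
  iff \<open>K u = 0\<close>, and the gauge action of \<open>\<epsilon>\<lambda>\<close>, with \<open>\<lambda>\<close> of degree -1, translates \<open>u\<close> by \<open>K \<lambda>\<close> up to sign.
\<close>

definition tangent_basis ::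
    "(complex \<Rightarrow> 'b :: ring_1) \<Rightarrow> (int \<Rightarrow> 'b set) \<Rightarrow> ('b \<Rightarrow> 'b) \<Rightarrow> ('i \<Rightarrow> 'b) \<Rightarrow> bool" where
  "tangent_basis cst G K u \<longleftrightarrow>
     basis_mod (\<lambda>c a. cst c * a) {a \<in> G 0. K a = 0} (K ` G (- 1)) u"

definition maurer_cartan ::
    "(complex \<Rightarrow> 'b :: ring_1) \<Rightarrow> (int \<Rightarrow> 'b set) \<Rightarrow> ('b \<Rightarrow> 'b) \<Rightarrow> ('i, 'b) mps \<Rightarrow> bool" where
  "maurer_cartan cst G K \<Gamma> \<longleftrightarrow>
     \<Gamma> \<in> mser G 0 \<and> mps_map K \<Gamma> + mps_const (cst (1 / 2)) * ell2 (mps_map K) 0 \<Gamma> \<Gamma> = 0"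

text \<open>The differential \<open>\<hbar>\<Delta> + Q + \<ell>\<^sub>2\<^sup>\<Delta>(\<Gamma>, \<cdot>)\<close>\<close>

definition tw_diff ::
    "('b :: ring_1 \<Rightarrow> 'b) \<Rightarrow> ('b \<Rightarrow> 'b) \<Rightarrow> ('i, 'b) mps \<Rightarrow> ('i, 'b) mps fps \<Rightarrow> ('i, 'b) mps fps" where
  "tw_diff \<Delta> Q \<Gamma> w = fps_X * hext \<Delta> w + hext Q w + ell2 (hext \<Delta>) 0 (fps_const \<Gamma>) w"

text \<open>The operator \<open>\<hbar>\<nabla>\<^sub>\<alpha>\<close>\<close>

definition hnabla ::
    "('i, 'b :: ring_1) mps \<Rightarrow> 'i \<Rightarrow> ('i, 'b) mps fps \<Rightarrow> ('i, 'b) mps fps" where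
  "hnabla \<Gamma> \<alpha> w = fps_X * fps_map (mps_deriv \<alpha>) w + fps_const (mps_deriv \<alpha> \<Gamma>) * w"

definition cocycles0 ::
    "(int \<Rightarrow> 'b :: ring_1 set) \<Rightarrow> ('b \<Rightarrow> 'b) \<Rightarrow> ('b \<Rightarrow> 'b) \<Rightarrow> ('i, 'b) mps \<Rightarrow> ('i, 'b) mps fps set" where
  "cocycles0 G \<Delta> Q \<Gamma> = {w \<in> hser G 0. tw_diff \<Delta> Q \<Gamma> w = 0}"

definition coboundaries0 ::
    "(int \<Rightarrow> 'b :: ring_1 set) \<Rightarrow> ('b \<Rightarrow> 'b) \<Rightarrow> ('b \<Rightarrow> 'b) \<Rightarrow> ('i, 'b) mps \<Rightarrow> ('i, 'b) mps fps set" where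
  "coboundaries0 G \<Delta> Q \<Gamma> = tw_diff \<Delta> Q \<Gamma> ` hser G (- 1)"

definition connection_coeffs ::
    "(complex \<Rightarrow> 'b :: ring_1) \<Rightarrow> (int \<Rightarrow> 'b set) \<Rightarrow> ('b \<Rightarrow> 'b) \<Rightarrow> ('b \<Rightarrow> 'b) \<Rightarrow>
     ('i, 'b) mps \<Rightarrow> ('i, 'b) mps fps \<Rightarrow> ('i \<Rightarrow> 'i \<Rightarrow> 'i \<Rightarrow> ('i, complex) mps fps) \<Rightarrow> bool" where
  "connection_coeffs cst G \<Delta> Q \<Gamma> \<zeta> A \<longleftrightarrow>
     (\<forall>\<alpha> \<beta>. finite {\<rho>. A \<alpha> \<beta> \<rho> \<noteq> 0} \<and>
        (\<exists>\<Lambda>\<in>hser G (- 1).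
           hnabla \<Gamma> \<beta> (hnabla \<Gamma> \<alpha> \<zeta>) =
             (\<Sum>\<rho> | A \<alpha> \<beta> \<rho> \<noteq> 0. hact cst (A \<alpha> \<beta> \<rho>) (hnabla \<Gamma> \<rho> \<zeta>)) + tw_diff \<Delta> Q \<Gamma> \<Lambda>))"

text \<open>
  Speaking of the cohomology of \<open>B[[t]][[\<hbar>]]\<close> presupposes that the twisted differential
  squares to zero; this is not implied by the Maurer-Cartan equation for \<open>\<Delta> + Q\<close> alone.
\<close>

definition weak_primitive_form ::
    "(complex \<Rightarrow> 'b :: ring_1) \<Rightarrow> (int \<Rightarrow> 'b set) \<Rightarrow> ('b \<Rightarrow> 'b) \<Rightarrow> ('b \<Rightarrow> 'b) \<Rightarrow>
     ('i, 'b) mps \<Rightarrow> ('i, 'b) mps fps \<Rightarrow> bool" where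
  "weak_primitive_form cst G \<Delta> Q \<Gamma> \<zeta> \<longleftrightarrow>
     \<zeta> \<in> hser G 0 \<and>
     (\<forall>j. \<forall>w\<in>hser G j. tw_diff \<Delta> Q \<Gamma> (tw_diff \<Delta> Q \<Gamma> w) = 0) \<and>
     basis_mod (hact cst) (cocycles0 G \<Delta> Q \<Gamma>) (coboundaries0 G \<Delta> Q \<Gamma>) (\<lambda>\<alpha>. hnabla \<Gamma> \<alpha> \<zeta>) \<and>
     (\<exists>A0 A1. connection_coeffs cst G \<Delta> Q \<Gamma> \<zeta> (\<lambda>\<alpha> \<beta> \<rho>. hbar_lin (A0 \<alpha> \<beta> \<rho>) (A1 \<alpha> \<beta> \<rho>)))"


section \<open>Formal F-manifolds\<close>

text \<open>A formal vector field \<open>\<Sum>\<rho>. X\<^sup>\<rho> \<partial>\<^sub>\<rho>\<close> is the family of its components.\<close>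

type_synonym 'i vfield = "'i \<Rightarrow> ('i, complex) mps"

definition vf_coord :: "'i \<Rightarrow> 'i vfield" where
  "vf_coord \<alpha> = (\<lambda>\<rho>. if \<rho> = \<alpha> then 1 else 0)"

definition vf_bracket :: "'i :: finite vfield \<Rightarrow> 'i vfield \<Rightarrow> 'i vfield" where
  "vf_bracket X Y =
     (\<lambda>\<rho>. \<Sum>\<alpha>\<in>UNIV. X \<alpha> * mps_deriv \<alpha> (Y \<rho>) - Y \<alpha> * mps_deriv \<alpha> (X \<rho>))"

definition formal_F_manifold :: "('i :: finite vfield \<Rightarrow> 'i vfield \<Rightarrow> 'i vfield) \<Rightarrow> bool" where
  "formal_F_manifold p \<longleftrightarrow>
     (\<forall>X Y Z. p (p X Y) Z = p X (p Y Z)) \<and>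
     (\<forall>X Y. p X Y = p Y X) \<and>
     (\<forall>X X' Y. p (\<lambda>\<rho>. X \<rho> + X' \<rho>) Y = (\<lambda>\<rho>. p X Y \<rho> + p X' Y \<rho>)) \<and>
     (\<forall>X Y Y'. p X (\<lambda>\<rho>. Y \<rho> + Y' \<rho>) = (\<lambda>\<rho>. p X Y \<rho> + p X Y' \<rho>)) \<and>
     (\<forall>f X Y. p (\<lambda>\<rho>. f * X \<rho>) Y = (\<lambda>\<rho>. f * p X Y \<rho>) \<and> p X (\<lambda>\<rho>. f * Y \<rho>) = (\<lambda>\<rho>. f * p X Y \<rho>)) \<and>
     (\<forall>X Y Z W \<rho>.
        vf_bracket (p X Y) (p Z W) \<rho>
        - p (vf_bracket (p X Y) Z) W \<rho> - p Z (vf_bracket (p X Y) W) \<rho>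
        - p X (vf_bracket Y (p Z W)) \<rho> + p X (p (vf_bracket Y Z) W) \<rho> + p X (p Z (vf_bracket Y W)) \<rho>
        - p Y (vf_bracket X (p Z W)) \<rho> + p Y (p (vf_bracket X Z) W) \<rho> + p Y (p Z (vf_bracket X W)) \<rho>
        = 0)"

definition symmetric3 :: "('i \<Rightarrow> 'i \<Rightarrow> 'i \<Rightarrow> 'a) \<Rightarrow> bool" where
  "symmetric3 T \<longleftrightarrow>
     (\<forall>\<alpha> \<beta> \<gamma>. T \<alpha> \<gamma> \<beta> = T \<alpha> \<beta> \<gamma> \<and> T \<beta> \<alpha> \<gamma> = T \<alpha> \<beta> \<gamma> \<and> T \<beta> \<gamma> \<alpha> = T \<alpha> \<beta> \<gamma> \<and>
              T \<gamma> \<alpha> \<beta> = T \<alpha> \<beta> \<gamma> \<and> T \<gamma> \<beta> \<alpha> = T \<alpha> \<beta> \<gamma>)"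


section \<open>Grassmann algebras\<close>

text \<open>
  \<open>('v, 'c) grassmann\<close> is the exterior algebra over \<open>'c\<close> with one odd generator \<open>\<eta>\<^sub>v\<close> for each
  \<open>v :: 'v\<close>. An element \<open>\<Sum>I. f(I) \<eta>\<^sub>I\<close> is stored as its coefficient function, where \<open>\<eta>\<^sub>I\<close> is the
  product of the \<open>\<eta>\<^sub>v\<close> with \<open>v \<in> I\<close> in increasing order. For disjoint \<open>I\<close>, \<open>J\<close> the product
  \<open>\<eta>\<^sub>I \<eta>\<^sub>J\<close> is \<open>shuffle_sign I J\<close> times \<open>\<eta>\<^sub>I\<^sub>\<union>\<^sub>J\<close>.
\<close>

typedef (overloaded) ('v, 'c) grassmann =
  "{f :: 'v set \<Rightarrow> 'c :: zero. finite {I. f I \<noteq> 0} \<and> (\<forall>I. f I \<noteq> 0 \<longrightarrow> finite I)}"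
  morphisms gcoeff Abs_grassmann
  by (rule exI[of _ "\<lambda>_. 0"]) simp

setup_lifting type_definition_grassmann

definition inversions :: "'v :: linorder set \<Rightarrow> 'v set \<Rightarrow> nat" where
  "inversions I J = card {(i, j) \<in> I \<times> J. j < i}"

definition shuffle_sign :: "'v :: linorder set \<Rightarrow> 'v set \<Rightarrow> 'c :: comm_ring_1" where
  "shuffle_sign I J = (- 1) ^ inversions I J"

lemma shuffle_sign_empty [simp]: "shuffle_sign {} J = 1" "shuffle_sign I {} = 1"
  by (simp_all add: shuffle_sign_def inversions_def)

lemma inversions_Un_left:
  assumes "finite I" "finite J" "finite K" "I \<inter> J = {}"
  shows "inversions (I \<union> J) K = inversions I K + inversions J K"
proof -
  have "{(i, k) \<in> (I \<union> J) \<times> K. k < i} = {(i, k) \<in> I \<times> K. k < i} \<union> {(i, k) \<in> J \<times> K. k < i}"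
    by auto
  moreover have "finite {(i, k) \<in> I \<times> K. k < i}" "finite {(i, k) \<in> J \<times> K. k < i}"
    using assms by (auto intro: finite_subset[of _ "I \<times> K"] finite_subset[of _ "J \<times> K"])
  ultimately show ?thesis
    unfolding inversions_def using assms(4) by (subst card_Un_disjoint[symmetric]) auto
qed

lemma inversions_Un_right:
  assumes "finite I" "finite J" "finite K" "J \<inter> K = {}"
  shows "inversions I (J \<union> K) = inversions I J + inversions I K"
proof -
  have "{(i, k) \<in> I \<times> (J \<union> K). k < i} = {(i, k) \<in> I \<times> J. k < i} \<union> {(i, k) \<in> I \<times> K. k < i}"
    by auto
  moreover have "finite {(i, k) \<in> I \<times> J. k < i}" "finite {(i, k) \<in> I \<times> K. k < i}"
    using assms by (auto intro: finite_subset[of _ "I \<times> J"] finite_subset[of _ "I \<times> K"])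
  ultimately show ?thesis
    unfolding inversions_def using assms(4) by (subst card_Un_disjoint[symmetric]) auto
qed

lemma shuffle_sign_cocycle:
  assumes "finite I" "finite J" "finite K" "I \<inter> J = {}" "J \<inter> K = {}"
  shows "(shuffle_sign I J * shuffle_sign (I \<union> J) K :: 'c :: comm_ring_1) =
         shuffle_sign I (J \<union> K) * shuffle_sign J K"
  using assms
  by (simp add: shuffle_sign_def inversions_Un_left inversions_Un_right power_add ac_simps)

lemma grassmann_eqI: "(\<And>I. gcoeff a I = gcoeff b I) \<Longrightarrow> a = b"
  by transfer auto

lemma finite_support_gcoeff: "finite {I. gcoeff a I \<noteq> 0}"
  by transfer simp

lemma gcoeff_infinite: "infinite I \<Longrightarrow> gcoeff a I = 0"
  by transfer auto

instantiation grassmann :: (type, zero) zero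
begin
lift_definition zero_grassmann :: "('a, 'b) grassmann" is "\<lambda>_. 0" by simp
instance ..
end

instantiation grassmann :: (type, zero_neq_one) one
begin
lift_definition one_grassmann :: "('a, 'b) grassmann" is "\<lambda>I. if I = {} then 1 else 0"
  by (auto intro: finite_subset[of _ "{{}}"])
instance ..
end

instantiation grassmann :: (type, ab_group_add) ab_group_add
begin

lift_definition plus_grassmann :: "('a, 'b) grassmann \<Rightarrow> ('a, 'b) grassmann \<Rightarrow> ('a, 'b) grassmann"
  is "\<lambda>f g I. f I + g I"
proof -
  fix f g :: "'a set \<Rightarrow> 'b"
  assume f: "finite {I. f I \<noteq> 0} \<and> (\<forall>I. f I \<noteq> 0 \<longrightarrow> finite I)"
    and g: "finite {I. g I \<noteq> 0} \<and> (\<forall>I. g I \<noteq> 0 \<longrightarrow> finite I)"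
  have "{I. f I + g I \<noteq> 0} \<subseteq> {I. f I \<noteq> 0} \<union> {I. g I \<noteq> 0}"
    by auto
  then have "finite {I. f I + g I \<noteq> 0}"
    by (rule finite_subset) (use f g in simp)
  moreover have "finite I" if "f I + g I \<noteq> 0" for I
    using that f g by (cases "f I = 0") auto
  ultimately show "finite {I. f I + g I \<noteq> 0} \<and> (\<forall>I. f I + g I \<noteq> 0 \<longrightarrow> finite I)"
    by blast
qed

lift_definition uminus_grassmann :: "('a, 'b) grassmann \<Rightarrow> ('a, 'b) grassmann"
  is "\<lambda>f I. - f I"
  by simp

lift_definition minus_grassmann :: "('a, 'b) grassmann \<Rightarrow> ('a, 'b) grassmann \<Rightarrow> ('a, 'b) grassmann"
  is "\<lambda>f g I. f I - g I"
proof -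
  fix f g :: "'a set \<Rightarrow> 'b"
  assume f: "finite {I. f I \<noteq> 0} \<and> (\<forall>I. f I \<noteq> 0 \<longrightarrow> finite I)"
    and g: "finite {I. g I \<noteq> 0} \<and> (\<forall>I. g I \<noteq> 0 \<longrightarrow> finite I)"
  have "{I. f I - g I \<noteq> 0} \<subseteq> {I. f I \<noteq> 0} \<union> {I. g I \<noteq> 0}"
    by auto
  then have "finite {I. f I - g I \<noteq> 0}"
    by (rule finite_subset) (use f g in simp)
  moreover have "finite I" if "f I - g I \<noteq> 0" for I
    using that f g by (cases "f I = 0") auto
  ultimately show "finite {I. f I - g I \<noteq> 0} \<and> (\<forall>I. f I - g I \<noteq> 0 \<longrightarrow> finite I)"
    by blast
qed

instance
  by standard (rule grassmann_eqI, simp add: zero_grassmann.rep_eq plus_grassmann.rep_eq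
      minus_grassmann.rep_eq uminus_grassmann.rep_eq algebra_simps)+

end

instantiation grassmann :: (linorder, comm_ring_1) times
begin

lift_definition times_grassmann :: "('a, 'b) grassmann \<Rightarrow> ('a, 'b) grassmann \<Rightarrow> ('a, 'b) grassmann"
  is "\<lambda>f g K. \<Sum>I\<in>Pow K. shuffle_sign I (K - I) * (f I * g (K - I))"
proof -
  fix f g :: "'a set \<Rightarrow> 'b"
  assume f: "finite {I. f I \<noteq> 0} \<and> (\<forall>I. f I \<noteq> 0 \<longrightarrow> finite I)"
    and g: "finite {I. g I \<noteq> 0} \<and> (\<forall>I. g I \<noteq> 0 \<longrightarrow> finite I)"
  define h where "h = (\<lambda>K. \<Sum>I\<in>Pow K. shuffle_sign I (K - I) * (f I * g (K - I)))"
  have ex: "\<exists>I J. f I \<noteq> 0 \<and> g J \<noteq> 0 \<and> K = I \<union> J" if "h K \<noteq> 0" for K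
  proof -
    have "\<exists>I\<in>Pow K. shuffle_sign I (K - I) * (f I * g (K - I)) \<noteq> 0"
    proof (rule ccontr)
      assume "\<not> ?thesis"
      then have "h K = 0"
        unfolding h_def by (intro sum.neutral) blast
      with that show False
        by simp
    qed
    then obtain I where I: "I \<subseteq> K" "shuffle_sign I (K - I) * (f I * g (K - I)) \<noteq> 0"
      by blast
    then have "f I \<noteq> 0" "g (K - I) \<noteq> 0"
      by (metis mult_zero_left mult_zero_right)+
    moreover have "K = I \<union> (K - I)"
      using I by blast
    ultimately show ?thesis
      by blast
  qed
  have "{K. h K \<noteq> 0} \<subseteq> (\<lambda>(I, J). I \<union> J) ` ({I. f I \<noteq> 0} \<times> {J. g J \<noteq> 0})"
    using ex by blast
  then have "finite {K. h K \<noteq> 0}"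
    by (rule finite_subset) (use f g in simp)
  moreover have "finite K" if "h K \<noteq> 0" for K
    using ex[OF that] f g by blast
  ultimately show "finite {K. (\<Sum>I\<in>Pow K. shuffle_sign I (K - I) * (f I * g (K - I))) \<noteq> 0} \<and>
      (\<forall>K. (\<Sum>I\<in>Pow K. shuffle_sign I (K - I) * (f I * g (K - I))) \<noteq> 0 \<longrightarrow> finite K)"
    unfolding h_def by blast
qed

instance ..

end

lemma gcoeff_simps [simp]:
  "gcoeff 0 I = 0"
  "gcoeff (a + b) I = gcoeff a I + gcoeff b I"
  "gcoeff (a - b) I = gcoeff a I - gcoeff b I"
  "gcoeff (- a) I = - gcoeff a I"
  by (simp_all add: zero_grassmann.rep_eq plus_grassmann.rep_eq minus_grassmann.rep_eq
      uminus_grassmann.rep_eq)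

lemma gcoeff_one: "gcoeff 1 I = (if I = {} then 1 else 0)"
  by (simp add: one_grassmann.rep_eq)

lemma gcoeff_mult:
  "gcoeff (a * b) K = (\<Sum>I\<in>Pow K. shuffle_sign I (K - I) * (gcoeff a I * gcoeff b (K - I)))"
  by (simp only: times_grassmann.rep_eq)

lemma grassmann_mult_assoc:
  fixes a b c :: "('v :: linorder, 'c :: comm_ring_1) grassmann"
  shows "(a * b) * c = a * (b * c)"
proof (rule grassmann_eqI)
  fix K :: "'v set"
  show "gcoeff ((a * b) * c) K = gcoeff (a * (b * c)) K"
  proof (cases "finite K")
    case False
    then show ?thesis
      by (simp add: gcoeff_infinite)
  next
    case fin: True
    have finsub: "finite I" if "I \<subseteq> K" for I
      using that fin by (rule finite_subset)
    have "gcoeff ((a * b) * c) K =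
        (\<Sum>M\<in>Pow K. \<Sum>I\<in>Pow M. shuffle_sign I (M - I) * shuffle_sign M (K - M) *
            (gcoeff a I * gcoeff b (M - I) * gcoeff c (K - M)))"
      by (simp add: gcoeff_mult sum_distrib_left sum_distrib_right ac_simps)
    also have "\<dots> = (\<Sum>(M, I)\<in>(SIGMA M:Pow K. Pow M).
            shuffle_sign I (M - I) * shuffle_sign M (K - M) *
            (gcoeff a I * gcoeff b (M - I) * gcoeff c (K - M)))"
      by (rule sum.Sigma) (auto simp: fin finsub)
    also have "\<dots> = (\<Sum>(I, J)\<in>(SIGMA I:Pow K. Pow (K - I)).
            shuffle_sign I (K - I) * shuffle_sign J (K - I - J) *
            (gcoeff a I * gcoeff b J * gcoeff c (K - I - J)))"
    proof (rule sum.reindex_bij_witness[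
          where i = "\<lambda>(I, J). (I \<union> J, I)" and j = "\<lambda>(M, I). (I, M - I)"])
      fix p
      assume "p \<in> (SIGMA M:Pow K. Pow M)"
      then obtain M I where p: "p = (M, I)" "M \<subseteq> K" "I \<subseteq> M"
        by auto
      have e: "K - I - (M - I) = K - M" "I \<union> (M - I) = M" "(M - I) \<union> (K - M) = K - I"
        using p by auto
      have "shuffle_sign I (M - I) * shuffle_sign (I \<union> (M - I)) (K - M) =
          (shuffle_sign I ((M - I) \<union> (K - M)) * shuffle_sign (M - I) (K - M) :: 'c)"
        using p by (intro shuffle_sign_cocycle) (auto intro: finsub)
      then have "shuffle_sign I (K - I) * shuffle_sign (M - I) (K - M) =
          (shuffle_sign I (M - I) * shuffle_sign M (K - M) :: 'c)"
        by (simp only: e)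
      then show "(case (case p of (M, I) \<Rightarrow> (I, M - I)) of (I, J) \<Rightarrow>
            shuffle_sign I (K - I) * shuffle_sign J (K - I - J) *
            (gcoeff a I * gcoeff b J * gcoeff c (K - I - J))) =
          (case p of (M, I) \<Rightarrow> shuffle_sign I (M - I) * shuffle_sign M (K - M) *
            (gcoeff a I * gcoeff b (M - I) * gcoeff c (K - M)))"
        by (simp only: p prod.case e)
    qed auto
    also have "\<dots> = (\<Sum>I\<in>Pow K. \<Sum>J\<in>Pow (K - I).
            shuffle_sign I (K - I) * shuffle_sign J (K - I - J) *
            (gcoeff a I * gcoeff b J * gcoeff c (K - I - J)))"
      by (rule sum.Sigma[symmetric]) (auto simp: fin)
    also have "\<dots> = gcoeff (a * (b * c)) K"
      by (simp add: gcoeff_mult sum_distrib_left ac_simps)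
    finally show ?thesis .
  qed
qed

lemma grassmann_one_mult:
  fixes a :: "('v :: linorder, 'c :: comm_ring_1) grassmann"
  shows "1 * a = a" and "a * 1 = a"
proof -
  show "1 * a = a"
  proof (rule grassmann_eqI)
    fix K :: "'v set"
    show "gcoeff (1 * a) K = gcoeff a K"
    proof (cases "finite K")
      case True
      have "gcoeff (1 * a) K = (\<Sum>I\<in>Pow K. if I = {} then gcoeff a K else 0)"
        unfolding gcoeff_mult by (rule sum.cong) (auto simp: gcoeff_one)
      then show ?thesis
        using True by simp
    qed (simp add: gcoeff_infinite)
  qed
  show "a * 1 = a"
  proof (rule grassmann_eqI)
    fix K :: "'v set"
    show "gcoeff (a * 1) K = gcoeff a K"
    proof (cases "finite K")
      case True
      have "gcoeff (a * 1) K = (\<Sum>I\<in>Pow K. if I = K then gcoeff a K else 0)"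
        unfolding gcoeff_mult by (rule sum.cong) (auto simp: gcoeff_one)
      then show ?thesis
        using True by simp
    qed (simp add: gcoeff_infinite)
  qed
qed

instance grassmann :: (linorder, comm_ring_1) ring_1
proof
  fix a b c :: "('a, 'b) grassmann"
  show "a * b * c = a * (b * c)"
    by (rule grassmann_mult_assoc)
  show "1 * a = a" "a * 1 = a"
    by (rule grassmann_one_mult)+
  show "(a + b) * c = a * c + b * c"
    by (rule grassmann_eqI) (simp add: gcoeff_mult distrib_right distrib_left sum.distrib)
  show "a * (b + c) = a * b + a * c"
    by (rule grassmann_eqI) (simp add: gcoeff_mult distrib_left sum.distrib)
  have "gcoeff (0 :: ('a, 'b) grassmann) {} \<noteq> gcoeff 1 {}"
    by (simp add: gcoeff_one)
  then show "(0 :: ('a, 'b) grassmann) \<noteq> 1"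
    by metis
qed

lift_definition gconst :: "'c :: zero \<Rightarrow> ('v, 'c) grassmann" is "\<lambda>c I. if I = {} then c else 0"
  by (auto intro: finite_subset[of _ "{{}}"])

text \<open>The left derivative \<open>\<partial>/\<partial>\<eta>\<^sub>v\<close>\<close>

lift_definition eta_deriv ::
    "'v :: linorder \<Rightarrow> ('v, 'c :: comm_ring_1) grassmann \<Rightarrow> ('v, 'c) grassmann"
  is "\<lambda>v f I. if v \<in> I then 0 else shuffle_sign {v} I * f (insert v I)"
proof -
  fix v :: 'v and f :: "'v set \<Rightarrow> 'c"
  assume f: "finite {I. f I \<noteq> 0} \<and> (\<forall>I. f I \<noteq> 0 \<longrightarrow> finite I)"
  have "{I. (if v \<in> I then 0 else shuffle_sign {v} I * f (insert v I)) \<noteq> 0} \<subseteq>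
      (\<lambda>I. I - {v}) ` {I. f I \<noteq> 0}"
  proof
    fix I
    assume "I \<in> {I. (if v \<in> I then 0 else shuffle_sign {v} I * f (insert v I)) \<noteq> 0}"
    then have "v \<notin> I" "f (insert v I) \<noteq> 0"
      by (auto split: if_splits)
    then show "I \<in> (\<lambda>I. I - {v}) ` {I. f I \<noteq> 0}"
      by (intro image_eqI[of _ _ "insert v I"]) auto
  qed
  moreover have "finite I"
    if "(if v \<in> I then 0 else shuffle_sign {v} I * f (insert v I)) \<noteq> 0" for I
  proof -
    have "f (insert v I) \<noteq> 0"
      using that by (auto split: if_splits)
    then show ?thesis
      using f by (metis finite_insert)
  qed
  ultimately show "finite {I. (if v \<in> I then 0 else shuffle_sign {v} I * f (insert v I)) \<noteq> 0} \<and>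
      (\<forall>I. (if v \<in> I then 0 else shuffle_sign {v} I * f (insert v I)) \<noteq> 0 \<longrightarrow> finite I)"
    using f by (meson finite_imageI finite_subset)
qed


section \<open>The dGBV algebra of a Calabi-Yau complete intersection\<close>

text \<open>The variables \<open>y\<^sub>1, \<dots>, y\<^sub>k, x\<^sub>0, \<dots>, x\<^sub>n\<close>, ordered as listed\<close>

datatype var = Y nat | X nat

instantiation var :: linorder
begin

fun less_eq_var :: "var \<Rightarrow> var \<Rightarrow> bool" where
  "less_eq_var (Y i) (Y j) = (i \<le> j)"
| "less_eq_var (Y i) (X j) = True"
| "less_eq_var (X i) (Y j) = False"
| "less_eq_var (X i) (X j) = (i \<le> j)"

definition less_var :: "var \<Rightarrow> var \<Rightarrow> bool" where
  "less_var v w \<longleftrightarrow> v \<le> w \<and> \<not> w \<le> v"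

instance
proof
  fix u v w :: var
  show "(v < w) = (v \<le> w \<and> \<not> w \<le> v)"
    by (simp add: less_var_def)
  show "v \<le> v"
    by (cases v) auto
  show "u \<le> w" if "u \<le> v" "v \<le> w"
    using that by (cases u; cases v; cases w) auto
  show "v = w" if "v \<le> w" "w \<le> v"
    using that by (cases v; cases w) auto
  show "v \<le> w \<or> w \<le> v"
    by (cases v; cases w) auto
qed

end

type_synonym cpoly = "(var \<Rightarrow>\<^sub>0 nat) \<Rightarrow>\<^sub>0 complex"

type_synonym superpoly = "(var, cpoly) grassmann"

definition pvar :: "var \<Rightarrow> cpoly" where
  "pvar v = Poly_Mapping.single (Poly_Mapping.single v 1) 1"

definition peval :: "(var \<Rightarrow> complex) \<Rightarrow> cpoly \<Rightarrow> complex" where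
  "peval x f =
     (\<Sum>m\<in>Poly_Mapping.keys f. Poly_Mapping.lookup f m * (\<Prod>v\<in>Poly_Mapping.keys m. x v ^ Poly_Mapping.lookup m v))"

definition pdiff :: "var \<Rightarrow> cpoly \<Rightarrow> cpoly" where
  "pdiff v f =
     (\<Sum>m\<in>Poly_Mapping.keys f.
        Poly_Mapping.single (m - Poly_Mapping.single v 1) (of_nat (Poly_Mapping.lookup m v) * Poly_Mapping.lookup f m))"

definition homogeneous_in :: "var set \<Rightarrow> nat \<Rightarrow> cpoly \<Rightarrow> bool" where
  "homogeneous_in V d f \<longleftrightarrow>
     (\<forall>m\<in>Poly_Mapping.keys f.
        Poly_Mapping.keys m \<subseteq> V \<and> (\<Sum>v\<in>Poly_Mapping.keys m. Poly_Mapping.lookup m v) = d)"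

text \<open>
  \<open>F\<^sub>1, \<dots>, F\<^sub>k\<close> are homogeneous of positive degrees \<open>d\<^sub>1, \<dots>, d\<^sub>k\<close> in \<open>x\<^sub>0, \<dots>, x\<^sub>n\<close> and cut out a smooth
  subscheme of codimension \<open>k\<close> of projective \<open>n\<close>-space: at every common zero
  \<open>p \<noteq> 0\<close> the gradients of the \<open>F\<^sub>\<ell>\<close> are linearly independent.
\<close>

definition smooth_complete_intersection ::
    "nat \<Rightarrow> nat \<Rightarrow> (nat \<Rightarrow> nat) \<Rightarrow> (nat \<Rightarrow> cpoly) \<Rightarrow> bool" where
  "smooth_complete_intersection n k d F \<longleftrightarrow>
     (\<forall>l\<in>{1..k}. 0 < d l \<and> homogeneous_in (X ` {0..n}) (d l) (F l)) \<and>
     (\<forall>p. (\<exists>j\<in>{0..n}. p (X j) \<noteq> 0) \<longrightarrow> (\<forall>l\<in>{1..k}. peval p (F l) = 0) \<longrightarrow>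
        (\<forall>c. (\<forall>j\<in>{0..n}. (\<Sum>l\<in>{1..k}. c l * peval p (pdiff (X j) (F l))) = 0) \<longrightarrow>
             (\<forall>l\<in>{1..k}. c l = 0)))"

definition qvars :: "nat \<Rightarrow> nat \<Rightarrow> var set" where
  "qvars n k = Y ` {1..k} \<union> X ` {0..n}"

definition dwork_potential :: "nat \<Rightarrow> (nat \<Rightarrow> cpoly) \<Rightarrow> cpoly" where
  "dwork_potential k F = (\<Sum>l\<in>{1..k}. pvar (Y l) * F l)"

definition sp_const :: "complex \<Rightarrow> superpoly" where
  "sp_const c = gconst (Poly_Mapping.single 0 c)"

lift_definition q_deriv :: "var \<Rightarrow> superpoly \<Rightarrow> superpoly" is "\<lambda>v f I. pdiff v (f I)"
proof -
  fix v and f :: "var set \<Rightarrow> cpoly"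
  assume f: "finite {I. f I \<noteq> 0} \<and> (\<forall>I. f I \<noteq> 0 \<longrightarrow> finite I)"
  have "pdiff v (f I) \<noteq> 0 \<Longrightarrow> f I \<noteq> 0" for I
    by (auto simp: pdiff_def)
  moreover from this have "finite {I. pdiff v (f I) \<noteq> 0}"
    using f by (auto intro: finite_subset[of _ "{I. f I \<noteq> 0}"])
  ultimately show "finite {I. pdiff v (f I) \<noteq> 0} \<and> (\<forall>I. pdiff v (f I) \<noteq> 0 \<longrightarrow> finite I)"
    using f by blast
qed

definition BV_Delta :: "nat \<Rightarrow> nat \<Rightarrow> superpoly \<Rightarrow> superpoly" where
  "BV_Delta n k a = (\<Sum>v\<in>qvars n k. q_deriv v (eta_deriv v a))"

definition Q_of :: "nat \<Rightarrow> nat \<Rightarrow> cpoly \<Rightarrow> superpoly \<Rightarrow> superpoly" where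
  "Q_of n k f a = (\<Sum>v\<in>qvars n k. gconst (pdiff v f) * eta_deriv v a)"

text \<open>
  The degree of the monomial \<open>q\<^sup>m \<eta>\<^sub>I\<close> with respect to a grading with \<open>deg q\<^sub>v = g v\<close> and
  \<open>deg \<eta>\<^sub>v = h v\<close>
\<close>

definition mono_deg ::
    "(var \<Rightarrow> int) \<Rightarrow> (var \<Rightarrow> int) \<Rightarrow> (var \<Rightarrow>\<^sub>0 nat) \<Rightarrow> var set \<Rightarrow> int" where
  "mono_deg g h m I = (\<Sum>v\<in>Poly_Mapping.keys m. int (Poly_Mapping.lookup m v) * g v) + (\<Sum>v\<in>I. h v)"

fun charge :: "(nat \<Rightarrow> nat) \<Rightarrow> var \<Rightarrow> int" where
  "charge d (Y l) = - int (d l)"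
| "charge d (X j) = 1"

fun weight :: "var \<Rightarrow> int" where
  "weight (Y l) = 1"
| "weight (X j) = 0"

text \<open>The charge 0 part of the polynomials of degree \<open>j\<close> in \<open>q\<close>, \<open>\<eta>\<close>\<close>

definition CY_alg :: "nat \<Rightarrow> nat \<Rightarrow> (nat \<Rightarrow> nat) \<Rightarrow> int \<Rightarrow> superpoly set" where
  "CY_alg n k d j =
     {a. \<forall>I. \<forall>m\<in>Poly_Mapping.keys (gcoeff a I).
           I \<subseteq> qvars n k \<and> Poly_Mapping.keys m \<subseteq> qvars n k \<and>
           mono_deg (\<lambda>v. 0) (\<lambda>v. - 1) m I = j \<and>
           mono_deg (charge d) (\<lambda>v. - charge d v) m I = 0}"

definition weight_homogeneous :: "int \<Rightarrow> superpoly \<Rightarrow> bool" where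
  "weight_homogeneous r a \<longleftrightarrow>
     (\<forall>I. \<forall>m\<in>Poly_Mapping.keys (gcoeff a I). mono_deg weight (\<lambda>v. 1 - weight v) m I = r)"

text \<open>Homogeneity of weight \<open>r\<close> over \<open>t\<close> and \<open>\<hbar>\<close>, with \<open>wt(t\<^sup>\<rho>) = tw \<rho>\<close> and \<open>wt(\<hbar>) = 1\<close>\<close>

definition series_weight :: "('i \<Rightarrow> int) \<Rightarrow> int \<Rightarrow> ('i, superpoly) mps fps \<Rightarrow> bool" where
  "series_weight tw r w \<longleftrightarrow>
     (\<forall>s m. weight_homogeneous
        (r - int s - (\<Sum>\<rho>\<in>Poly_Mapping.keys m. int (Poly_Mapping.lookup m \<rho>) * tw \<rho>))
        (mps_nth (fps_nth w s) m))"

text \<open>\<open>L = \<Sum>\<rho>. u\<^sub>\<rho> t\<^sup>\<rho>\<close>\<close>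

definition linear_deformation :: "('i :: finite \<Rightarrow> 'b :: ring_1) \<Rightarrow> ('i, 'b) mps" where
  "linear_deformation u = (\<Sum>\<rho>\<in>UNIV. mps_const (u \<rho>) * mps_var \<rho>)"

end

theory Submission
  imports Defs
begin

text \<open>
  Write \<open>D = \<hbar>\<Delta> + Q + [\<Gamma>, \<cdot>]\<close> and \<open>V\<^sub>\<alpha> = \<hbar>\<nabla>\<^sub>\<alpha>\<zeta>\<close>. The operators \<open>\<hbar>\<nabla>\<^sub>\<alpha>\<close> commute, so the
  expansions of \<open>\<hbar>\<nabla>\<^sub>\<beta>V\<^sub>\<alpha>\<close> and \<open>\<hbar>\<nabla>\<^sub>\<alpha>V\<^sub>\<beta>\<close> in the basis of cohomology agree, which is commutativity. If
  \<open>\<hbar>\<nabla>\<^sub>\<gamma>\<close> also commutes with \<open>D\<close>, applying it to the expansion of \<open>\<hbar>\<nabla>\<^sub>\<beta>V\<^sub>\<alpha>\<close> shows that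
  \<open>\<hbar>\<partial>\<^sub>\<gamma>A\<^sub>\<alpha>\<^sub>\<beta> + A\<^sub>\<alpha>\<^sub>\<beta>A\<^sub>\<gamma>\<close> is symmetric in \<open>\<alpha>\<close> and \<open>\<gamma>\<close>; for \<open>A = \<^sup>0A\<close> the coefficients of \<open>\<hbar>\<close> and \<open>1\<close> are
  the potential and the associativity equations.

  For a Calabi-Yau complete intersection \<open>D\<close> and \<open>\<hbar>\<nabla>\<^sub>\<gamma>\<close> commute because elements of degree 0 contain no
  \<open>\<eta>\<close> and are killed by \<open>\<Delta>\<close> and every \<open>Q\<^sub>f\<close>. In the abstract case the Maurer-Cartan equation for
  \<open>\<Delta> + Q\<close> only gives \<open>[D, \<hbar>\<nabla>\<^sub>\<gamma>] = (\<hbar> - 1)\<partial>\<^sub>\<gamma>\<mu>\<close> with \<open>\<mu> = \<Delta>\<Gamma>\<close>, which need not vanish. But \<open>D\<^sup>2 = 0\<close>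
  forces multiplication by \<open>\<partial>\<^sub>\<gamma>\<mu>\<close> to anticommute with \<open>\<Delta>\<close> and \<open>D\<close>, and \<open>D(\<hbar>\<nabla>\<^sub>\<beta>V\<^sub>\<alpha>) = 0\<close> forces
  \<open>\<partial>\<^sub>\<beta>\<mu> V\<^sub>\<alpha> = 0\<close>. Expanding the cocycle \<open>1\<close> in the basis then yields \<open>\<kappa>\<close> of degree -1 with
  \<open>\<partial>\<^sub>\<beta>\<mu> = \<partial>\<^sub>\<beta>\<mu> D\<kappa>\<close>, so multiplication by the constant term of \<open>\<kappa>\<close> contracts the ideal generated by the
  \<open>\<partial>\<^sub>\<beta>\<mu>\<close> for the \<open>\<hbar> = 0\<close> part of \<open>D\<close>. Solving order by order in \<open>\<hbar>\<close>, the error terms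
  \<open>\<partial>\<^sub>\<gamma>\<mu> \<Lambda>\<^sub>\<alpha>\<^sub>\<beta> - \<partial>\<^sub>\<alpha>\<mu> \<Lambda>\<^sub>\<gamma>\<^sub>\<beta>\<close> are coboundaries.

  The Hertling-Manin identity follows from the symmetry of the tensor \<open>\<partial>\<^sub>\<gamma>A\<^sub>\<alpha>\<^sub>\<beta>\<^sup>\<rho>\<close> and the
  derivatives of the associativity law.
\<close>

section \<open>Formal power series\<close>

lemma mps_nth_map [simp]: "mps_nth (mps_map h f) m = h (mps_nth f m)"
  by (simp add: mps_map_def)

lemma mps_nth_const: "mps_nth (mps_const a) m = (if m = 0 then a else 0)"
  by (simp add: mps_const_def)

lemma mps_nth_deriv:
  "mps_nth (mps_deriv \<alpha> f) m =
     of_nat (Suc (Poly_Mapping.lookup m \<alpha>)) * mps_nth f (m + Poly_Mapping.single \<alpha> 1)"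
  by (simp add: mps_deriv_def)

lemma fps_nth_map [simp]: "fps_nth (fps_map h F) n = h (fps_nth F n)"
  by (simp add: fps_map_def)

lemma mps_nth_sum: "mps_nth (sum f S) m = (\<Sum>x\<in>S. mps_nth (f x) m)"
  by (induction S rule: infinite_finite_induct) auto

section \<open>Partial derivatives and the Leibniz rule\<close>

lemma mps_deriv_simps [simp]:
  fixes f g :: "('i, 'a :: ring_1) mps"
  shows "mps_deriv \<alpha> 0 = (0 :: ('i, 'a) mps)"
    and "mps_deriv \<alpha> 1 = (0 :: ('i, 'a) mps)"
    and "mps_deriv \<alpha> (f + g) = mps_deriv \<alpha> f + mps_deriv \<alpha> g"
    and "mps_deriv \<alpha> (f - g) = mps_deriv \<alpha> f - mps_deriv \<alpha> g"
    and "mps_deriv \<alpha> (- f) = - mps_deriv \<alpha> f"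
proof -
  have nz: "m + Poly_Mapping.single \<alpha> (1 :: nat) \<noteq> 0" for m
  proof
    assume "m + Poly_Mapping.single \<alpha> (1 :: nat) = 0"
    then have "Poly_Mapping.lookup (m + Poly_Mapping.single \<alpha> 1) \<alpha> = (0 :: nat)"
      by simp
    then show False
      by (simp add: lookup_add)
  qed
  show "mps_deriv \<alpha> 1 = (0 :: ('i, 'a) mps)"
    using nz by (intro mps_eqI) (simp add: mps_nth_deriv mps_nth_one)
qed (auto intro!: mps_eqI simp: mps_nth_deriv distrib_left right_diff_distrib)

lemma mps_deriv_sum:
  fixes f :: "'x \<Rightarrow> ('i, 'a :: ring_1) mps"
  shows "mps_deriv \<alpha> (sum f S) = (\<Sum>x\<in>S. mps_deriv \<alpha> (f x))"
  by (induction S rule: infinite_finite_induct) auto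

lemma mps_deriv_commute:
  fixes f :: "('i, 'a :: ring_1) mps"
  shows "mps_deriv \<alpha> (mps_deriv \<beta> f) = mps_deriv \<beta> (mps_deriv \<alpha> f)"
proof (rule mps_eqI)
  fix m
  show "mps_nth (mps_deriv \<alpha> (mps_deriv \<beta> f)) m = mps_nth (mps_deriv \<beta> (mps_deriv \<alpha> f)) m"
  proof (cases "\<alpha> = \<beta>")
    case False
    then have "Poly_Mapping.lookup (m + Poly_Mapping.single \<alpha> 1) \<beta> = Poly_Mapping.lookup m \<beta>"
      "Poly_Mapping.lookup (m + Poly_Mapping.single \<beta> 1) \<alpha> = Poly_Mapping.lookup m \<alpha>"
      by (simp_all add: lookup_add lookup_single)
    then show ?thesis
      by (simp only: mps_nth_deriv mult.assoc[symmetric] of_nat_mult[symmetric]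
          ac_simps mult.commute[of "Suc a" "Suc b" for a b])
  qed simp
qed

text \<open>The weight \<open>lookup a \<alpha>\<close> kills every splitting in which \<alpha> does
  not occur in \<open>a\<close>; lowering that exponent by one matches the others with the
  splittings of \<open>m\<close>. This is one half of the Leibniz rule, kept free of commutativity
  by a general \<open>h\<close>.\<close>

lemma sum_splits_shift_left:
  fixes m :: "'i \<Rightarrow>\<^sub>0 nat" and h :: "_ \<Rightarrow> _ \<Rightarrow> 'a :: ring_1"
  shows "(\<Sum>(a, b)\<in>{(a, b). a + b = m + Poly_Mapping.single \<alpha> 1}. of_nat (Poly_Mapping.lookup a \<alpha>) * h a b) =
         (\<Sum>(a, b)\<in>{(a, b). a + b = m}. of_nat (Suc (Poly_Mapping.lookup a \<alpha>)) * h (a +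
             Poly_Mapping.single \<alpha> 1) b)"
proof -
  let ?e = "Poly_Mapping.single \<alpha> (1 :: nat)"
  let ?T = "{(a, b). a + b = m + ?e \<and> Poly_Mapping.lookup a \<alpha> \<noteq> 0}"
  \<comment> \<open>Subtraction of exponents truncates at 0, so it is undone only when \<alpha>
    occurs in \<open>a\<close>.\<close>
  have minus: "a - ?e + ?e = a" if "Poly_Mapping.lookup a \<alpha> \<noteq> 0" for a
    using that by (intro poly_mapping_eqI) (auto simp: lookup_add lookup_minus lookup_single when_def)
  have "(\<Sum>(a, b)\<in>{(a, b). a + b = m + ?e}. of_nat (Poly_Mapping.lookup a \<alpha>) * h a b) =
        (\<Sum>(a, b)\<in>?T. of_nat (Poly_Mapping.lookup a \<alpha>) * h a b)"
    by (rule sum.mono_neutral_right) (auto simp: finite_pm_splits intro!: gr0I)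
  also have "\<dots> = (\<Sum>(a, b)\<in>{(a, b). a + b = m}. of_nat (Suc (Poly_Mapping.lookup a \<alpha>)) * h (a +
      ?e) b)"
  proof (rule sum.reindex_bij_witness[where i = "\<lambda>(a, b). (a + ?e, b)" and j =
      "\<lambda>(a, b). (a - ?e, b)"])
    fix p assume "p \<in> ?T"
    then obtain a b where p: "p = (a, b)" "a + b = m + ?e" "Poly_Mapping.lookup a \<alpha> \<noteq> 0"
      by auto
    have "(a - ?e + b) + ?e = m + ?e"
      using minus[OF p(3)] p(2) by (metis add.assoc add.commute)
    then have "a - ?e + b = m"
      by (rule add_right_imp_eq)
    then show "(case p of (a, b) \<Rightarrow> (a - ?e, b)) \<in> {(a, b). a + b = m}"
      using p by simp
    show "(case case p of (a, b) \<Rightarrow> (a - ?e, b) of (a, b) \<Rightarrow> (a + ?e, b)) = p"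
      using p minus[OF p(3)] by simp
    have "Suc (Poly_Mapping.lookup (a - ?e) \<alpha>) = Poly_Mapping.lookup a \<alpha>"
      using p(3) by (simp add: lookup_minus)
    then show "(case case p of (a, b) \<Rightarrow> (a - ?e, b) of
        (a, b) \<Rightarrow> of_nat (Suc (Poly_Mapping.lookup a \<alpha>)) * h (a + ?e) b) =
        (case p of (a, b) \<Rightarrow> of_nat (Poly_Mapping.lookup a \<alpha>) * h a b)"
      using p minus[OF p(3)] by (simp del: of_nat_Suc)
  qed (auto simp: lookup_add ac_simps)
  finally show ?thesis .
qed

lemma sum_splits_swap:
  fixes m :: "'i \<Rightarrow>\<^sub>0 nat"
  shows "(\<Sum>(a, b)\<in>{(a, b). a + b = m}. h a b) = (\<Sum>(a, b)\<in>{(a, b). a + b = m}. h b a)"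
  by (rule sum.reindex_bij_witness[where i = "\<lambda>(a, b). (b, a)" and j = "\<lambda>(a, b). (b, a)"])
    (auto simp: add.commute)

lemma mps_deriv_mult:
  \<comment> \<open>The exponent of \<alpha> in \<open>a + b\<close> is the sum of its exponents in
    \<open>a\<close> and in \<open>b\<close>; each summand yields one term of the rule after a
    shift.\<close>
  fixes f g :: "('i, 'a :: ring_1) mps"
  shows "mps_deriv \<alpha> (f * g) = mps_deriv \<alpha> f * g + f * mps_deriv \<alpha> g"
proof (rule mps_eqI)
  fix m :: "'i \<Rightarrow>\<^sub>0 nat"
  let ?e = "Poly_Mapping.single \<alpha> (1 :: nat)"
  let ?S = "\<lambda>m. {(a, b). a + b = (m :: 'i \<Rightarrow>\<^sub>0 nat)}"
  let ?t = "\<lambda>a b. mps_nth f a * mps_nth g b"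
  \<comment> \<open>The coefficients need not commute with each other, but integers are
    central.\<close>
  have of_nat_left: "x * (of_nat n * y) = of_nat n * (x * y)" for x y :: 'a and n
    by (metis mult.assoc mult_of_nat_commute)
  have "mps_nth (mps_deriv \<alpha> (f * g)) m =
      (\<Sum>(a, b)\<in>?S (m + ?e). of_nat (Poly_Mapping.lookup (m + ?e) \<alpha>) * ?t a b)"
    by (simp add: mps_nth_deriv mps_nth_mult sum_distrib_left lookup_add case_prod_unfold)
  also have "\<dots> = (\<Sum>(a, b)\<in>?S (m + ?e).
      of_nat (Poly_Mapping.lookup a \<alpha>) * ?t a b + of_nat (Poly_Mapping.lookup b \<alpha>) * ?t a b)"
    by (rule sum.cong) (auto simp: distrib_right[symmetric] lookup_add[symmetric] of_nat_add[symmetric]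
        simp del: of_nat_add)
  also have "\<dots> = (\<Sum>(a, b)\<in>?S (m + ?e). of_nat (Poly_Mapping.lookup a \<alpha>) * ?t a b) +
      (\<Sum>(a, b)\<in>?S (m + ?e). of_nat (Poly_Mapping.lookup b \<alpha>) * ?t a b)"
    by (simp add: sum.distrib case_prod_unfold)
  also have "(\<Sum>(a, b)\<in>?S (m + ?e). of_nat (Poly_Mapping.lookup b \<alpha>) * ?t a b) =
      (\<Sum>(b, a)\<in>?S (m + ?e). of_nat (Poly_Mapping.lookup b \<alpha>) * ?t a b)"
    by (rule sum_splits_swap)
  also have "\<dots> = (\<Sum>(b, a)\<in>?S m. of_nat (Suc (Poly_Mapping.lookup b \<alpha>)) * ?t a (b + ?e))"
    by (rule sum_splits_shift_left)
  also have "\<dots> = (\<Sum>(a, b)\<in>?S m. of_nat (Suc (Poly_Mapping.lookup b \<alpha>)) * ?t a (b + ?e))"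
    by (rule sum_splits_swap)
  also have "\<dots> = mps_nth (f * mps_deriv \<alpha> g) m"
    by (simp add: mps_nth_mult mps_nth_deriv of_nat_left del: of_nat_Suc)
  also have "(\<Sum>(a, b)\<in>?S (m + ?e). of_nat (Poly_Mapping.lookup a \<alpha>) * ?t a b) =
      (\<Sum>(a, b)\<in>?S m. of_nat (Suc (Poly_Mapping.lookup a \<alpha>)) * ?t (a + ?e) b)"
    by (rule sum_splits_shift_left)
  also have "\<dots> = mps_nth (mps_deriv \<alpha> f * g) m"
    by (simp add: mps_nth_mult mps_nth_deriv mult.assoc del: of_nat_Suc)
  finally show "mps_nth (mps_deriv \<alpha> (f * g)) m = mps_nth (mps_deriv \<alpha> f * g + f * mps_deriv \<alpha> g) m"
    by simp
qed

lemma fps_map_deriv_mult: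
  fixes v w :: "('i, 'a :: ring_1) mps fps"
  shows "fps_map (mps_deriv \<alpha>) (v * w) = fps_map (mps_deriv \<alpha>) v * w + v * fps_map (mps_deriv \<alpha>) w"
  by (rule fps_ext) (simp add: fps_mult_nth mps_deriv_sum mps_deriv_mult sum.distrib)

text \<open>Both sides run over the ordered decompositions of \<open>m\<close> into three exponent
  vectors. An arbitrary \<phi> allows trilinear expressions such as brackets, which are not iterated
  products.\<close>

lemma sum_splits_assoc:
  fixes m :: "'i \<Rightarrow>\<^sub>0 nat" and \<phi> :: "_ \<Rightarrow> _ \<Rightarrow> _ \<Rightarrow> 'a :: comm_monoid_add"
  shows "(\<Sum>(s, c)\<in>{(s, c). s + c = m}. \<Sum>(a, b)\<in>{(a, b). a + b = s}. \<phi> a b c) =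
         (\<Sum>(a, s)\<in>{(a, s). a + s = m}. \<Sum>(b, c)\<in>{(b, c). b + c = s}. \<phi> a b c)"
proof -
  let ?S = "\<lambda>m. {(a, b). a + b = (m :: 'i \<Rightarrow>\<^sub>0 nat)}"
  have "(\<Sum>(s, c)\<in>?S m. \<Sum>(a, b)\<in>?S s. \<phi> a b c) =
      (\<Sum>p\<in>?S m. \<Sum>q\<in>?S (fst p). \<phi> (fst q) (snd q) (snd p))"
    by (simp add: case_prod_unfold)
  also have "\<dots> = (\<Sum>(p, q)\<in>(SIGMA p:?S m. ?S (fst p)). \<phi> (fst q) (snd q) (snd p))"
    by (rule sum.Sigma) (auto simp: finite_pm_splits)
  also have "\<dots> = (\<Sum>(p, q)\<in>(SIGMA p:?S m. ?S (snd p)). \<phi> (fst p) (fst q) (snd q))"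
    by (rule sum.reindex_bij_witness[
          where i = "\<lambda>(p, q). ((fst p + fst q, snd q), (fst p, fst q))"
            and j = "\<lambda>(p, q). ((fst q, snd q + snd p), (snd q, snd p))"])
      (auto simp: ac_simps)
  also have "\<dots> = (\<Sum>p\<in>?S m. \<Sum>q\<in>?S (snd p). \<phi> (fst p) (fst q) (snd q))"
    by (rule sum.Sigma[symmetric]) (auto simp: finite_pm_splits)
  also have "\<dots> = (\<Sum>(a, s)\<in>?S m. \<Sum>(b, c)\<in>?S s. \<phi> a b c)"
    by (simp add: case_prod_unfold)
  finally show ?thesis .
qed

lemma sum_splits_left_commute:
  fixes m :: "'i \<Rightarrow>\<^sub>0 nat" and \<phi> :: "_ \<Rightarrow> _ \<Rightarrow> _ \<Rightarrow> 'a :: comm_monoid_add"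
  shows "(\<Sum>(b, s)\<in>{(b, s). b + s = m}. \<Sum>(a, c)\<in>{(a, c). a + c = s}. \<phi> a b c) =
         (\<Sum>(a, s)\<in>{(a, s). a + s = m}. \<Sum>(b, c)\<in>{(b, c). b + c = s}. \<phi> a b c)"
proof -
  let ?S = "\<lambda>m. {(a, b). a + b = (m :: 'i \<Rightarrow>\<^sub>0 nat)}"
  have "(\<Sum>(b, s)\<in>?S m. \<Sum>(a, c)\<in>?S s. \<phi> a b c) = (\<Sum>(s, c)\<in>?S m. \<Sum>(b, a)\<in>?S s. \<phi> a b c)"
    by (rule sum_splits_assoc[symmetric])
  also have "\<dots> = (\<Sum>(s, c)\<in>?S m. \<Sum>(a, b)\<in>?S s. \<phi> a b c)"
    by (intro sum.cong refl) (auto intro!: sum_splits_swap)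
  finally show ?thesis
    by (simp add: sum_splits_assoc)
qed

section \<open>F-manifolds from symmetric structure constants\<close>

definition vf_product ::
    "('i :: finite \<Rightarrow> 'i \<Rightarrow> 'i \<Rightarrow> ('i, complex) mps) \<Rightarrow> 'i vfield \<Rightarrow> 'i vfield \<Rightarrow> 'i vfield" where
  "vf_product a U V = (\<lambda>\<rho>. \<Sum>\<alpha>\<in>UNIV. \<Sum>\<beta>\<in>UNIV. U \<alpha> * V \<beta> * a \<alpha> \<beta> \<rho>)"

text \<open>Covariant derivative of the flat connection for which the coordinate fields are
  parallel; its antisymmetrization is \<open>vf_bracket\<close>.\<close>

definition vf_deriv :: "'i :: finite vfield \<Rightarrow> 'i vfield \<Rightarrow> 'i vfield" where
  "vf_deriv T U = (\<lambda>\<rho>. \<Sum>\<alpha>\<in>UNIV. T \<alpha> * mps_deriv \<alpha> (U \<rho>))"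

text \<open>The covariant derivative along \<open>T\<close> of the product, seen as a (1,2)-tensor,
  evaluated at \<open>U\<close> and \<open>V\<close>.\<close>

definition vf_struct_deriv ::
    "('i :: finite \<Rightarrow> 'i \<Rightarrow> 'i \<Rightarrow> ('i, complex) mps) \<Rightarrow> 'i vfield \<Rightarrow> 'i vfield \<Rightarrow> 'i vfield \<Rightarrow> 'i vfield" where
  "vf_struct_deriv a T U V = (\<lambda>\<rho>. \<Sum>\<gamma>\<in>UNIV. \<Sum>\<alpha>\<in>UNIV. \<Sum>\<beta>\<in>UNIV. T \<gamma> * U \<alpha> * V \<beta> * mps_deriv \<gamma> (a \<alpha> \<beta> \<rho>))"

text \<open>Together with \<open>sym\<close>, the axiom \<open>potential\<close> is the
  integrability condition for the \<open>a \<alpha> \<beta> \<rho>\<close> to be second derivatives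
  of a vector potential.\<close>

locale potential_structure =
  fixes a :: "'i :: finite \<Rightarrow> 'i \<Rightarrow> 'i \<Rightarrow> ('i, complex) mps"
  assumes sym: "a \<alpha> \<beta> \<rho> = a \<beta> \<alpha> \<rho>"
    and assoc: "(\<Sum>\<rho>\<in>UNIV. a \<alpha> \<beta> \<rho> * a \<rho> \<gamma> \<delta>) = (\<Sum>\<rho>\<in>UNIV. a \<beta> \<gamma> \<rho> * a \<rho> \<alpha> \<delta>)"
    and potential: "mps_deriv \<alpha> (a \<gamma> \<beta> \<rho>) = mps_deriv \<gamma> (a \<alpha> \<beta> \<rho>)"
begin

abbreviation p where "p \<equiv> vf_product a"
abbreviation C where "C \<equiv> vf_struct_deriv a"

lemma p_commute: "p U V = p V U"
proof
  fix \<rho>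
  show "p U V \<rho> = p V U \<rho>"
    unfolding vf_product_def
    by (subst sum.swap) (intro sum.cong refl, metis sym mult.commute)
qed

lemma p_linear:
  "p (\<lambda>\<rho>. U \<rho> + U' \<rho>) V = (\<lambda>\<rho>. p U V \<rho> + p U' V \<rho>)"
  "p (\<lambda>\<rho>. U \<rho> - U' \<rho>) V = (\<lambda>\<rho>. p U V \<rho> - p U' V \<rho>)"
  "p V (\<lambda>\<rho>. U \<rho> + U' \<rho>) = (\<lambda>\<rho>. p V U \<rho> + p V U' \<rho>)"
  "p V (\<lambda>\<rho>. U \<rho> - U' \<rho>) = (\<lambda>\<rho>. p V U \<rho> - p V U' \<rho>)"
  "p (\<lambda>\<rho>. f * U \<rho>) V = (\<lambda>\<rho>. f * p U V \<rho>)"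
  "p V (\<lambda>\<rho>. f * U \<rho>) = (\<lambda>\<rho>. f * p V U \<rho>)"
  by (auto simp: vf_product_def sum.distrib sum_subtractf algebra_simps sum_distrib_left)

lemma p_coord: "p (vf_coord \<alpha>) (vf_coord \<beta>) = (\<lambda>\<rho>. a \<alpha> \<beta> \<rho>)"
proof
  fix \<rho>
  have "(\<Sum>\<beta>'\<in>UNIV. vf_coord \<alpha> \<alpha>' * vf_coord \<beta> \<beta>' * a \<alpha>' \<beta>' \<rho>) =
      (if \<alpha>' = \<alpha> then a \<alpha> \<beta> \<rho> else 0)" for \<alpha>'
    by (simp add: vf_coord_def if_distrib[of "\<lambda>x. x * _"] cong: if_cong)
  then show "p (vf_coord \<alpha>) (vf_coord \<beta>) \<rho> = a \<alpha> \<beta> \<rho>"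
    by (simp add: vf_product_def)
qed

lemma p_assoc: "p (p U V) Z = p U (p V Z)"
proof
  fix \<delta>
  have l: "p (p U V) Z \<delta> = (\<Sum>\<alpha>\<in>UNIV. \<Sum>\<beta>\<in>UNIV. \<Sum>\<gamma>\<in>UNIV. U \<alpha> * V \<beta> * Z \<gamma> * (\<Sum>\<rho>\<in>UNIV. a \<alpha> \<beta> \<rho> * a \<rho> \<gamma> \<delta>))"
    for U V Z
  proof -
    have "p (p U V) Z \<delta> = (\<Sum>\<rho>\<in>UNIV. \<Sum>\<gamma>\<in>UNIV. \<Sum>\<alpha>\<in>UNIV. \<Sum>\<beta>\<in>UNIV. U \<alpha> * V \<beta> * Z \<gamma> * (a \<alpha> \<beta> \<rho> * a \<rho> \<gamma> \<delta>))"
      by (simp add: vf_product_def sum_distrib_left sum_distrib_right ac_simps)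
    also have "\<dots> = (\<Sum>(\<rho>, \<gamma>, \<alpha>, \<beta>)\<in>UNIV. U \<alpha> * V \<beta> * Z \<gamma> * (a \<alpha> \<beta> \<rho> * a \<rho> \<gamma> \<delta>))"
      by (simp add: sum.cartesian_product)
    also have "\<dots> = (\<Sum>(\<alpha>, \<beta>, \<gamma>, \<rho>)\<in>UNIV. U \<alpha> * V \<beta> * Z \<gamma> * (a \<alpha> \<beta> \<rho> * a \<rho> \<gamma> \<delta>))"
      by (rule sum.reindex_bij_witness[where i = "\<lambda>(\<alpha>, \<beta>, \<gamma>, \<rho>). (\<rho>, \<gamma>, \<alpha>, \<beta>)"
            and j = "\<lambda>(\<rho>, \<gamma>, \<alpha>, \<beta>). (\<alpha>, \<beta>, \<gamma>, \<rho>)"]) auto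
    finally show ?thesis
      by (simp add: sum.cartesian_product sum_distrib_left)
  qed
  \<comment> \<open>After this swap the expansion \<open>l\<close> covers both bracketings, and
    \<open>assoc\<close> compares the two coefficients.\<close>
  have "p U (p V Z) \<delta> = p (p V Z) U \<delta>"
    by (simp add: p_commute)
  also have "\<dots> = (\<Sum>\<beta>\<in>UNIV. \<Sum>\<gamma>\<in>UNIV. \<Sum>\<alpha>\<in>UNIV. U \<alpha> * V \<beta> * Z \<gamma> * (\<Sum>\<rho>\<in>UNIV. a \<alpha> \<beta> \<rho> * a \<rho> \<gamma> \<delta>))"
    unfolding l by (intro sum.cong refl) (simp add: assoc ac_simps)
  also have "\<dots> = (\<Sum>\<alpha>\<in>UNIV. \<Sum>\<beta>\<in>UNIV. \<Sum>\<gamma>\<in>UNIV. U \<alpha> * V \<beta> * Z \<gamma> * (\<Sum>\<rho>\<in>UNIV. a \<alpha> \<beta> \<rho> * a \<rho> \<gamma> \<delta>))"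
    by (subst sum.swap[of _ UNIV]) (subst sum.swap[of _ UNIV], rule refl)
  finally show "p (p U V) Z \<delta> = p U (p V Z) \<delta>"
    by (simp add: l)
qed

text \<open>The first transposition comes from \<open>sym\<close>, the second from
  \<open>potential\<close>. They generate all permutations, so \<open>C\<close> is totally
  symmetric.\<close>

lemma C_commute: "C T U V = C T V U" "C T U V = C U T V"
proof -
  show "C T U V = C T V U"
    unfolding vf_struct_deriv_def
  proof (rule ext, rule sum.cong[OF refl])
    fix \<rho> \<gamma>
    have "(\<Sum>\<alpha>\<in>UNIV. \<Sum>\<beta>\<in>UNIV. T \<gamma> * U \<alpha> * V \<beta> * mps_deriv \<gamma> (a \<alpha> \<beta> \<rho>)) =
        (\<Sum>\<beta>\<in>UNIV. \<Sum>\<alpha>\<in>UNIV. T \<gamma> * U \<alpha> * V \<beta> * mps_deriv \<gamma> (a \<alpha> \<beta> \<rho>))"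
      by (rule sum.swap)
    also have "\<dots> = (\<Sum>\<beta>\<in>UNIV. \<Sum>\<alpha>\<in>UNIV. T \<gamma> * V \<beta> * U \<alpha> * mps_deriv \<gamma> (a \<beta> \<alpha> \<rho>))"
    proof (intro sum.cong refl)
      fix \<beta> \<alpha>
      show "T \<gamma> * U \<alpha> * V \<beta> * mps_deriv \<gamma> (a \<alpha> \<beta> \<rho>) = T \<gamma> * V \<beta> * U \<alpha> * mps_deriv \<gamma> (a \<beta> \<alpha> \<rho>)"
        by (simp add: sym[of \<alpha> \<beta>] ac_simps)
    qed
    finally show "(\<Sum>\<alpha>\<in>UNIV. \<Sum>\<beta>\<in>UNIV. T \<gamma> * U \<alpha> * V \<beta> * mps_deriv \<gamma> (a \<alpha> \<beta> \<rho>)) =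
        (\<Sum>\<alpha>\<in>UNIV. \<Sum>\<beta>\<in>UNIV. T \<gamma> * V \<alpha> * U \<beta> * mps_deriv \<gamma> (a \<alpha> \<beta> \<rho>))" .
  qed
  show "C T U V = C U T V"
    unfolding vf_struct_deriv_def
  proof (intro ext)
    fix \<rho>
    have "(\<Sum>\<gamma>\<in>UNIV. \<Sum>\<alpha>\<in>UNIV. \<Sum>\<beta>\<in>UNIV. T \<gamma> * U \<alpha> * V \<beta> * mps_deriv \<gamma> (a \<alpha> \<beta> \<rho>)) =
        (\<Sum>\<alpha>\<in>UNIV. \<Sum>\<gamma>\<in>UNIV. \<Sum>\<beta>\<in>UNIV. T \<gamma> * U \<alpha> * V \<beta> * mps_deriv \<gamma> (a \<alpha> \<beta> \<rho>))"
      by (rule sum.swap)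
    also have "\<dots> = (\<Sum>\<alpha>\<in>UNIV. \<Sum>\<gamma>\<in>UNIV. \<Sum>\<beta>\<in>UNIV. U \<alpha> * T \<gamma> * V \<beta> * mps_deriv \<alpha> (a \<gamma> \<beta> \<rho>))"
    proof (intro sum.cong refl)
      fix \<alpha> \<gamma> \<beta>
      show "T \<gamma> * U \<alpha> * V \<beta> * mps_deriv \<gamma> (a \<alpha> \<beta> \<rho>) = U \<alpha> * T \<gamma> * V \<beta> * mps_deriv \<alpha> (a \<gamma> \<beta> \<rho>)"
        by (simp add: potential[of \<gamma> \<alpha>] ac_simps)
    qed
    finally show "(\<Sum>\<gamma>\<in>UNIV. \<Sum>\<alpha>\<in>UNIV. \<Sum>\<beta>\<in>UNIV. T \<gamma> * U \<alpha> * V \<beta> * mps_deriv \<gamma> (a \<alpha> \<beta> \<rho>)) =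
        (\<Sum>\<gamma>\<in>UNIV. \<Sum>\<alpha>\<in>UNIV. \<Sum>\<beta>\<in>UNIV. U \<gamma> * T \<alpha> * V \<beta> * mps_deriv \<gamma> (a \<alpha> \<beta> \<rho>))" .
  qed
qed

lemma vf_deriv_p:
  "vf_deriv T (p U V) = (\<lambda>\<rho>. C T U V \<rho> + p (vf_deriv T U) V \<rho> + p U (vf_deriv T V) \<rho>)"
proof
  fix \<rho>
  have "vf_deriv T (p U V) \<rho> =
      C T U V \<rho> +
      (\<Sum>\<gamma>\<in>UNIV. \<Sum>\<alpha>\<in>UNIV. \<Sum>\<beta>\<in>UNIV. (T \<gamma> * mps_deriv \<gamma> (U \<alpha>)) * V \<beta> * a \<alpha> \<beta> \<rho>) +
      (\<Sum>\<gamma>\<in>UNIV. \<Sum>\<alpha>\<in>UNIV. \<Sum>\<beta>\<in>UNIV. U \<alpha> * (T \<gamma> * mps_deriv \<gamma> (V \<beta>)) * a \<alpha> \<beta> \<rho>)"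
    by (simp add: vf_deriv_def vf_product_def vf_struct_deriv_def mps_deriv_sum mps_deriv_mult
        sum_distrib_left sum.distrib[symmetric] algebra_simps)
  also have "(\<Sum>\<gamma>\<in>UNIV. \<Sum>\<alpha>\<in>UNIV. \<Sum>\<beta>\<in>UNIV. (T \<gamma> * mps_deriv \<gamma> (U \<alpha>)) * V \<beta> * a \<alpha> \<beta> \<rho>) =
      p (vf_deriv T U) V \<rho>"
    unfolding vf_product_def vf_deriv_def sum_distrib_right
    by (subst sum.swap) (intro sum.cong refl sum.swap)
  also have "(\<Sum>\<gamma>\<in>UNIV. \<Sum>\<alpha>\<in>UNIV. \<Sum>\<beta>\<in>UNIV. U \<alpha> * (T \<gamma> * mps_deriv \<gamma> (V \<beta>)) * a \<alpha> \<beta> \<rho>) =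
      p U (vf_deriv T V) \<rho>"
    unfolding vf_product_def vf_deriv_def sum_distrib_right sum_distrib_left
    by (subst sum.swap) (intro sum.cong refl sum.swap)
  finally show "vf_deriv T (p U V) \<rho> = C T U V \<rho> + p (vf_deriv T U) V \<rho> + p U (vf_deriv T V) \<rho>" .
qed

lemma vf_bracket_eq: "vf_bracket U V = (\<lambda>\<rho>. vf_deriv U V \<rho> - vf_deriv V U \<rho>)"
  by (simp add: vf_bracket_def vf_deriv_def sum_subtractf)

text \<open>Differentiate the associativity law along \<open>T\<close> by \<open>vf_deriv_p\<close>.
  The terms in which a vector field is differentiated agree by \<open>p_assoc\<close>, leaving those
  in which the structure constants are.\<close>

lemma C_assoc: "C T (p U V) Z \<rho> + p (C T U V) Z \<rho> = C T U (p V Z) \<rho> + p U (C T V Z) \<rho>"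
proof -
  have "vf_deriv T (p (p U V) Z) \<rho> = C T (p U V) Z \<rho> +
      (p (C T U V) Z \<rho> + p (p (vf_deriv T U) V) Z \<rho> + p (p U (vf_deriv T V)) Z \<rho>) + p (p U V)
          (vf_deriv T Z) \<rho>"
    by (simp only: vf_deriv_p p_linear)
  moreover have "vf_deriv T (p U (p V Z)) \<rho> = C T U (p V Z) \<rho> + p (vf_deriv T U) (p V Z) \<rho> +
      (p U (C T V Z) \<rho> + p U (p (vf_deriv T V) Z) \<rho> + p U (p V (vf_deriv T Z)) \<rho>)"
    by (simp only: vf_deriv_p p_linear)
  ultimately show ?thesis
    by (simp add: p_assoc)
qed

lemma p_left_commute: "p U (p V Z) = p V (p U Z)"
  by (metis p_assoc p_commute)

text \<open>Brackets are written through \<open>vf_deriv\<close>. By the product rule all terms with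
  derivatives of the fields cancel, and only values of \<open>C\<close> remain.\<close>

lemma hertling_manin:
  "vf_bracket (p U V) (p Z W) \<rho>
        - p (vf_bracket (p U V) Z) W \<rho> - p Z (vf_bracket (p U V) W) \<rho>
        - p U (vf_bracket V (p Z W)) \<rho> + p U (p (vf_bracket V Z) W) \<rho> + p U (p Z (vf_bracket V W)) \<rho>
        - p V (vf_bracket U (p Z W)) \<rho> + p V (p (vf_bracket U Z) W) \<rho> + p V (p Z (vf_bracket U W)) \<rho>
        = 0"
proof -
  have 1: "C W (p U V) Z \<rho> + p (C W U V) Z \<rho> = C W U (p V Z) \<rho> + p U (C W V Z) \<rho>"
    and 2: "C U (p V Z) W \<rho> + p (C U V Z) W \<rho> = C U V (p Z W) \<rho> + p V (C U Z W) \<rho>"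
    by (rule C_assoc)+
  have s: "C W (p U V) Z = C (p U V) Z W" "C U V (p Z W) = C (p Z W) U V"
    "C W U (p V Z) = C U (p V Z) W" "C W V Z = C V Z W" "C U V Z = C Z U V"
    by (metis C_commute)+
  \<comment> \<open>This is the sum of \<open>1\<close> and \<open>2\<close>: the terms
    \<open>C W U (p V Z)\<close> and \<open>C U (p V Z) W\<close> agree by total symmetry and
    cancel.\<close>
  have "C (p U V) Z W \<rho> - C (p Z W) U V \<rho> + p (C W U V) Z \<rho> + p (C Z U V) W \<rho>
      - p U (C V Z W) \<rho> - p V (C U Z W) \<rho> = 0"
    using 1 2 unfolding s by (simp add: algebra_simps)
  then show ?thesis
    by (simp add: vf_bracket_eq vf_deriv_p p_linear p_assoc p_left_commute p_commute
        C_commute(1)[of _ W Z] algebra_simps)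
qed

lemma formal_F_manifold_vf_product: "formal_F_manifold p"
  unfolding formal_F_manifold_def
  by (intro conjI allI) (rule p_assoc p_commute p_linear hertling_manin)+

end

lemma vf_expand: "(U :: 'i :: finite vfield) = (\<lambda>\<rho>. \<Sum>\<alpha>\<in>UNIV. U \<alpha> * vf_coord \<alpha> \<rho>)"
  by (rule ext) (simp add: vf_coord_def if_distrib[of "(*) _"] cong: if_cong)

text \<open>Bilinearity over the power series determines a product from its values on the finitely
  many coordinate fields.\<close>

lemma formal_F_manifold_unique:
  assumes p: "formal_F_manifold p"
    and coord: "\<And>\<alpha> \<beta>. p (vf_coord \<alpha>) (vf_coord \<beta>) = (\<lambda>\<rho>. a \<alpha> \<beta> \<rho>)"
  shows "p = vf_product a"
proof (intro ext)
  fix U V :: "'a vfield" and \<rho>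
  have add: "p (\<lambda>\<rho>. U \<rho> + U' \<rho>) V = (\<lambda>\<rho>. p U V \<rho> + p U' V \<rho>)"
    and scale: "p (\<lambda>\<rho>. f * U \<rho>) V = (\<lambda>\<rho>. f * p U V \<rho>)"
    and comm: "p U V = p V U" for U U' V f
    using p unfolding formal_F_manifold_def by blast+
  have zero: "p (\<lambda>\<rho>. 0) V = (\<lambda>\<rho>. 0)" for V
    using scale[of 0 "\<lambda>\<rho>. 0" V] by simp
  have "p (\<lambda>\<rho>. \<Sum>\<alpha>\<in>S. U \<alpha> * T \<alpha> \<rho>) V = (\<lambda>\<rho>. \<Sum>\<alpha>\<in>S. U \<alpha> * p (T \<alpha>) V \<rho>)"
    if "finite S" for S :: "'a set" and U T V
    using that by (induction S) (simp_all add: zero add scale)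
  then have lin: "p U V = (\<lambda>\<rho>. \<Sum>\<alpha>\<in>UNIV. U \<alpha> * p (vf_coord \<alpha>) V \<rho>)" for U V
    by (subst vf_expand[of U]) simp
  \<comment> \<open>\<open>lin\<close> expands the first argument only; commutativity gives the
    expansion of the second.\<close>
  have "p U V \<rho> = (\<Sum>\<alpha>\<in>UNIV. U \<alpha> * p V (vf_coord \<alpha>) \<rho>)"
    by (subst lin) (simp add: comm)
  also have "\<dots> = (\<Sum>\<alpha>\<in>UNIV. U \<alpha> * (\<Sum>\<beta>\<in>UNIV. V \<beta> * a \<alpha> \<beta> \<rho>))"
    by (subst lin[of V]) (simp add: comm[of "vf_coord _" "vf_coord _"] coord[symmetric])
  also have "\<dots> = vf_product a U V \<rho>"
    by (simp add: vf_product_def sum_distrib_left mult.assoc)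
  finally show "p U V \<rho> = vf_product a U V \<rho>" .
qed

section \<open>The twisted differential and the connection\<close>

definition graded_linear :: "(complex \<Rightarrow> 'b :: ring_1) \<Rightarrow> (int \<Rightarrow> 'b set) \<Rightarrow> ('b \<Rightarrow> 'b) \<Rightarrow> bool" where
  "graded_linear cst G K \<longleftrightarrow>
     (\<forall>j. \<forall>a\<in>G j. \<forall>b\<in>G j. K (a + b) = K a + K b) \<and>
     (\<forall>j c. \<forall>a\<in>G j. K (cst c * a) = cst c * K a)"

lemma degree_one_map_graded_linear: "degree_one_map cst G K \<Longrightarrow> graded_linear cst G K"
  by (simp add: degree_one_map_def graded_linear_def)

text \<open>Common ground of abstract dGBV algebras and superpolynomials. Centrality of the degree 0
  part takes the place of super-commutativity: scalars, \<Gamma> and its derivatives all have degree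
  0.\<close>

locale even_central =
  fixes cst :: "complex \<Rightarrow> 'b :: ring_1" and G :: "int \<Rightarrow> 'b set"
  assumes cst_one: "cst 1 = 1"
    and cst_add: "cst (c + c') = cst c + cst c'"
    and cst_mult: "cst (c * c') = cst c * cst c'"
    and zero_in: "0 \<in> G j"
    and add_in: "a \<in> G j \<Longrightarrow> b \<in> G j \<Longrightarrow> a + b \<in> G j"
    and scale_in: "a \<in> G j \<Longrightarrow> cst c * a \<in> G j"
    and one_in: "1 \<in> G 0"
    and mult_in: "a \<in> G i \<Longrightarrow> b \<in> G j \<Longrightarrow> a * b \<in> G (i + j)"
    and even_commute: "a \<in> G 0 \<Longrightarrow> b \<in> G j \<Longrightarrow> a * b = b * a"
begin

lemma cst_zero: "cst 0 = 0"
  using cst_add[of 0 0] by simp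

lemma cst_minus_one: "cst (- 1) = - 1"
  using cst_add[of "- 1" 1] by (simp add: cst_zero cst_one eq_neg_iff_add_eq_0)

lemma cst_of_nat: "cst (of_nat n) = of_nat n"
  by (induction n) (simp_all add: cst_zero cst_one cst_add)

lemma uminus_in: "a \<in> G j \<Longrightarrow> - a \<in> G j"
  using scale_in[of a j "- 1"] by (simp add: cst_minus_one)

lemma diff_in: "a \<in> G j \<Longrightarrow> b \<in> G j \<Longrightarrow> a - b \<in> G j"
  using add_in[OF _ uminus_in] by fastforce

lemma cst_in: "cst c \<in> G 0"
  using scale_in[OF one_in] by simp

lemma sum_in: "(\<And>x. x \<in> S \<Longrightarrow> f x \<in> G j) \<Longrightarrow> sum f S \<in> G j"
  by (induction S rule: infinite_finite_induct) (simp_all add: zero_in add_in)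

lemma of_nat_mult_in: "a \<in> G j \<Longrightarrow> of_nat n * a \<in> G j"
  by (metis cst_of_nat scale_in)

section \<open>Power series with coefficients in a fixed degree\<close>

lemma mser_zero: "0 \<in> mser G j"
  by (simp add: mser_def zero_in)

lemma mser_one: "1 \<in> mser G 0"
  by (simp add: mser_def mps_nth_one zero_in one_in)

lemma mser_add: "f \<in> mser G j \<Longrightarrow> g \<in> mser G j \<Longrightarrow> f + g \<in> mser G j"
  by (simp add: mser_def add_in)

lemma mser_uminus: "f \<in> mser G j \<Longrightarrow> - f \<in> mser G j"
  by (simp add: mser_def uminus_in)

lemma mser_diff: "f \<in> mser G j \<Longrightarrow> g \<in> mser G j \<Longrightarrow> f - g \<in> mser G j"
  by (simp add: mser_def diff_in)

lemma mser_sum: "(\<And>x. x \<in> S \<Longrightarrow> f x \<in> mser G j) \<Longrightarrow> sum f S \<in> mser G j"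
  by (induction S rule: infinite_finite_induct) (simp_all add: mser_zero mser_add)

lemma mser_mult: "f \<in> mser G i \<Longrightarrow> g \<in> mser G j \<Longrightarrow> f * g \<in> mser G (i + j)"
  by (auto simp: mser_def mps_nth_mult intro!: sum_in mult_in)

lemma mser_mult0: "f \<in> mser G 0 \<Longrightarrow> g \<in> mser G j \<Longrightarrow> f * g \<in> mser G j"
  using mser_mult[of f 0 g j] by simp

lemma mser_deriv: "f \<in> mser G j \<Longrightarrow> mps_deriv \<alpha> f \<in> mser G j"
  by (simp add: mser_def mps_nth_deriv of_nat_mult_in del: of_nat_Suc)

lemma mser_commute: "f \<in> mser G 0 \<Longrightarrow> g \<in> mser G j \<Longrightarrow> f * g = g * f"
  unfolding mser_def
  by (intro mps_eqI, unfold mps_nth_mult, subst (2) sum_splits_swap)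
    (auto intro!: sum.cong even_commute)

lemma mser_map_cst: "mps_map cst r \<in> mser G 0"
  by (simp add: mser_def cst_in)

lemma hser_zero: "0 \<in> hser G j"
  by (simp add: hser_def mser_zero)

lemma hser_add: "v \<in> hser G j \<Longrightarrow> w \<in> hser G j \<Longrightarrow> v + w \<in> hser G j"
  by (simp add: hser_def mser_add)

lemma hser_uminus: "v \<in> hser G j \<Longrightarrow> - v \<in> hser G j"
  by (simp add: hser_def mser_uminus)

lemma hser_diff: "v \<in> hser G j \<Longrightarrow> w \<in> hser G j \<Longrightarrow> v - w \<in> hser G j"
  by (simp add: hser_def mser_diff)

lemma hser_sum: "(\<And>x. x \<in> S \<Longrightarrow> f x \<in> hser G j) \<Longrightarrow> sum f S \<in> hser G j"
  by (induction S rule: infinite_finite_induct) (simp_all add: hser_zero hser_add)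

lemma hser_mult: "v \<in> hser G i \<Longrightarrow> w \<in> hser G j \<Longrightarrow> v * w \<in> hser G (i + j)"
  by (simp add: hser_def fps_mult_nth mser_sum mser_mult)

lemma hser_mult0: "v \<in> hser G 0 \<Longrightarrow> w \<in> hser G j \<Longrightarrow> v * w \<in> hser G j"
  using hser_mult[of v 0 w j] by simp

lemma hser_const: "f \<in> mser G j \<Longrightarrow> fps_const f \<in> hser G j"
  by (simp add: hser_def mser_zero)

lemma hser_X_mult: "w \<in> hser G j \<Longrightarrow> fps_X * w \<in> hser G j"
  by (simp add: hser_def mser_zero)

lemma hser_map_deriv: "w \<in> hser G j \<Longrightarrow> fps_map (mps_deriv \<alpha>) w \<in> hser G j"
  by (simp add: hser_def mser_deriv)

lemma hser_commute:
  assumes "v \<in> hser G 0" "w \<in> hser G j"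
  shows "v * w = w * v"
proof (rule fps_ext)
  fix n
  have "fps_nth (v * w) n = (\<Sum>i = 0..n. fps_nth w (n - i) * fps_nth v i)"
    using assms by (auto simp: fps_mult_nth hser_def intro!: sum.cong mser_commute)
  also have "\<dots> = fps_nth (w * v) n"
    unfolding fps_mult_nth
    by (rule sum.reindex_bij_witness[where i = "\<lambda>i. n - i" and j = "\<lambda>i. n - i"]) auto
  finally show "fps_nth (v * w) n = fps_nth (w * v) n" .
qed

lemma hser_hext_cst: "hext cst r \<in> hser G 0"
  by (simp add: hser_def hext_def mser_map_cst)

lemma hser_hact: "w \<in> hser G j \<Longrightarrow> hact cst r w \<in> hser G j"
  by (simp add: hact_def hser_mult0 hser_hext_cst)

lemma hser_hnabla: "\<Gamma> \<in> mser G 0 \<Longrightarrow> w \<in> hser G j \<Longrightarrow> hnabla \<Gamma> \<alpha> w \<in> hser G j"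
  by (simp add: hnabla_def hser_add hser_X_mult hser_map_deriv hser_mult0 hser_const mser_deriv)

lemma cst_diff: "cst (c - c') = cst c - cst c'"
  using cst_add[of "c - c'" c'] by (simp add: eq_diff_eq)

lemma cst_sum: "cst (sum f S) = (\<Sum>x\<in>S. cst (f x))"
  by (induction S rule: infinite_finite_induct) (simp_all add: cst_zero cst_add)

lemma mps_map_cst_mult: "mps_map cst (r * s) = mps_map cst r * mps_map cst s"
  by (rule mps_eqI) (simp add: mps_nth_mult cst_sum cst_mult case_prod_unfold)

lemma mps_map_cst_sum: "mps_map cst (sum f S) = (\<Sum>x\<in>S. mps_map cst (f x))"
  by (rule mps_eqI) (simp add: mps_nth_sum cst_sum)

lemma hext_cst:
  "hext cst (r + s) = hext cst r + hext cst s"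
  "hext cst (r - s) = hext cst r - hext cst s"
  "hext cst (r * s) = hext cst r * hext cst s"
  "hext cst 0 = 0"
  "hext cst 1 = 1"
  "hext cst fps_X = fps_X"
  by (auto simp: hext_def cst_add cst_diff cst_zero cst_one fps_mult_nth fps_X_def mps_nth_one
      mps_map_cst_sum mps_map_cst_mult intro!: fps_ext mps_eqI)

lemma hact_simps:
  "hact cst (r + s) w = hact cst r w + hact cst s w"
  "hact cst (r - s) w = hact cst r w - hact cst s w"
  "hact cst (r * s) w = hact cst r (hact cst s w)"
  "hact cst r (v + w) = hact cst r v + hact cst r w"
  "hact cst 0 w = 0"
  "hact cst r 0 = 0"
  by (simp_all add: hact_def hext_cst algebra_simps)

lemma hact_sum_right: "hact cst r (sum f S) = (\<Sum>x\<in>S. hact cst r (f x))"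
  by (simp add: hact_def sum_distrib_left)

lemma hact_sum_left: "hact cst (sum f S) w = (\<Sum>x\<in>S. hact cst (f x) w)"
  by (induction S rule: infinite_finite_induct) (simp_all add: hact_simps)

lemma map_deriv_hext_cst: "fps_map (mps_deriv \<alpha>) (hext cst r) = hext cst (fps_map (mps_deriv \<alpha>) r)"
proof (intro fps_ext mps_eqI)
  fix n m
  show "mps_nth (fps_nth (fps_map (mps_deriv \<alpha>) (hext cst r)) n) m =
      mps_nth (fps_nth (hext cst (fps_map (mps_deriv \<alpha>) r)) n) m"
    by (simp add: hext_def mps_nth_deriv cst_mult cst_of_nat del: of_nat_Suc)
qed

section \<open>The connection operators\<close>

lemma fps_map_deriv_add: "fps_map (mps_deriv \<alpha>) (v + w) =
    fps_map (mps_deriv \<alpha>) v + fps_map (mps_deriv \<alpha>) (w :: ('i, 'b) mps fps)"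
  by (rule fps_ext) simp

lemma fps_map_deriv_X: "fps_map (mps_deriv \<alpha>) fps_X = (0 :: ('i, 'b) mps fps)"
  by (rule fps_ext) (simp add: fps_X_def)

lemma fps_map_deriv_const: "fps_map (mps_deriv \<alpha>) (fps_const f) =
    fps_const (mps_deriv \<alpha> (f :: ('i, 'b) mps))"
  by (rule fps_ext) simp

lemma hnabla_add: "hnabla \<Gamma> \<alpha> (v + w) = hnabla \<Gamma> \<alpha> v + hnabla \<Gamma> \<alpha> (w :: ('i, 'b) mps fps)"
  by (simp add: hnabla_def fps_map_deriv_add algebra_simps)

lemma hnabla_zero: "hnabla \<Gamma> \<alpha> 0 = (0 :: ('i, 'b) mps fps)"
  using hnabla_add[of \<Gamma> \<alpha> 0 0] by simp

lemma hnabla_sum: "hnabla \<Gamma> \<alpha> (sum f S) = (\<Sum>x\<in>S. hnabla \<Gamma> \<alpha> (f x :: ('i, 'b) mps fps))"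
  by (induction S rule: infinite_finite_induct) (simp_all add: hnabla_add hnabla_zero)

lemma X_left_commute: "w * (fps_X * v) = fps_X * (w * (v :: ('i, 'b) mps fps))"
  by (simp only: mult.assoc[symmetric] fps_mult_fps_X_commute[symmetric])

text \<open>A connection up to the factor \<hbar>: scalars have degree 0, so they pass
  \<open>mps_deriv \<alpha> \<Gamma>\<close> and contribute only through their derivative.\<close>

lemma hnabla_hact:
  assumes \<Gamma>: "\<Gamma> \<in> mser G 0"
  shows "hnabla \<Gamma> \<alpha> (hact cst r w) =
           hact cst (fps_X * fps_map (mps_deriv \<alpha>) r) w + hact cst r (hnabla \<Gamma> \<alpha> w)"
proof -
  have "fps_const (mps_deriv \<alpha> \<Gamma>) * hext cst r = hext cst r * fps_const (mps_deriv \<alpha> \<Gamma>)"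
    by (intro hser_commute[OF _ hser_hext_cst] hser_const mser_deriv \<Gamma>)
  then have "fps_const (mps_deriv \<alpha> \<Gamma>) * (hext cst r * w) =
      hext cst r * (fps_const (mps_deriv \<alpha> \<Gamma>) * w)"
    by (simp add: mult.assoc[symmetric])
  then show ?thesis
    by (simp add: hnabla_def hact_def fps_map_deriv_mult hext_cst map_deriv_hext_cst distrib_left
        X_left_commute[of "hext cst _"] mult.assoc)
qed

text \<open>Flatness: partial derivatives commute, the cross terms involve the symmetric Hessian of
  \<Gamma>, and the degree 0 elements \<open>mps_deriv \<alpha> \<Gamma>\<close> commute.\<close>

lemma hnabla_commute:
  assumes \<Gamma>: "\<Gamma> \<in> mser G 0"
  shows "hnabla \<Gamma> \<beta> (hnabla \<Gamma> \<alpha> w) = hnabla \<Gamma> \<alpha> (hnabla \<Gamma> \<beta> w)"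
proof -
  have "fps_const (mps_deriv \<beta> \<Gamma>) * (fps_const (mps_deriv \<alpha> \<Gamma>) * w) =
      fps_const (mps_deriv \<alpha> \<Gamma>) * (fps_const (mps_deriv \<beta> \<Gamma>) * w)"
    unfolding mult.assoc[symmetric]
    by (intro arg_cong[where f = "\<lambda>x. x * w"] hser_commute[where j = 0] hser_const mser_deriv \<Gamma>)
  moreover have "fps_map (mps_deriv \<alpha>) (fps_map (mps_deriv \<beta>) w) =
      fps_map (mps_deriv \<beta>) (fps_map (mps_deriv \<alpha>) w)"
    by (rule fps_ext) (simp add: mps_deriv_commute)
  ultimately show ?thesis
    by (simp add: hnabla_def fps_map_deriv_add fps_map_deriv_X fps_map_deriv_mult fps_map_deriv_const
        X_left_commute[of "fps_const _"] distrib_left mult.assoc mps_deriv_commute[of \<alpha> \<beta>]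
        add.assoc add.commute add.left_commute)
qed

section \<open>Lifting linear operators to power series\<close>

context
  fixes K :: "'b \<Rightarrow> 'b"
  assumes K: "graded_linear cst G K"
begin

lemma K_add: "a \<in> G j \<Longrightarrow> b \<in> G j \<Longrightarrow> K (a + b) = K a + K b"
  using K by (simp add: graded_linear_def)

lemma K_scale: "a \<in> G j \<Longrightarrow> K (cst c * a) = cst c * K a"
  using K unfolding graded_linear_def by blast

lemma K_zero: "K 0 = 0"
  using K_add[OF zero_in zero_in] by simp

lemma K_diff: "a \<in> G j \<Longrightarrow> b \<in> G j \<Longrightarrow> K (a - b) = K a - K b"
  using K_add[of "a - b" j b] by (simp add: diff_in)

lemma K_sum: "(\<And>x. x \<in> S \<Longrightarrow> f x \<in> G j) \<Longrightarrow> K (sum f S) = (\<Sum>x\<in>S. K (f x))"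
  by (induction S rule: infinite_finite_induct) (simp_all add: K_zero K_add[of _ j] sum_in)

lemma mps_map_add: "f \<in> mser G j \<Longrightarrow> g \<in> mser G j \<Longrightarrow> mps_map K (f + g) = mps_map K f + mps_map K g"
  by (rule mps_eqI) (simp add: mser_def K_add[of _ j])

lemma mps_map_diff: "f \<in> mser G j \<Longrightarrow> g \<in> mser G j \<Longrightarrow> mps_map K (f - g) = mps_map K f - mps_map K g"
  by (rule mps_eqI) (simp add: mser_def K_diff[of _ j])

lemma mps_map_zero: "mps_map K 0 = 0"
  by (rule mps_eqI) (simp add: K_zero)

lemma mps_map_sum: "(\<And>x. x \<in> S \<Longrightarrow> f x \<in> mser G j) \<Longrightarrow> mps_map K (sum f S) = (\<Sum>x\<in>S. mps_map K (f x))"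
  by (induction S rule: infinite_finite_induct)
      (simp_all add: mps_map_zero mps_map_add[of _ j] mser_sum)

lemma mps_map_deriv: "f \<in> mser G j \<Longrightarrow> mps_map K (mps_deriv \<alpha> f) = mps_deriv \<alpha> (mps_map K f)"
  by (rule mps_eqI) (simp only: mps_nth_map mps_nth_deriv mser_def mem_Collect_eq cst_of_nat[symmetric] K_scale[of _ j])

lemma mps_map_nth_mult:
  assumes "f \<in> mser G i" "g \<in> mser G j"
  shows "mps_nth (mps_map K (f * g)) m = (\<Sum>(a, b)\<in>{(a, b). a + b =
      m}. K (mps_nth f a * mps_nth g b))"
proof -
  have "K (\<Sum>x\<in>{(a, b). a + b = m}. mps_nth f (fst x) * mps_nth g (snd x)) =
      (\<Sum>x\<in>{(a, b). a + b = m}. K (mps_nth f (fst x) * mps_nth g (snd x)))"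
    using assms by (intro K_sum[where j = "i + j"]) (auto simp: mser_def mult_in)
  then show ?thesis
    by (simp add: mps_nth_mult case_prod_unfold)
qed

lemma mps_map_scale: "f \<in> mser G j \<Longrightarrow> mps_map K (mps_map cst r * f) = mps_map cst r * mps_map K f"
  by (rule mps_eqI, subst mps_map_nth_mult[OF mser_map_cst], assumption)
    (simp add: mps_nth_mult mser_def K_scale[of _ j])

lemma hext_hact: "w \<in> hser G j \<Longrightarrow> hext K (hact cst r w) = hact cst r (hext K w)"
proof (rule fps_ext)
  fix n
  assume w: "w \<in> hser G j"
  have "mps_map K (\<Sum>i = 0..n. mps_map cst (fps_nth r i) * fps_nth w (n - i)) =
      (\<Sum>i = 0..n. mps_map K (mps_map cst (fps_nth r i) * fps_nth w (n - i)))"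
    using w by (intro mps_map_sum[where j = j]) (simp add: hser_def mser_mult0 mser_map_cst)
  also have "\<dots> = (\<Sum>i = 0..n. mps_map cst (fps_nth r i) * mps_map K (fps_nth w (n - i)))"
    using w by (intro sum.cong refl mps_map_scale[where j = j]) (simp add: hser_def)
  finally show "fps_nth (hext K (hact cst r w)) n = fps_nth (hact cst r (hext K w)) n"
    by (simp add: hext_def hact_def fps_mult_nth)
qed

lemma hext_const: "hext K (fps_const f) = fps_const (mps_map K f)"
  by (rule fps_ext) (simp add: hext_def mps_map_zero)

text \<open>Each coefficient of a triple product is a sum over threefold decompositions of the
  exponent, and the rule is applied to each summand. One of the two resulting sums is then
  reassociated to the left; in the other the roles of \<open>a\<close> and \<open>b\<close> are
  interchanged.\<close>

lemma ell2_poisson_mps: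
  fixes f g h :: "('i, 'b) mps"
  assumes f: "f \<in> mser G 0" and g: "g \<in> mser G j" and h: "h \<in> mser G l"
    and poisson: "\<And>a b c. a \<in> G 0 \<Longrightarrow> b \<in> G j \<Longrightarrow> c \<in> G l \<Longrightarrow>
      ell2 K 0 a (b * c) = ell2 K 0 a b * c + sg j * (b * ell2 K 0 a c)"
  shows "ell2 (mps_map K) 0 f (g * h) =
           ell2 (mps_map K) 0 f g * h + sg j * (g * ell2 (mps_map K) 0 f h)"
proof (rule mps_eqI)
  fix m :: "'i \<Rightarrow>\<^sub>0 nat"
  let ?S = "\<lambda>m. {(a, b). a + b = (m :: 'i \<Rightarrow>\<^sub>0 nat)}"
  let ?T = "\<lambda>\<phi> m. \<Sum>(a, s)\<in>?S m. \<Sum>(b, c)\<in>?S s. \<phi> (mps_nth f a) (mps_nth g b) (mps_nth h c)"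
  have in_G: "mps_nth f a \<in> G 0" "mps_nth g a \<in> G j" "mps_nth h a \<in> G l" for a
    using f g h by (simp_all add: mser_def)
  have br: "mps_nth (ell2 (mps_map K) 0 u v) m =
      (\<Sum>(a, b)\<in>?S m. ell2 K 0 (mps_nth u a) (mps_nth v b))"
    if "u \<in> mser G 0" "v \<in> mser G i" for u v :: "('i, 'b) mps" and i m
    using mps_map_nth_mult[OF that]
    by (simp add: ell2_def sg_def mps_nth_mult sum_subtractf case_prod_unfold)
  have ell2_sum: "ell2 K 0 (mps_nth f a) (\<Sum>p\<in>?S s. mps_nth g (fst p) * mps_nth h (snd p)) =
      (\<Sum>p\<in>?S s. ell2 K 0 (mps_nth f a) (mps_nth g (fst p) * mps_nth h (snd p)))" for a s
  proof -
    have "K (\<Sum>p\<in>?S s. mps_nth f a * (mps_nth g (fst p) * mps_nth h (snd p))) =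
        (\<Sum>p\<in>?S s. K (mps_nth f a * (mps_nth g (fst p) * mps_nth h (snd p))))"
      by (rule K_sum[where j = "0 + (j + l)"]) (intro mult_in in_G)
    moreover have "K (\<Sum>p\<in>?S s. mps_nth g (fst p) * mps_nth h (snd p)) =
        (\<Sum>p\<in>?S s. K (mps_nth g (fst p) * mps_nth h (snd p)))"
      by (rule K_sum[where j = "j + l"]) (intro mult_in in_G)
    ultimately show ?thesis
      by (simp add: ell2_def sum_distrib_left sum_subtractf)
  qed
  have sg: "mps_nth (sg j * u) m = sg j * mps_nth u m" for u :: "('i, 'b) mps" and m
    by (simp add: sg_def)
  have "mps_nth (ell2 (mps_map K) 0 f (g * h)) m = ?T (\<lambda>a b c. ell2 K 0 a (b * c)) m"
  proof (subst br[OF f mser_mult[OF g h]], intro sum.cong refl)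
    fix p assume "p \<in> ?S m"
    show "(case p of (a, s) \<Rightarrow> ell2 K 0 (mps_nth f a) (mps_nth (g * h) s)) =
        (case p of (a, s) \<Rightarrow> \<Sum>(b, c)\<in>?S s. ell2 K 0 (mps_nth f a) (mps_nth g b * mps_nth h c))"
      using ell2_sum[of "fst p" "snd p"] by (simp add: split_def mps_nth_mult)
  qed
  also have "\<dots> = ?T (\<lambda>a b c. ell2 K 0 a b * c + sg j * (b * ell2 K 0 a c)) m"
    by (simp only: poisson[OF in_G])
  also have "\<dots> = ?T (\<lambda>a b c. ell2 K 0 a b * c) m + sg j * ?T (\<lambda>a b c. b * ell2 K 0 a c) m"
    by (simp add: sum.distrib sum_distrib_left split_def)
  also have "?T (\<lambda>a b c. ell2 K 0 a b * c) m = mps_nth (ell2 (mps_map K) 0 f g * h) m"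
    by (rule trans[OF sum_splits_assoc[symmetric]])
        (simp only: mps_nth_mult br[OF f g] sum_distrib_right split_def)
  also have "?T (\<lambda>a b c. b * ell2 K 0 a c) m = mps_nth (g * ell2 (mps_map K) 0 f h) m"
    by (rule trans[OF sum_splits_left_commute[symmetric]])
        (simp only: mps_nth_mult br[OF f h] sum_distrib_left split_def)
  finally show "mps_nth (ell2 (mps_map K) 0 f (g * h)) m =
      mps_nth (ell2 (mps_map K) 0 f g * h + sg j * (g * ell2 (mps_map K) 0 f h)) m"
    by (simp add: sg)
qed

lemma leibniz_mps:
  fixes f g :: "('i, 'b) mps"
  assumes f: "f \<in> mser G i" and g: "g \<in> mser G j"
    and leibniz: "\<And>a b. a \<in> G i \<Longrightarrow> b \<in> G j \<Longrightarrow> K (a * b) = K a * b + sg i * (a * K b)"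
  shows "mps_map K (f * g) = mps_map K f * g + sg i * (f * mps_map K g)"
proof (rule mps_eqI)
  fix m :: "'i \<Rightarrow>\<^sub>0 nat"
  have sg: "mps_nth (sg i * u) m = sg i * mps_nth u m" for u :: "('i, 'b) mps"
    by (simp add: sg_def)
  have "K (mps_nth f a * mps_nth g b) = K (mps_nth f a) * mps_nth g b +
      sg i * (mps_nth f a * K (mps_nth g b))" for a b
    using f g by (intro leibniz) (simp_all add: mser_def)
  then show "mps_nth (mps_map K (f * g)) m = mps_nth (mps_map K f * g + sg i * (f * mps_map K g)) m"
    by (simp only: mps_map_nth_mult[OF f g] mps_nth_simps sg)
      (simp add: mps_nth_mult sum.distrib sum_distrib_left split_def)
qed

end

end

text \<open>The zero vector is represented both by the empty family and by \<open>c\<close>, so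
  uniqueness of coordinates gives linear independence.\<close>

lemma basis_mod_independent:
  assumes basis: "basis_mod act Z N v" and "0 \<in> Z" and "0 \<in> N" and N_uminus: "\<And>w. w \<in> N \<Longrightarrow> - w \<in> N"
    and T: "finite T" and c: "(\<Sum>\<delta>\<in>T. act (c \<delta>) (v \<delta>)) \<in> N" and act0: "\<And>w. act 0 w = 0" and "\<delta> \<in> T"
  shows "c \<delta> = 0"
proof -
  \<comment> \<open>Coordinates in \<open>basis_mod\<close> are finitely supported families, so
    \<open>c\<close> is cut off outside \<open>T\<close>.\<close>
  define p where "p = Abs_poly_mapping (\<lambda>\<delta>. if \<delta> \<in> T then c \<delta> else 0)"
  have lp: "Poly_Mapping.lookup p = (\<lambda>\<delta>. if \<delta> \<in> T then c \<delta> else 0)"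
  proof -
    have "{\<delta>. (if \<delta> \<in> T then c \<delta> else 0) \<noteq> 0} \<subseteq> T"
      by auto
    then show ?thesis
      unfolding p_def using T by (intro lookup_Abs_poly_mapping) (rule finite_subset)
  qed
  have "(\<Sum>\<alpha>\<in>Poly_Mapping.keys p. act (Poly_Mapping.lookup p \<alpha>) (v \<alpha>)) =
      (\<Sum>\<alpha>\<in>T. act (Poly_Mapping.lookup p \<alpha>) (v \<alpha>))"
    using T by (intro sum.mono_neutral_left) (auto simp: in_keys_iff lp act0 split: if_splits)
  also have "\<dots> = (\<Sum>\<delta>\<in>T. act (c \<delta>) (v \<delta>))"
    by (simp add: lp)
  finally have "0 - (\<Sum>\<alpha>\<in>Poly_Mapping.keys p. act (Poly_Mapping.lookup p \<alpha>) (v \<alpha>)) \<in> N"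
    using N_uminus[OF c] by simp
  moreover have "0 - (\<Sum>\<alpha>\<in>Poly_Mapping.keys 0. act (Poly_Mapping.lookup 0 \<alpha>) (v \<alpha>)) \<in> N"
    using \<open>0 \<in> N\<close> by simp
  ultimately have "p = 0"
    using basis \<open>0 \<in> Z\<close> unfolding basis_mod_def by blast
  then show ?thesis
    using lp \<open>\<delta> \<in> T\<close> by (metis lookup_zero)
qed

text \<open>
  The derivation properties are only required for degree 0 factors;
      for superpolynomials these involve
  no shuffle signs.
\<close>

locale bv_setting = even_central cst G
  for cst :: "complex \<Rightarrow> 'b :: ring_1" and G :: "int \<Rightarrow> 'b set" +
  fixes \<Delta> Q :: "'b \<Rightarrow> 'b" and \<Gamma> :: "('i, 'b) mps"
  assumes \<Delta>_linear: "graded_linear cst G \<Delta>"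
    and Q_linear: "graded_linear cst G Q"
    and \<Delta>_even_in: "a \<in> G 0 \<Longrightarrow> \<Delta> a \<in> G 1"
    and \<Delta>_poisson0: "a \<in> G 0 \<Longrightarrow> b \<in> G 0 \<Longrightarrow> c \<in> G j \<Longrightarrow>
      ell2 \<Delta> 0 a (b * c) = ell2 \<Delta> 0 a b * c + b * ell2 \<Delta> 0 a c"
    and Q_leibniz0: "b \<in> G 0 \<Longrightarrow> c \<in> G j \<Longrightarrow> Q (b * c) = Q b * c + b * Q c"
    and \<Gamma>_in: "\<Gamma> \<in> mser G 0"
begin

section \<open>The twisted differential and its coboundaries\<close>

abbreviation D where "D \<equiv> tw_diff \<Delta> Q \<Gamma>"
abbreviation del where "del \<equiv> mps_map \<Delta>"
abbreviation nab where "nab \<equiv> hnabla \<Gamma>"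
abbreviation N where "N \<equiv> coboundaries0 G \<Delta> Q \<Gamma>"
abbreviation Z where "Z \<equiv> cocycles0 G \<Delta> Q \<Gamma>"

text \<open>The part of \<open>D\<close> free of \<hbar>, so that \<open>D\<close> is
  \<hbar>\<Delta> + \<open>d0\<close> coefficientwise; see \<open>tw_diff_nth\<close>.\<close>

definition d0 :: "('i, 'b) mps \<Rightarrow> ('i, 'b) mps" where
  "d0 f = mps_map Q f + ell2 del 0 \<Gamma> f"

lemma d0_eq: "d0 f = mps_map Q f + (del (\<Gamma> * f) - del \<Gamma> * f - \<Gamma> * del f)"
  by (simp add: d0_def ell2_def sg_def)

lemma tw_diff_nth:
  "fps_nth (D w) n = (if n = 0 then 0 else del (fps_nth w (n - 1))) + d0 (fps_nth w n)"
proof -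
  have "ell2 (hext \<Delta>) 0 (fps_const \<Gamma>) w = fps_map (ell2 del 0 \<Gamma>) w"
    by (rule fps_ext) (simp add: ell2_def sg_def hext_const[OF \<Delta>_linear], simp add: hext_def)
  then show ?thesis
    by (simp add: tw_diff_def d0_def hext_def)
qed

lemma d0_add: "f \<in> mser G j \<Longrightarrow> g \<in> mser G j \<Longrightarrow> d0 (f + g) = d0 f + d0 g"
  using mser_mult0[OF \<Gamma>_in]
  by (simp add: d0_eq mps_map_add[OF \<Delta>_linear, of _ j] mps_map_add[OF Q_linear, of _ j] distrib_left)

lemma D_add: "v \<in> hser G j \<Longrightarrow> w \<in> hser G j \<Longrightarrow> D (v + w) = D v + D w"
  by (rule fps_ext) (simp add: tw_diff_nth hser_def d0_add[of _ j] mps_map_add[OF \<Delta>_linear, of _ j])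

lemma D_zero: "D 0 = 0"
  using D_add[OF hser_zero hser_zero] by simp

lemma D_uminus: "w \<in> hser G j \<Longrightarrow> D (- w) = - D w"
  using D_add[of w j "- w"] by (simp add: hser_uminus D_zero eq_neg_iff_add_eq_0 add.commute)

lemma D_diff: "v \<in> hser G j \<Longrightarrow> w \<in> hser G j \<Longrightarrow> D (v - w) = D v - D w"
  using D_add[of v j "- w"] by (simp add: hser_uminus D_uminus)

lemma del_\<Gamma>_in: "del \<Gamma> \<in> mser G 1"
  using \<Gamma>_in by (simp add: mser_def \<Delta>_even_in)

lemma hact_left_commute: "v \<in> hser G i \<Longrightarrow> v * hact cst r u = hact cst r (v * u)"
  unfolding hact_def by (simp only: mult.assoc[symmetric] hser_commute[OF hser_hext_cst])

lemma D_hact: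
  assumes w: "w \<in> hser G j"
  shows "D (hact cst r w) = hact cst r (D w)"
proof -
  have "fps_X * hact cst r u = hact cst r (fps_X * u)" for u :: "('i, 'b) mps fps"
    by (simp add: hact_def X_left_commute[of "hext cst _"])
  moreover have "hact cst r (u - v) = hact cst r u - hact cst r v" for u v
    by (simp add: hact_def right_diff_distrib)
  ultimately show ?thesis
    using w hser_mult0[OF hser_const[OF \<Gamma>_in] w] hser_const[OF \<Gamma>_in] hser_const[OF del_\<Gamma>_in]
    by (simp add: tw_diff_def ell2_def sg_def hact_simps hext_const[OF \<Delta>_linear]
        hext_hact[OF \<Delta>_linear, of _ j] hext_hact[OF Q_linear, of _ j]
        hact_left_commute[of "fps_const \<Gamma>" 0] hact_left_commute[of "fps_const (del \<Gamma>)" 1])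
qed

lemma zero_cocycle: "0 \<in> Z"
  by (simp add: cocycles0_def hser_zero D_zero)

lemma N_zero: "0 \<in> N"
  unfolding coboundaries0_def using D_zero hser_zero by (metis image_eqI)

lemma N_add: "v \<in> N \<Longrightarrow> w \<in> N \<Longrightarrow> v + w \<in> N"
  unfolding coboundaries0_def by (auto simp: D_add[symmetric] intro!: hser_add)

lemma N_uminus: "w \<in> N \<Longrightarrow> - w \<in> N"
  unfolding coboundaries0_def by (auto simp: D_uminus[symmetric] intro!: hser_uminus)

lemma N_diff: "v \<in> N \<Longrightarrow> w \<in> N \<Longrightarrow> v - w \<in> N"
  using N_add[OF _ N_uminus] by fastforce

lemma N_hact: "w \<in> N \<Longrightarrow> hact cst r w \<in> N"
  unfolding coboundaries0_def by (auto simp: D_hact[symmetric] intro!: hser_hact)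

lemma N_sum: "(\<And>x. x \<in> S \<Longrightarrow> f x \<in> N) \<Longrightarrow> sum f S \<in> N"
  by (induction S rule: infinite_finite_induct) (simp_all add: N_zero N_add)

lemma D_in_N: "w \<in> hser G (- 1) \<Longrightarrow> D w \<in> N"
  by (simp add: coboundaries0_def)

text \<open>Both Q and the bracket with \<Gamma> are derivations, although \<Delta> itself has
  second order. No sign appears because \<open>f\<close> has degree 0.\<close>

lemma d0_leibniz:
  assumes f: "f \<in> mser G 0" and g: "g \<in> mser G j"
  shows "d0 (f * g) = d0 f * g + f * d0 g"
proof -
  have "ell2 del 0 \<Gamma> (f * g) = ell2 del 0 \<Gamma> f * g + sg 0 * (f * ell2 del 0 \<Gamma> g)"
    by (rule ell2_poisson_mps[OF \<Delta>_linear \<Gamma>_in f g]) (simp add: \<Delta>_poisson0 sg_def)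
  moreover have "mps_map Q (f * g) = mps_map Q f * g + sg 0 * (f * mps_map Q g)"
    by (rule leibniz_mps[OF Q_linear f g]) (simp add: Q_leibniz0 sg_def)
  ultimately show ?thesis
    by (simp add: d0_def sg_def algebra_simps)
qed

text \<open>The additional term is the bracket of \<open>mps_deriv \<gamma> \<Gamma>\<close> with
  \<open>f\<close>, from the derivative falling on \<Gamma> inside \<open>d0\<close>.\<close>

lemma d0_deriv:
  assumes f: "f \<in> mser G j"
  shows "mps_deriv \<gamma> (d0 f) = d0 (mps_deriv \<gamma> f) +
     (del (mps_deriv \<gamma> \<Gamma> * f) - del (mps_deriv \<gamma> \<Gamma>) * f - mps_deriv \<gamma> \<Gamma> * del f)"
proof -
  note in_mser = mser_mult0[OF \<Gamma>_in f] mser_mult0[OF mser_deriv[OF \<Gamma>_in] f]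
    mser_mult0[OF \<Gamma>_in mser_deriv[OF f]]
  show ?thesis
    using f by (simp add: d0_eq mps_map_deriv[OF \<Delta>_linear, of _ j, symmetric] in_mser \<Gamma>_in
        mps_map_deriv[OF \<Delta>_linear \<Gamma>_in, symmetric] mps_map_deriv[OF Q_linear, of _ j, symmetric]
        mps_deriv_mult mps_map_add[OF \<Delta>_linear, of _ j] algebra_simps)
qed

text \<open>The failure of \<hbar>\<Delta> to be a derivation, \<hbar> times the bracket of
  \<open>mps_deriv \<gamma> \<Gamma>\<close> with \<open>w\<close>, cancels the term that arises
  when the derivative in \<open>nab\<close> falls on \<Gamma> inside \<open>D\<close>. What survives
  is \<open>D\<close> applied to the factor \<open>mps_deriv \<gamma> \<Gamma>\<close>
  alone.\<close>

lemma D_hnabla: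
  assumes w: "w \<in> hser G j"
  shows "D (nab \<gamma> w) = nab \<gamma> (D w) + D (fps_const (mps_deriv \<gamma> \<Gamma>)) * w"
proof (rule fps_ext)
  fix n
  let ?g = "mps_deriv \<gamma> \<Gamma>"
  have wn: "fps_nth w k \<in> mser G j" for k
    using w by (simp add: hser_def)
  note g = mser_deriv[OF \<Gamma>_in, of \<gamma>]
  have Dg: "D (fps_const ?g) = fps_const (d0 ?g) + fps_X * fps_const (del ?g)"
    by (rule fps_ext) (auto simp: tw_diff_nth d0_add[OF mser_zero mser_zero, simplified] d0_eq
        mps_map_zero[OF \<Delta>_linear] mps_map_zero[OF Q_linear])
  have nab_nth: "fps_nth (nab \<gamma> v) n =
      (if n = 0 then 0 else mps_deriv \<gamma> (fps_nth v (n - 1))) + ?g * fps_nth v n" for v n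
    by (simp add: hnabla_def)
  have rhs: "fps_nth (D (fps_const ?g) * w) n =
      d0 ?g * fps_nth w n + (if n = 0 then 0 else del ?g * fps_nth w (n - 1))" for n
    by (simp add: Dg distrib_right mult.assoc)
  note leibniz = d0_leibniz[OF g wn]
  note in_mser = wn mser_deriv mser_mult0 g mser_add
  show "fps_nth (D (nab \<gamma> w)) n = fps_nth (nab \<gamma> (D w) + D (fps_const ?g) * w) n"
  proof (cases n)
    case 0
    then show ?thesis
      by (simp only: fps_add_nth rhs) (simp add: tw_diff_nth nab_nth leibniz)
  next
    case (Suc k)
    have "d0 (mps_deriv \<gamma> (fps_nth w k) + ?g * fps_nth w n) =
        d0 (mps_deriv \<gamma> (fps_nth w k)) + (d0 ?g * fps_nth w n + ?g * d0 (fps_nth w n))"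
      by (simp add: d0_add[of _ j] in_mser leibniz)
    moreover have "del ((if k = 0 then 0 else mps_deriv \<gamma> (fps_nth w (k - 1))) + ?g * fps_nth w k) =
        (if k = 0 then 0 else mps_deriv \<gamma> (del (fps_nth w (k - 1)))) + del (?g * fps_nth w k)"
      by (simp add: mps_map_add[OF \<Delta>_linear, of _ j] in_mser mps_map_deriv[OF \<Delta>_linear, of _ j, symmetric])
    \<comment> \<open>Coefficient \<open>n\<close> of either composite involves coefficients of
      \<open>w\<close> down to index \<open>n - 2\<close>, hence the second split, on
      \<open>k\<close>.\<close>
    ultimately show ?thesis
      using Suc d0_deriv[OF wn, of \<gamma> k]
      by (simp only: fps_add_nth rhs, cases k)
          (simp_all add: tw_diff_nth nab_nth distrib_left algebra_simps)
  qed
qed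

section \<open>Expansion in the basis: symmetry and flatness\<close>

context
  fixes \<zeta> :: "('i, 'b) mps fps" and A :: "'i \<Rightarrow> 'i \<Rightarrow> 'i \<Rightarrow> ('i, complex) mps fps"
    and \<Lambda> :: "'i \<Rightarrow> 'i \<Rightarrow> ('i, 'b) mps fps"
  assumes \<zeta>_in: "\<zeta> \<in> hser G 0"
    and basis: "basis_mod (hact cst) Z N (\<lambda>\<alpha>. nab \<alpha> \<zeta>)"
    and A_finite: "finite {\<rho>. A \<alpha> \<beta> \<rho> \<noteq> 0}"
    and \<Lambda>_in: "\<Lambda> \<alpha> \<beta> \<in> hser G (- 1)"
    and structure_eq: "nab \<beta> (nab \<alpha> \<zeta>) =
      (\<Sum>\<rho> | A \<alpha> \<beta> \<rho> \<noteq> 0. hact cst (A \<alpha> \<beta> \<rho>) (nab \<rho> \<zeta>)) + D (\<Lambda> \<alpha> \<beta>)"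
begin

lemma independent:
  "finite T \<Longrightarrow> (\<Sum>\<delta>\<in>T. hact cst (c \<delta>) (nab \<delta> \<zeta>)) \<in> N \<Longrightarrow> \<delta> \<in> T \<Longrightarrow> c \<delta> = 0"
  by (rule basis_mod_independent[OF basis zero_cocycle N_zero N_uminus]) (auto simp: hact_simps)

lemma structure_eq_superset:
  assumes "finite T" "{\<rho>. A \<alpha> \<beta> \<rho> \<noteq> 0} \<subseteq> T"
  shows "nab \<beta> (nab \<alpha> \<zeta>) = (\<Sum>\<rho>\<in>T. hact cst (A \<alpha> \<beta> \<rho>) (nab \<rho> \<zeta>)) + D (\<Lambda> \<alpha> \<beta>)"
  unfolding structure_eq using assms
  by (auto intro!: sum.mono_neutral_left simp: hact_simps)

lemma coeffs_symmetric: "A \<alpha> \<beta> \<rho> = A \<beta> \<alpha> \<rho>"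
proof -
  \<comment> \<open>Including \<rho> lets \<open>independent\<close> speak about it even if both
    coefficients vanish there.\<close>
  let ?T = "insert \<rho> ({\<rho>. A \<alpha> \<beta> \<rho> \<noteq> 0} \<union> {\<rho>. A \<beta> \<alpha> \<rho> \<noteq> 0})"
  have fin: "finite ?T"
    by (simp add: A_finite)
  have "(\<Sum>\<delta>\<in>?T. hact cst (A \<alpha> \<beta> \<delta> - A \<beta> \<alpha> \<delta>) (nab \<delta> \<zeta>)) =
      (nab \<beta> (nab \<alpha> \<zeta>) - D (\<Lambda> \<alpha> \<beta>)) - (nab \<alpha> (nab \<beta> \<zeta>) - D (\<Lambda> \<beta> \<alpha>))"
    by (subst structure_eq_superset[OF fin, of \<alpha> \<beta>], blast, subst structure_eq_superset[OF fin, of \<beta> \<alpha>], blast)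
      (simp only: hact_simps(2) sum_subtractf add_diff_cancel_right')
  also have "\<dots> = D (\<Lambda> \<beta> \<alpha>) - D (\<Lambda> \<alpha> \<beta>)"
    by (simp add: hnabla_commute[OF \<Gamma>_in, of \<alpha> \<beta>])
  also have "\<dots> \<in> N"
    by (intro N_diff D_in_N \<Lambda>_in)
  finally have "A \<alpha> \<beta> \<rho> - A \<beta> \<alpha> \<rho> = 0"
    by (rule independent[OF fin]) simp
  then show ?thesis
    by simp
qed

text \<open>Differentiate the expansion of the second derivatives and expand the new second
  derivatives again; the exact terms \<open>D (\<Lambda> \<rho> \<gamma>)\<close> are only
  multiplied by scalars and stay in \<open>N\<close>. The term
  \<open>nab \<gamma> (D (\<Lambda> \<alpha> \<beta>))\<close> is kept apart because
  \<open>nab\<close> need not preserve \<open>N\<close>.\<close>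

lemma hnabla_structure_eq:
  assumes fin: "finite T" and sub: "{\<rho>. A \<alpha> \<beta> \<rho> \<noteq> 0} \<subseteq> T"
    and sub': "\<And>\<rho>. \<rho> \<in> {\<rho>. A \<alpha> \<beta> \<rho> \<noteq> 0} \<Longrightarrow> {\<delta>. A \<rho> \<gamma> \<delta> \<noteq> 0} \<subseteq> T"
  shows "nab \<gamma> (nab \<beta> (nab \<alpha> \<zeta>)) - nab \<gamma> (D (\<Lambda> \<alpha> \<beta>)) -
      (\<Sum>\<delta>\<in>T. hact cst (fps_X * fps_map (mps_deriv \<gamma>) (A \<alpha> \<beta> \<delta>) +
        (\<Sum>\<rho> | A \<alpha> \<beta> \<rho> \<noteq> 0. A \<alpha> \<beta> \<rho> * A \<rho> \<gamma> \<delta>)) (nab \<delta> \<zeta>)) \<in> N"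
proof -
  let ?S = "{\<rho>. A \<alpha> \<beta> \<rho> \<noteq> 0}"
  let ?X = "\<lambda>\<delta>. hact cst (fps_X * fps_map (mps_deriv \<gamma>) (A \<alpha> \<beta> \<delta>)) (nab \<delta> \<zeta>)"
  have "nab \<gamma> (nab \<beta> (nab \<alpha> \<zeta>)) - nab \<gamma> (D (\<Lambda> \<alpha> \<beta>)) =
      (\<Sum>\<rho>\<in>?S. nab \<gamma> (hact cst (A \<alpha> \<beta> \<rho>) (nab \<rho> \<zeta>)))"
    by (simp add: structure_eq[of \<beta> \<alpha>] hnabla_add hnabla_sum)
  also have "\<dots> = (\<Sum>\<rho>\<in>?S. ?X \<rho>) + (\<Sum>\<rho>\<in>?S. hact cst (A \<alpha> \<beta> \<rho>) (nab \<gamma> (nab \<rho> \<zeta>)))"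
    by (simp add: hnabla_hact[OF \<Gamma>_in] sum.distrib)
  also have "(\<Sum>\<rho>\<in>?S. ?X \<rho>) = (\<Sum>\<delta>\<in>T. ?X \<delta>)"
    using fin sub by (intro sum.mono_neutral_left)
        (auto simp: hact_simps fps_map_def fps_zero_def[symmetric])
  also have "(\<Sum>\<rho>\<in>?S. hact cst (A \<alpha> \<beta> \<rho>) (nab \<gamma> (nab \<rho> \<zeta>))) =
      (\<Sum>\<rho>\<in>?S. \<Sum>\<delta>\<in>T. hact cst (A \<alpha> \<beta> \<rho> * A \<rho> \<gamma> \<delta>) (nab \<delta> \<zeta>)) +
      (\<Sum>\<rho>\<in>?S. hact cst (A \<alpha> \<beta> \<rho>) (D (\<Lambda> \<rho> \<gamma>)))"
    unfolding sum.distrib[symmetric]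
    by (intro sum.cong refl, subst structure_eq_superset[OF fin sub'])
      (simp_all add: hact_simps hact_sum_right)
  also have "(\<Sum>\<rho>\<in>?S. \<Sum>\<delta>\<in>T. hact cst (A \<alpha> \<beta> \<rho> * A \<rho> \<gamma> \<delta>) (nab \<delta> \<zeta>)) =
      (\<Sum>\<delta>\<in>T. \<Sum>\<rho>\<in>?S. hact cst (A \<alpha> \<beta> \<rho> * A \<rho> \<gamma> \<delta>) (nab \<delta> \<zeta>))"
    by (rule sum.swap)
  finally have "nab \<gamma> (nab \<beta> (nab \<alpha> \<zeta>)) - nab \<gamma> (D (\<Lambda> \<alpha> \<beta>)) -
      (\<Sum>\<delta>\<in>T. hact cst (fps_X * fps_map (mps_deriv \<gamma>) (A \<alpha> \<beta> \<delta>) +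
        (\<Sum>\<rho>\<in>?S. A \<alpha> \<beta> \<rho> * A \<rho> \<gamma> \<delta>)) (nab \<delta> \<zeta>)) =
      (\<Sum>\<rho>\<in>?S. hact cst (A \<alpha> \<beta> \<rho>) (D (\<Lambda> \<rho> \<gamma>)))"
    by (simp add: hact_simps(1) hact_sum_left sum.distrib)
  also have "\<dots> \<in> N"
    by (intro N_sum N_hact D_in_N \<Lambda>_in)
  finally show ?thesis .
qed

text \<open>The third covariant derivatives of \<zeta> are symmetric, so two expansions of the same
  one can be compared modulo \<open>N\<close>. The hypothesis asks exactness only of the
  antisymmetrized error, which is what the abstract case can provide.\<close>

lemma flatness:
  assumes "nab \<gamma> (D (\<Lambda> \<alpha> \<beta>)) - nab \<alpha> (D (\<Lambda> \<gamma> \<beta>)) \<in> N"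
  shows "fps_X * fps_map (mps_deriv \<gamma>) (A \<alpha> \<beta> \<delta>) + (\<Sum>\<rho> | A \<alpha> \<beta> \<rho> \<noteq> 0. A \<alpha> \<beta> \<rho> * A \<rho> \<gamma> \<delta>) =
    fps_X * fps_map (mps_deriv \<alpha>) (A \<gamma> \<beta> \<delta>) + (\<Sum>\<rho> | A \<gamma> \<beta> \<rho> \<noteq> 0. A \<gamma> \<beta> \<rho> * A \<rho> \<alpha> \<delta>)"
    (is "?c \<alpha> \<gamma> \<delta> = ?c \<gamma> \<alpha> \<delta>")
proof -
  let ?S = "\<lambda>\<alpha> \<beta>. {\<rho>. A \<alpha> \<beta> \<rho> \<noteq> 0}"
  let ?T = "insert \<delta> (?S \<alpha> \<beta> \<union> ?S \<gamma> \<beta> \<union> (\<Union>\<rho>\<in>?S \<alpha> \<beta>. ?S \<rho> \<gamma>) \<union> (\<Union>\<rho>\<in>?S \<gamma> \<beta>. ?S \<rho> \<alpha>))"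
  let ?s = "\<lambda>\<alpha> \<gamma>. \<Sum>\<delta>\<in>?T. hact cst (?c \<alpha> \<gamma> \<delta>) (nab \<delta> \<zeta>)"
  let ?e = "\<lambda>\<alpha> \<gamma>. nab \<gamma> (nab \<beta> (nab \<alpha> \<zeta>)) - nab \<gamma> (D (\<Lambda> \<alpha> \<beta>)) - ?s \<alpha> \<gamma>"
  have fin: "finite ?T"
    by (simp add: A_finite)
  have "?e \<alpha> \<gamma> \<in> N"
    by (rule hnabla_structure_eq[OF fin]) auto
  moreover have "?e \<gamma> \<alpha> \<in> N"
    by (rule hnabla_structure_eq[OF fin]) auto
  moreover have "nab \<gamma> (nab \<beta> (nab \<alpha> \<zeta>)) = nab \<alpha> (nab \<beta> (nab \<gamma> \<zeta>))"
    by (metis hnabla_commute[OF \<Gamma>_in])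
  then have "?s \<alpha> \<gamma> - ?s \<gamma> \<alpha> = (?e \<gamma> \<alpha> - ?e \<alpha> \<gamma>) - (nab \<gamma> (D (\<Lambda> \<alpha> \<beta>)) - nab \<alpha> (D (\<Lambda> \<gamma> \<beta>)))"
    by (simp add: algebra_simps)
  ultimately have "?s \<alpha> \<gamma> - ?s \<gamma> \<alpha> \<in> N"
    using assms by (simp only: N_diff)
  then have "(\<Sum>\<delta>\<in>?T. hact cst (?c \<alpha> \<gamma> \<delta> - ?c \<gamma> \<alpha> \<delta>) (nab \<delta> \<zeta>)) \<in> N"
    by (simp only: hact_simps(2) sum_subtractf)
  then have "?c \<alpha> \<gamma> \<delta> - ?c \<gamma> \<alpha> \<delta> = 0"
    by (rule independent[OF fin]) simp
  then show ?thesis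
    by simp
qed

end

lemma associativity_potential:
  fixes A0 :: "'i \<Rightarrow> 'i \<Rightarrow> 'i \<Rightarrow> ('i, complex) mps"
  assumes \<zeta>_in: "\<zeta> \<in> hser G 0"
    and basis: "basis_mod (hact cst) Z N (\<lambda>\<alpha>. nab \<alpha> \<zeta>)"
    and A_finite: "\<And>\<alpha> \<beta>. finite {\<rho>. A0 \<alpha> \<beta> \<rho> \<noteq> 0}"
    and \<Lambda>_in: "\<And>\<alpha> \<beta>. \<Lambda> \<alpha> \<beta> \<in> hser G (- 1)"
    and structure_eq: "\<And>\<alpha> \<beta>. nab \<beta> (nab \<alpha> \<zeta>) =
      (\<Sum>\<rho> | A0 \<alpha> \<beta> \<rho> \<noteq> 0. hact cst (fps_const (A0 \<alpha> \<beta> \<rho>)) (nab \<rho> \<zeta>)) + D (\<Lambda> \<alpha> \<beta>)"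
    and obstruction: "\<And>\<alpha> \<beta> \<gamma>. nab \<gamma> (D (\<Lambda> \<alpha> \<beta>)) - nab \<alpha> (D (\<Lambda> \<gamma> \<beta>)) \<in> N"
  shows "A0 \<alpha> \<beta> \<rho> = A0 \<beta> \<alpha> \<rho>"
    and "(\<Sum>\<rho> | A0 \<alpha> \<beta> \<rho> \<noteq> 0. A0 \<alpha> \<beta> \<rho> * A0 \<rho> \<gamma> \<delta>) =
         (\<Sum>\<rho> | A0 \<beta> \<gamma> \<rho> \<noteq> 0. A0 \<beta> \<gamma> \<rho> * A0 \<rho> \<alpha> \<delta>)"
    and "mps_deriv \<alpha> (A0 \<gamma> \<beta> \<rho>) = mps_deriv \<gamma> (A0 \<alpha> \<beta> \<rho>)"
proof -
  let ?A = "\<lambda>\<alpha> \<beta> \<rho>. fps_const (A0 \<alpha> \<beta> \<rho>)"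
  have hyps: "finite {\<rho>. ?A \<alpha> \<beta> \<rho> \<noteq> 0}"
    "nab \<beta> (nab \<alpha> \<zeta>) = (\<Sum>\<rho> | ?A \<alpha> \<beta> \<rho> \<noteq> 0. hact cst (?A \<alpha> \<beta> \<rho>) (nab \<rho> \<zeta>)) + D (\<Lambda> \<alpha> \<beta>)" for \<alpha> \<beta>
    using A_finite structure_eq by (simp_all add: fps_const_eq_0_iff)
  have sym: "A0 \<alpha> \<beta> \<rho> = A0 \<beta> \<alpha> \<rho>" for \<alpha> \<beta> \<rho>
    using coeffs_symmetric[OF \<zeta>_in basis hyps(1) \<Lambda>_in hyps(2), of \<alpha> \<beta> \<rho>]
        by (metis fps_nth_fps_const)
  then show "A0 \<alpha> \<beta> \<rho> = A0 \<beta> \<alpha> \<rho>" .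
  have flat: "fps_nth (fps_X * fps_map (mps_deriv \<gamma>)
      (?A \<alpha> \<beta> \<delta>) + (\<Sum>\<rho> | A0 \<alpha> \<beta> \<rho> \<noteq> 0. ?A \<alpha> \<beta> \<rho> * ?A \<rho> \<gamma> \<delta>)) n =
    fps_nth (fps_X * fps_map (mps_deriv \<alpha>) (?A \<gamma> \<beta> \<delta>) + (\<Sum>\<rho> | A0 \<gamma> \<beta> \<rho> \<noteq> 0. ?A \<gamma> \<beta> \<rho> * ?A \<rho> \<alpha> \<delta>)) n"
    for \<alpha> \<beta> \<gamma> \<delta> n
    using flatness[OF \<zeta>_in basis hyps(1) \<Lambda>_in hyps(2) obstruction, of \<gamma> \<alpha> \<beta> \<delta>]
    by simp
  \<comment> \<open>In \<hbar>-degree 1 the products of \<hbar>-constant series drop out; in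
    \<hbar>-degree 0, used next, the derivative terms do.\<close>
  show "mps_deriv \<alpha> (A0 \<gamma> \<beta> \<rho>) = mps_deriv \<gamma> (A0 \<alpha> \<beta> \<rho>)"
    using flat[of \<alpha> \<gamma> \<beta> \<rho> 1] by (simp add: fps_sum_nth)
  show "(\<Sum>\<rho> | A0 \<alpha> \<beta> \<rho> \<noteq> 0. A0 \<alpha> \<beta> \<rho> * A0 \<rho> \<gamma> \<delta>) =
         (\<Sum>\<rho> | A0 \<beta> \<gamma> \<rho> \<noteq> 0. A0 \<beta> \<gamma> \<rho> * A0 \<rho> \<alpha> \<delta>)"
    using flat[of \<gamma> \<alpha> \<beta> \<delta> 0] by (simp add: fps_sum_nth sym[of \<gamma> \<beta>])
qed

end

section \<open>dGBV algebras\<close>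

lemma sg_simps [simp]: "sg 0 = 1" "sg 1 = - 1" "sg (- 1) = - 1"
  by (simp_all add: sg_def)

text \<open>The abstract case. For a dGBV algebra \<open>Q_\<Delta>\<close> comes from the square of
  \<Delta> + Q being zero, and \<open>D_square\<close> from the existence of the cohomology in which
  the weak primitive form lives.\<close>

locale mc_setting = bv_setting cst G \<Delta> Q \<Gamma>
  for cst :: "complex \<Rightarrow> 'b :: ring_1" and G :: "int \<Rightarrow> 'b set" and \<Delta> Q and \<Gamma> :: "('i, 'b) mps" +
  assumes \<Delta>_in: "a \<in> G j \<Longrightarrow> \<Delta> a \<in> G (j + 1)"
    and Q_in: "a \<in> G j \<Longrightarrow> Q a \<in> G (j + 1)"
    and \<Delta>_square: "a \<in> G j \<Longrightarrow> \<Delta> (\<Delta> a) = 0"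
    and Q_\<Delta>: "a \<in> G j \<Longrightarrow> Q (\<Delta> a) = - \<Delta> (Q a)"
    and \<Delta>_poisson: "a \<in> G 0 \<Longrightarrow> b \<in> G j \<Longrightarrow> c \<in> G l \<Longrightarrow>
      ell2 \<Delta> 0 a (b * c) = ell2 \<Delta> 0 a b * c + sg j * (b * ell2 \<Delta> 0 a c)"
    and Q_leibniz: "a \<in> G i \<Longrightarrow> b \<in> G j \<Longrightarrow> Q (a * b) = Q a * b + sg i * (a * Q b)"
    and supercomm: "a \<in> G i \<Longrightarrow> b \<in> G j \<Longrightarrow> a * b = sg (i * j) * (b * a)"
    and mc: "maurer_cartan cst G (\<lambda>b. \<Delta> b + Q b) \<Gamma>"
    and D_square: "w \<in> hser G j \<Longrightarrow> D (D w) = 0"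
begin

abbreviation q where "q \<equiv> mps_map Q"

text \<open>The obstruction of the abstract case: by \<open>D_hnabla\<close> and
  \<open>D_d\<Gamma>\<close>, \<open>D\<close> commutes with the connection when the derivatives of
  \<mu> vanish.\<close>

definition \<mu> where "\<mu> = del \<Gamma>"

text \<open>Division is available only through the structure map: 2 is cancelled by multiplying with
  \<open>cst (1 / 2)\<close>.\<close>

lemma half: "x = y" if "x + x = y + y" for x y :: "('i, 'b) mps"
proof (rule mps_eqI)
  fix m
  have "cst (1 / 2) * (z + z) = z" for z
  proof -
    have "cst (1 / 2) * (z + z) = (cst (1 / 2) + cst (1 / 2)) * z"
      by (simp add: distrib_left distrib_right)
    also have "cst (1 / 2) + cst (1 / 2) = 1"
      by (simp add: cst_add[symmetric] cst_one)
    finally show ?thesis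
      by simp
  qed
  moreover have "mps_nth x m + mps_nth x m = mps_nth y m + mps_nth y m"
    using arg_cong[OF that, of "\<lambda>u. mps_nth u m"] by simp
  ultimately show "mps_nth x m = mps_nth y m"
    by metis
qed

lemma del_in: "f \<in> mser G j \<Longrightarrow> del f \<in> mser G (j + 1)"
  by (simp add: mser_def \<Delta>_in)

lemma q_in: "f \<in> mser G j \<Longrightarrow> q f \<in> mser G (j + 1)"
  by (simp add: mser_def Q_in)

lemma del_del: "f \<in> mser G j \<Longrightarrow> del (del f) = 0"
  by (rule mps_eqI) (simp add: mser_def \<Delta>_square[of _ j])

lemma q_del: "f \<in> mser G j \<Longrightarrow> q (del f) = - del (q f)"
  by (rule mps_eqI) (simp add: mser_def Q_\<Delta>[of _ j])

lemma q_mult: "f \<in> mser G i \<Longrightarrow> g \<in> mser G j \<Longrightarrow> q (f * g) = q f * g + sg i * (f * q g)"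
  by (rule leibniz_mps[OF Q_linear]) (auto simp: Q_leibniz)

lemma d0_mult: "f \<in> mser G i \<Longrightarrow> g \<in> mser G j \<Longrightarrow> d0 (f * g) = d0 f * g + sg i * (f * d0 g)"
  unfolding d0_def
  by (subst ell2_poisson_mps[OF \<Delta>_linear \<Gamma>_in, of f i g j])
    (auto simp: \<Delta>_poisson q_mult algebra_simps)

lemma odd_anticommute:
  fixes f g :: "('i, 'b) mps"
  assumes f: "f \<in> mser G i" and g: "g \<in> mser G j" and ij: "odd i" "odd j"
  shows "f * g = - (g * f)"
proof (rule mps_eqI)
  fix m
  have "mps_nth f a * mps_nth g b = - (mps_nth g b * mps_nth f a)" for a b
    using supercomm[of "mps_nth f a" i "mps_nth g b" j] f g ij by (simp add: mser_def sg_def)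
  then show "mps_nth (f * g) m = mps_nth (- (g * f)) m"
    unfolding mps_nth_simps mps_nth_mult
    by (subst (2) sum_splits_swap) (simp add: sum_negf split_def)
qed

section \<open>Consequences of the Maurer-Cartan equation and of \<open>D_square\<close>\<close>

lemma \<mu>_in: "\<mu> \<in> mser G 1"
  unfolding \<mu>_def by (rule del_\<Gamma>_in)

text \<open>This is the coefficient of \<hbar> in the square of \<hbar>\<Delta> + \<open>d0\<close>,
  evaluated on a series constant in \<hbar>.\<close>

lemma del_d0:
  assumes f: "f \<in> mser G j"
  shows "del (d0 f) = - d0 (del f)"
proof -
  have "fps_nth (D (D (fps_const f))) 1 = 0"
    using D_square[OF hser_const[OF f]] by simp
  moreover have "d0 0 = 0" "del 0 = 0"
    using d0_add[OF mser_zero mser_zero] mps_map_zero[OF \<Delta>_linear] by simp_all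
  ultimately show ?thesis
    by (simp add: tw_diff_nth eq_neg_iff_add_eq_0)
qed

text \<open>Expand \<open>del_d0\<close>. Since \<Delta> squares to zero and anticommutes with Q,
  only the two terms containing \<mu> remain.\<close>

lemma del_\<mu>_mult:
  assumes f: "f \<in> mser G j"
  shows "del (\<mu> * f) = - (\<mu> * del f)"
proof -
  note ins = q_in[OF f] del_in[OF f] mser_mult0[OF \<Gamma>_in f] mser_mult0[OF \<Gamma>_in del_in[OF f]]
    del_in[OF mser_mult0[OF \<Gamma>_in f]] mser_mult[OF \<mu>_in f]
  have \<mu>f: "\<mu> * f \<in> mser G (j + 1)"
    using mser_mult[OF \<mu>_in f] by (simp add: add.commute)
  have "del (d0 f) = del (q f) - del (\<mu> * f) - del (\<Gamma> * del f)"
    by (simp add: d0_eq \<mu>_def[symmetric] mps_map_add[OF \<Delta>_linear, of _ "j + 1"]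
        mps_map_diff[OF \<Delta>_linear, of _ "j + 1"] mser_diff ins \<mu>f del_del[of _ j])
  moreover have "d0 (del f) = - del (q f) + del (\<Gamma> * del f) - \<mu> * del f"
    by (simp add: d0_eq \<mu>_def[symmetric] q_del[OF f] del_del[OF f])
  ultimately show ?thesis
    using del_d0[OF f] by (simp add: algebra_simps eq_neg_iff_add_eq_0)
qed

lemma d\<mu>_in: "mps_deriv \<beta> \<mu> \<in> mser G 1"
  by (rule mser_deriv[OF \<mu>_in])

text \<open>Differentiate \<open>del_\<mu>_mult\<close> in \<open>t\<^sup>\<beta>\<close>; the terms
  with the derivative on \<open>f\<close> cancel by \<open>del_\<mu>_mult\<close> itself.\<close>

lemma del_d\<mu>_mult:
  assumes f: "f \<in> mser G j"
  shows "del (mps_deriv \<beta> \<mu> * f) = - (mps_deriv \<beta> \<mu> * del f)"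
proof -
  note ins = mser_mult[OF \<mu>_in f] mser_mult[OF \<mu>_in mser_deriv[OF f]] mser_mult[OF d\<mu>_in f]
  have "mps_deriv \<beta> (del (\<mu> * f)) = del (mps_deriv \<beta> \<mu> * f) + del (\<mu> * mps_deriv \<beta> f)"
    by (simp add: mps_map_deriv[OF \<Delta>_linear ins(1), symmetric] mps_deriv_mult
        mps_map_add[OF \<Delta>_linear, of _ "1 + j"] ins)
  also have "del (\<mu> * mps_deriv \<beta> f) = - (\<mu> * mps_deriv \<beta> (del f))"
    by (simp add: del_\<mu>_mult[OF mser_deriv[OF f]] mps_map_deriv[OF \<Delta>_linear f])
  finally show ?thesis
    by (simp add: del_\<mu>_mult[OF f] mps_deriv_mult algebra_simps)
qed

text \<open>Doubling removes the factor 1/2 from the Maurer-Cartan equation. Q is a derivation, so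
  the bracket of \<Delta> + Q is that of \<Delta>.\<close>

lemma mc_doubled: "q \<Gamma> + q \<Gamma> + del (\<Gamma> * \<Gamma>) + \<mu> + \<mu> - \<Gamma> * \<mu> - \<Gamma> * \<mu> = 0"
proof -
  let ?h = "mps_const (cst (1 / 2)) :: ('i, 'b) mps"
  let ?e = "del (\<Gamma> * \<Gamma>) - \<Gamma> * \<mu> - \<Gamma> * \<mu>"
  have map: "mps_map (\<lambda>b. \<Delta> b + Q b) f = del f + q f" for f :: "('i, 'b) mps"
    by (rule mps_eqI) simp
  have "\<mu> * \<Gamma> = \<Gamma> * \<mu>"
    by (rule mser_commute[OF \<Gamma>_in \<mu>_in, symmetric])
  then have "ell2 (mps_map (\<lambda>b. \<Delta> b + Q b)) 0 \<Gamma> \<Gamma> = ?e"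
    by (simp only: ell2_def map) (simp add: q_mult[OF \<Gamma>_in \<Gamma>_in] \<mu>_def[symmetric] algebra_simps)
  then have "\<mu> + q \<Gamma> + ?h * ?e = 0"
    using mc by (simp add: maurer_cartan_def map \<mu>_def)
  moreover have "?h * x + ?h * x = x" for x
  proof -
    have "?h + ?h = 1"
      by (rule mps_eqI) (simp add: mps_nth_const mps_nth_one cst_add[symmetric] cst_one)
    then show ?thesis
      by (simp add: distrib_right[symmetric])
  qed
  ultimately have "(\<mu> + q \<Gamma> + ?h * ?e) + (\<mu> + q \<Gamma> + ?h * ?e) = 0" and h: "?h * ?e + ?h * ?e = ?e"
    by simp_all
  moreover have "(\<mu> + q \<Gamma> + ?h * ?e) + (\<mu> + q \<Gamma> + ?h * ?e) =
      (\<mu> + q \<Gamma>) + (\<mu> + q \<Gamma>) + (?h * ?e + ?h * ?e)"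
    by (simp only: add.assoc add.commute add.left_commute)
  ultimately have "(\<mu> + q \<Gamma>) + (\<mu> + q \<Gamma>) + ?e = 0"
    by (simp only: h)
  then show ?thesis
    by (simp add: algebra_simps)
qed

lemma \<mu>_square: "\<mu> * \<mu> = 0"
proof -
  have "\<mu> * \<mu> = - (\<mu> * \<mu>)"
    by (rule odd_anticommute[OF \<mu>_in \<mu>_in]) simp_all
  then have "\<mu> * \<mu> + \<mu> * \<mu> = 0 + 0"
    by (simp only: eq_neg_iff_add_eq_0 add_0_right)
  then show ?thesis
    by (rule half)
qed

text \<open>Apply \<Delta> to the Maurer-Cartan equation. The term \<Delta>(\<Gamma>\<mu>) vanishes
  by \<open>del_\<mu>_mult\<close> and \<open>\<mu>_square\<close>, so \<Delta>Q\<Gamma> = 0, and Q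
  anticommutes with \<Delta>.\<close>

lemma q_\<mu>: "q \<mu> = 0"
proof -
  note ins = q_in[OF \<Gamma>_in] del_in[OF mser_mult0[OF \<Gamma>_in \<Gamma>_in]] \<mu>_in mser_mult0[OF \<Gamma>_in \<mu>_in]
  have "0 = del (q \<Gamma> + q \<Gamma> + del (\<Gamma> * \<Gamma>) + \<mu> + \<mu> - \<Gamma> * \<mu> - \<Gamma> * \<mu>)"
    by (simp add: mc_doubled mps_map_zero[OF \<Delta>_linear])
  also have "\<dots> = del (q \<Gamma>) + del (q \<Gamma>) - del (\<Gamma> * \<mu>) - del (\<Gamma> * \<mu>)"
    using ins by (simp add: mps_map_add[OF \<Delta>_linear, of _ 1] mps_map_diff[OF \<Delta>_linear, of _ 1] mser_add mser_diff
        del_del[OF mser_mult0[OF \<Gamma>_in \<Gamma>_in]]) (simp add: \<mu>_def del_del[OF \<Gamma>_in])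
  also have "del (\<Gamma> * \<mu>) = 0"
    using del_\<mu>_mult[OF \<Gamma>_in] \<mu>_square by (simp add: mser_commute[OF \<Gamma>_in \<mu>_in] \<mu>_def[symmetric])
  finally have "del (q \<Gamma>) = 0"
    by - (rule half, simp)
  then show ?thesis
    by (simp add: \<mu>_def q_del[OF \<Gamma>_in])
qed

text \<open>Multiplication by the odd element \<open>mps_deriv \<beta> \<mu>\<close> anticommutes
  with Q (by \<open>q_\<mu>\<close>), with \<Delta> and with multiplication by \<mu>, and commutes
  with multiplication by \<Gamma>.\<close>

lemma d0_d\<mu>_mult:
  assumes f: "f \<in> mser G j"
  shows "d0 (mps_deriv \<beta> \<mu> * f) = - (mps_deriv \<beta> \<mu> * d0 f)"
proof -
  let ?m = "mps_deriv \<beta> \<mu>"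
  have comm: "\<Gamma> * (?m * g) = ?m * (\<Gamma> * g)" for g
    by (simp add: mult.assoc[symmetric] mser_commute[OF \<Gamma>_in d\<mu>_in])
  have anti: "\<mu> * (?m * g) = - (?m * (\<mu> * g))" for g
    by (simp add: mult.assoc[symmetric] odd_anticommute[OF \<mu>_in d\<mu>_in, of \<beta>])
  have "q ?m = 0"
    by (simp add: mps_map_deriv[OF Q_linear \<mu>_in] q_\<mu>)
  then have "q (?m * f) = - (?m * q f)"
    by (simp add: q_mult[OF d\<mu>_in f])
  then show ?thesis
    by (simp add: d0_eq comm del_d\<mu>_mult[OF mser_mult0[OF \<Gamma>_in f]] del_d\<mu>_mult[OF f]
        \<mu>_def[symmetric] anti algebra_simps)
qed

lemma D_d\<mu>_mult:
  assumes w: "w \<in> hser G j"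
  shows "D (fps_const (mps_deriv \<beta> \<mu>) * w) = - (fps_const (mps_deriv \<beta> \<mu>) * D w)"
proof -
  have "fps_nth w n \<in> mser G j" for n
    using w by (simp add: hser_def)
  note d0_d\<mu>_mult[OF this] del_d\<mu>_mult[OF this]
  then show ?thesis
    by (intro fps_ext) (simp add: tw_diff_nth distrib_left)
qed

text \<open>The coefficient of \<hbar> is \<Delta> of the derivative of \<Gamma>, that is,
  \<open>mps_deriv \<gamma> \<mu>\<close>. The constant coefficient is its negative, by the
  derivative of the Maurer-Cartan equation.\<close>

lemma D_d\<Gamma>: "D (fps_const (mps_deriv \<gamma> \<Gamma>)) = (fps_X - 1) * fps_const (mps_deriv \<gamma> \<mu>)"
proof -
  let ?g = "mps_deriv \<gamma> \<Gamma>"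
  note g = mser_deriv[OF \<Gamma>_in, of \<gamma>]
  have del_g: "del ?g = mps_deriv \<gamma> \<mu>"
    by (simp add: \<mu>_def mps_map_deriv[OF \<Delta>_linear \<Gamma>_in])
  have comm: "?g * \<Gamma> = \<Gamma> * ?g" "?g * \<mu> = \<mu> * ?g"
    using mser_commute[OF g \<Gamma>_in] mser_commute[OF g \<mu>_in] by auto
  have "0 = mps_deriv \<gamma> (q \<Gamma> + q \<Gamma> + del (\<Gamma> * \<Gamma>) + \<mu> + \<mu> - \<Gamma> * \<mu> - \<Gamma> * \<mu>)"
    by (simp add: mc_doubled)
  also have "\<dots> = (d0 ?g + mps_deriv \<gamma> \<mu>) + (d0 ?g + mps_deriv \<gamma> \<mu>)"
    by (simp add: mps_map_deriv[OF Q_linear \<Gamma>_in, symmetric] mps_deriv_mult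
        mps_map_deriv[OF \<Delta>_linear mser_mult0[OF \<Gamma>_in \<Gamma>_in], symmetric] comm
        mps_map_add[OF \<Delta>_linear mser_mult0[OF \<Gamma>_in g] mser_mult0[OF \<Gamma>_in g]]
        d0_eq del_g \<mu>_def[symmetric])
  finally have "d0 ?g + mps_deriv \<gamma> \<mu> = 0"
    by - (rule half, simp)
  then have "d0 ?g = - mps_deriv \<gamma> \<mu>"
    by (simp add: eq_neg_iff_add_eq_0)
  moreover have "d0 0 = 0" "del 0 = 0"
    using d0_add[OF mser_zero mser_zero] mps_map_zero[OF \<Delta>_linear] by simp_all
  ultimately show ?thesis
    by (intro fps_ext) (auto simp: tw_diff_nth del_g left_diff_distrib)
qed

text \<open>From \<open>fps_X * u = u\<close> each coefficient equals the previous one, and the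
  first is 0.\<close>

lemma X_minus_one_cancel:
  fixes u :: "('i, 'b) mps fps"
  assumes "(fps_X - 1) * u = 0"
  shows "u = 0"
proof (rule fps_ext)
  fix n
  have Xu: "fps_X * u = u"
    using assms by (simp add: left_diff_distrib)
  have "fps_nth (fps_X * u) 0 = 0" "fps_nth (fps_X * u) (Suc n) = fps_nth u n" for n
    by simp_all
  then have "fps_nth u 0 = 0" "fps_nth u (Suc n) = fps_nth u n" for n
    unfolding Xu by auto
  then show "fps_nth u n = fps_nth 0 n"
    by (induction n) simp_all
qed

lemma one_cocycle: "1 \<in> Z"
proof -
  \<comment> \<open>Inserting 1 in the derivation rules makes \<Delta>1 and Q1 equal to their
    doubles.\<close>
  have "\<Delta> 1 = 0" "Q 1 = 0"
    using \<Delta>_poisson[OF one_in one_in one_in] Q_leibniz[OF one_in one_in] by (simp_all add: ell2_def)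
  then have "del 1 = 0" "q 1 = 0"
    using mps_map_zero[OF \<Delta>_linear] mps_map_zero[OF Q_linear]
    by (auto intro!: mps_eqI simp: mps_nth_one K_zero[OF \<Delta>_linear] K_zero[OF Q_linear])
  moreover have "d0 0 = 0" "del 0 = 0"
    using d0_add[OF mser_zero mser_zero] mps_map_zero[OF \<Delta>_linear] by simp_all
  ultimately have "D (fps_const 1) = 0"
    by (intro fps_ext) (auto simp: tw_diff_nth, simp add: d0_eq)
  then show ?thesis
    using hser_const[OF mser_one] by (simp add: cocycles0_def)
qed

section \<open>Exactness in the ideal generated by two derivatives of \<mu>\<close>

definition \<mu>_ideal :: "'i \<Rightarrow> 'i \<Rightarrow> int \<Rightarrow> ('i, 'b) mps set" where
  "\<mu>_ideal \<alpha> \<gamma> j = {mps_deriv \<alpha> \<mu> * a + mps_deriv \<gamma> \<mu> * b | a b. a \<in> mser G (j - 1) \<and> b \<in> mser G (j - 1)}"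

lemma \<mu>_ideal_in: "y \<in> \<mu>_ideal \<alpha> \<gamma> j \<Longrightarrow> y \<in> mser G j"
proof -
  have "mps_deriv \<alpha> \<mu> * a \<in> mser G j" if "a \<in> mser G (j - 1)" for \<alpha> a
    using mser_mult[OF d\<mu>_in that] by simp
  then show "y \<in> \<mu>_ideal \<alpha> \<gamma> j \<Longrightarrow> y \<in> mser G j"
    by (auto simp: \<mu>_ideal_def intro!: mser_add)
qed

lemma \<mu>_ideal_diff: "y \<in> \<mu>_ideal \<alpha> \<gamma> j \<Longrightarrow> z \<in> \<mu>_ideal \<alpha> \<gamma> j \<Longrightarrow> y - z \<in> \<mu>_ideal \<alpha> \<gamma> j"
proof -
  assume "y \<in> \<mu>_ideal \<alpha> \<gamma> j" "z \<in> \<mu>_ideal \<alpha> \<gamma> j"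
  then obtain a b a' b' where ab: "{a, b, a', b'} \<subseteq> mser G (j - 1)"
    "y = mps_deriv \<alpha> \<mu> * a + mps_deriv \<gamma> \<mu> * b" "z = mps_deriv \<alpha> \<mu> * a' + mps_deriv \<gamma> \<mu> * b'"
    unfolding \<mu>_ideal_def by blast
  then have "y - z = mps_deriv \<alpha> \<mu> * (a - a') + mps_deriv \<gamma> \<mu> * (b - b')"
    by (simp add: algebra_simps)
  then show ?thesis
    using ab(1) unfolding \<mu>_ideal_def by (auto intro!: exI mser_diff)
qed

lemma \<mu>_ideal_del: "y \<in> \<mu>_ideal \<alpha> \<gamma> j \<Longrightarrow> del y \<in> \<mu>_ideal \<alpha> \<gamma> (j + 1)"
proof -
  assume "y \<in> \<mu>_ideal \<alpha> \<gamma> j"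
  then obtain a b where ab: "a \<in> mser G (j - 1)" "b \<in> mser G (j - 1)"
    and y: "y = mps_deriv \<alpha> \<mu> * a + mps_deriv \<gamma> \<mu> * b"
    unfolding \<mu>_ideal_def by blast
  have "del y = mps_deriv \<alpha> \<mu> * (- del a) + mps_deriv \<gamma> \<mu> * (- del b)"
    unfolding y using ab
    by (simp add: mps_map_add[OF \<Delta>_linear mser_mult[OF d\<mu>_in] mser_mult[OF d\<mu>_in]] del_d\<mu>_mult)
  moreover have "- del a \<in> mser G (j + 1 - 1)" "- del b \<in> mser G (j + 1 - 1)"
    using mser_uminus[OF del_in[OF ab(1)]] mser_uminus[OF del_in[OF ab(2)]] by simp_all
  ultimately show ?thesis
    unfolding \<mu>_ideal_def by blast
qed

lemma \<mu>_ideal_odd_mult: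
  assumes k: "k \<in> mser G (- 1)" and y: "y \<in> \<mu>_ideal \<alpha> \<gamma> j"
  shows "k * y \<in> \<mu>_ideal \<alpha> \<gamma> (j - 1)"
proof -
  obtain a b where ab: "a \<in> mser G (j - 1)" "b \<in> mser G (j - 1)"
    and y: "y = mps_deriv \<alpha> \<mu> * a + mps_deriv \<gamma> \<mu> * b"
    using y unfolding \<mu>_ideal_def by blast
  have "k * (mps_deriv \<alpha> \<mu> * a) = mps_deriv \<alpha> \<mu> * (- (k * a))" for \<alpha> a
    by (simp add: mult.assoc[symmetric] odd_anticommute[OF k d\<mu>_in, of \<alpha>])
  then have "k * y = mps_deriv \<alpha> \<mu> * (- (k * a)) + mps_deriv \<gamma> \<mu> * (- (k * b))"
    by (simp only: y distrib_left)
  moreover have "- (k * c) \<in> mser G (j - 1 - 1)" if "c \<in> mser G (j - 1)" for c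
    using mser_uminus[OF mser_mult[OF k that]] by (simp add: algebra_simps)
  ultimately show ?thesis
    using ab unfolding \<mu>_ideal_def by blast
qed

text \<open>On the ideal \<open>d0 k\<close> acts as 1, so \<open>d0 (k * y)\<close> is
  \<open>y - k * d0 y\<close>: multiplication by \<open>k\<close> is a contracting homotopy.\<close>

lemma \<mu>_ideal_exact:
  assumes k: "k \<in> mser G (- 1)" and unit: "\<And>\<beta>. mps_deriv \<beta> \<mu> * d0 k = mps_deriv \<beta> \<mu>"
    and y: "y \<in> \<mu>_ideal \<alpha> \<gamma> j" and "d0 y = 0"
  shows "d0 (k * y) = y"
proof -
  have d0k: "d0 k \<in> mser G 0"
    using q_in[OF k] del_in[OF mser_mult0[OF \<Gamma>_in k]] mser_mult[OF \<mu>_in k] mser_mult0[OF \<Gamma>_in del_in[OF k]]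
    unfolding d0_eq \<mu>_def by (simp add: mser_add mser_diff)
  have "d0 k * (mps_deriv \<beta> \<mu> * a) = mps_deriv \<beta> \<mu> * a" for \<beta> a
    by (simp add: mult.assoc[symmetric] mser_commute[OF d0k d\<mu>_in, of \<beta>] unit[of \<beta>])
  then have "d0 k * y = y"
    using y by (auto simp: \<mu>_ideal_def distrib_left)
  then show ?thesis
    using \<open>d0 y = 0\<close> by (simp add: d0_mult[OF k \<mu>_ideal_in[OF y]])
qed

text \<open>Solve \<open>D v = y\<close> coefficientwise:
  \<open>del (v (n - 1)) + d0 (v n) = fps_nth y n\<close>. Moving the known term to the right leaves
  \<open>r n\<close>, and \<open>v n = k * r n\<close> is a solution by
  \<open>\<mu>_ideal_exact\<close>.\<close>

lemma \<mu>_ideal_cocycle_exact: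
  assumes k: "k \<in> mser G (- 1)" and unit: "\<And>\<beta>. mps_deriv \<beta> \<mu> * d0 k = mps_deriv \<beta> \<mu>"
    and y: "\<And>n. fps_nth y n \<in> \<mu>_ideal \<alpha> \<gamma> 0" and Dy: "D y = 0"
  shows "y \<in> N"
proof -
  define v where "v = rec_nat (k * fps_nth y 0) (\<lambda>n u. k * (fps_nth y (Suc n) - del u))"
  define r where "r n = (case n of 0 \<Rightarrow> fps_nth y 0 | Suc n' \<Rightarrow> fps_nth y n - del (v n'))" for n
  have v_eq: "v n = k * r n" for n
    by (cases n) (simp_all add: v_def r_def)
  have Dy_nth: "(if n = 0 then 0 else del (fps_nth y (n - 1))) + d0 (fps_nth y n) = 0" for n
    using arg_cong[OF Dy, of "\<lambda>w. fps_nth w n"] by (simp add: tw_diff_nth)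
  have y_in: "fps_nth y n \<in> mser G 0" for n
    by (rule \<mu>_ideal_in[OF y])
  \<comment> \<open>Exactness of \<open>r n\<close> requires it to be \<open>d0\<close>-closed. In
    the induction step \<open>d0 (del (v n))\<close> is \<open>- del (r n)\<close>, and the last
    conjunct replaces \<open>del (r n)\<close> by \<open>del (fps_nth y n)\<close>, which
    \<open>Dy_nth\<close> controls.\<close>
  have r: "r n \<in> \<mu>_ideal \<alpha> \<gamma> 0 \<and> d0 (r n) = 0 \<and> del (r n) = del (fps_nth y n)" for n
  proof (induction n)
    case 0
    show ?case
      using y Dy_nth[of 0] by (simp add: r_def)
  next
    case (Suc n)
    have vn: "v n \<in> \<mu>_ideal \<alpha> \<gamma> (- 1)"
      using \<mu>_ideal_odd_mult[OF k, of "r n" \<alpha> \<gamma> 0] Suc by (simp add: v_eq)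
    have d0v: "d0 (v n) = r n"
      using \<mu>_ideal_exact[OF k unit, of "r n" \<alpha> \<gamma> 0] Suc by (simp add: v_eq)
    have del_v: "del (v n) \<in> \<mu>_ideal \<alpha> \<gamma> 0"
      using \<mu>_ideal_del[OF vn] by simp
    have "d0 (fps_nth y (Suc n) - del (v n)) = d0 (fps_nth y (Suc n)) - d0 (del (v n))"
      using d0_add[OF y_in mser_uminus[OF \<mu>_ideal_in[OF del_v]], of "Suc n"]
        d0_add[OF mser_uminus[OF \<mu>_ideal_in[OF del_v]] \<mu>_ideal_in[OF del_v]]
        d0_add[OF mser_zero mser_zero] by (simp add: eq_neg_iff_add_eq_0)
    also have "\<dots> = d0 (fps_nth y (Suc n)) + del (fps_nth y n)"
      using del_d0[OF \<mu>_ideal_in[OF vn]] Suc by (simp add: d0v)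
    also have "\<dots> = 0"
      using Dy_nth[of "Suc n"] by (simp add: add.commute)
    finally have "d0 (fps_nth y (Suc n) - del (v n)) = 0" .
    moreover have "del (fps_nth y (Suc n) - del (v n)) = del (fps_nth y (Suc n))"
      using mps_map_diff[OF \<Delta>_linear y_in \<mu>_ideal_in[OF del_v]] del_del[OF \<mu>_ideal_in[OF vn]] by simp
    ultimately show ?case
      using \<mu>_ideal_diff[OF y del_v] by (simp add: r_def)
  qed
  have v_in: "v n \<in> mser G (- 1)" for n
    using \<mu>_ideal_in[OF \<mu>_ideal_odd_mult[OF k, of "r n" \<alpha> \<gamma> 0]] r[of n] by (simp add: v_eq)
  have d0v: "d0 (v n) = r n" for n
    using \<mu>_ideal_exact[OF k unit, of "r n" \<alpha> \<gamma> 0] r[of n] by (simp add: v_eq)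
  have "D (Abs_fps v) = y"
  proof (rule fps_ext)
    fix n
    show "fps_nth (D (Abs_fps v)) n = fps_nth y n"
      by (cases n) (simp_all add: tw_diff_nth d0v, simp_all add: r_def)
  qed
  moreover have "Abs_fps v \<in> hser G (- 1)"
    by (simp add: hser_def v_in)
  ultimately show ?thesis
    using D_in_N by metis
qed

section \<open>Exactness of the obstruction\<close>

lemma basis_rep:
  assumes basis: "basis_mod (hact cst) Z N v" and "w \<in> Z"
  obtains T c \<kappa> where "finite T" "\<kappa> \<in> hser G (- 1)" "w = (\<Sum>\<alpha>\<in>T. hact cst (c \<alpha>) (v \<alpha>)) + D \<kappa>"
proof -
  obtain p where "w - (\<Sum>\<alpha>\<in>Poly_Mapping.keys p. hact cst (Poly_Mapping.lookup p \<alpha>) (v \<alpha>)) \<in> N"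
    using assms unfolding basis_mod_def by blast
  then obtain \<kappa> where "\<kappa> \<in> hser G (- 1)"
    "w - (\<Sum>\<alpha>\<in>Poly_Mapping.keys p. hact cst (Poly_Mapping.lookup p \<alpha>) (v \<alpha>)) = D \<kappa>"
    unfolding coboundaries0_def by blast
  then show ?thesis
    by (intro that[of "Poly_Mapping.keys p" \<kappa> "Poly_Mapping.lookup p"])
        (simp_all add: algebra_simps)
qed

text \<open>\<open>D\<close> and \<open>nab \<gamma>\<close> commute up to \<hbar> - 1 times
  multiplication by \<open>mps_deriv \<gamma> \<mu>\<close>, so the difference is a coboundary minus
  \<open>(fps_X - 1) * y\<close>. It remains to see that \<open>y\<close> is a cocycle with
  coefficients in the ideal, hence exact.\<close>

lemma obstruction_exact:
  fixes A :: "'i \<Rightarrow> 'i \<Rightarrow> 'i \<Rightarrow> ('i, complex) mps fps"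
  assumes \<zeta>_in: "\<zeta> \<in> hser G 0"
    and basis: "basis_mod (hact cst) Z N (\<lambda>\<alpha>. nab \<alpha> \<zeta>)"
    and \<Lambda>_in: "\<And>\<alpha> \<beta>. \<Lambda> \<alpha> \<beta> \<in> hser G (- 1)"
    and structure_eq: "\<And>\<alpha> \<beta>. nab \<beta> (nab \<alpha> \<zeta>) =
      (\<Sum>\<rho> | A \<alpha> \<beta> \<rho> \<noteq> 0. hact cst (A \<alpha> \<beta> \<rho>) (nab \<rho> \<zeta>)) + D (\<Lambda> \<alpha> \<beta>)"
  shows "nab \<gamma> (D (\<Lambda> \<alpha> \<beta>)) - nab \<alpha> (D (\<Lambda> \<gamma> \<beta>)) \<in> N"
proof -
  let ?V = "\<lambda>\<alpha>. nab \<alpha> \<zeta>" and ?m = "\<lambda>\<beta>. fps_const (mps_deriv \<beta> \<mu>)"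
  have V_in: "?V \<alpha> \<in> hser G 0" and DV: "D (?V \<alpha>) = 0" for \<alpha>
    using basis by (auto simp: basis_mod_def cocycles0_def)
  have m_in: "?m \<beta> \<in> hser G 1" for \<beta>
    by (rule hser_const[OF d\<mu>_in])
  have m_hact: "?m \<beta> * hact cst r w = hact cst r (?m \<beta> * w)" for \<beta> r w
    by (rule hact_left_commute[OF m_in])
  have D_nab: "D (nab \<gamma> w) = nab \<gamma> (D w) + (fps_X - 1) * (?m \<gamma> * w)" if "w \<in> hser G j" for w j \<gamma>
    using D_hnabla[OF that] by (simp add: D_d\<Gamma> mult.assoc)
  \<comment> \<open>Both parts of the right side of \<open>structure_eq\<close> are closed, so
    commuting \<open>D\<close> past \<open>nab \<beta>\<close> shows that \<hbar> - 1 times this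
    product is 0.\<close>
  have mV: "?m \<beta> * ?V \<alpha> = 0" for \<alpha> \<beta>
  proof -
    let ?s = "\<lambda>\<rho>. hact cst (A \<alpha> \<beta> \<rho>) (?V \<rho>)"
    have "D (sum ?s T) = 0" if "finite T" for T
      using that
    proof (induction T)
      case (insert \<rho> T)
      have "D (sum ?s (insert \<rho> T)) = D (?s \<rho> + sum ?s T)"
        using insert by simp
      also have "\<dots> = D (?s \<rho>) + D (sum ?s T)"
        by (rule D_add[OF hser_hact[OF V_in] hser_sum[OF hser_hact[OF V_in]]])
      finally have "D (sum ?s (insert \<rho> T)) = D (?s \<rho>) + D (sum ?s T)" .
      then show ?case
        using insert by (simp add: D_hact[OF V_in] DV hact_simps)
    qed (simp add: D_zero)
    \<comment> \<open>Over an infinite support the sum is 0 by convention, and \<open>D\<close>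
      vanishes on it as well.\<close>
    then have "D (sum ?s {\<rho>. A \<alpha> \<beta> \<rho> \<noteq> 0}) = 0"
      by (cases "finite {\<rho>. A \<alpha> \<beta> \<rho> \<noteq> 0}") (simp_all add: D_zero)
    \<comment> \<open>The degree of \<open>D (\<Lambda> \<alpha> \<beta>)\<close> is read off from
      the structure equation, whose other two terms have degree 0.\<close>
    moreover have "D (\<Lambda> \<alpha> \<beta>) \<in> hser G 0"
    proof -
      have "D (\<Lambda> \<alpha> \<beta>) = nab \<beta> (?V \<alpha>) - sum ?s {\<rho>. A \<alpha> \<beta> \<rho> \<noteq> 0}"
        by (simp add: structure_eq)
      then show ?thesis
        using hser_diff[OF hser_hnabla[OF \<Gamma>_in V_in] hser_sum[OF hser_hact[OF V_in]]] by simp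
    qed
    ultimately have "D (nab \<beta> (?V \<alpha>)) = 0"
      unfolding structure_eq
      by (subst D_add[OF hser_sum[OF hser_hact[OF V_in]]]) (simp_all add: D_square[OF \<Lambda>_in])
    then have "(fps_X - 1) * (?m \<beta> * ?V \<alpha>) = 0"
      by (simp add: D_nab[OF V_in] DV hnabla_zero)
    then show ?thesis
      by (rule X_minus_one_cancel)
  qed
  have m_sum: "?m \<beta> * (\<Sum>\<alpha>\<in>T. hact cst (c \<alpha>) (?V \<alpha>)) = 0" for \<beta> T c
    by (simp add: sum_distrib_left m_hact mV hact_simps)
  \<comment> \<open>Expand the cocycle 1 in the basis. Products with \<open>?m \<beta>\<close> kill
    the basis part, so \<open>?m \<beta> * D \<kappa>\<close> is \<open>?m \<beta>\<close>; the
    constant coefficient of \<kappa> gives the homotopy \<open>k\<close>.\<close>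
  obtain T c \<kappa> where \<kappa>: "\<kappa> \<in> hser G (- 1)" "1 = (\<Sum>\<alpha>\<in>T. hact cst (c \<alpha>) (?V \<alpha>)) + D \<kappa>"
    using basis_rep[OF basis one_cocycle] by metis
  define k where "k = fps_nth \<kappa> 0"
  have k_in: "k \<in> mser G (- 1)"
    using \<kappa>(1) by (simp add: hser_def k_def)
  have unit: "mps_deriv \<beta> \<mu> * d0 k = mps_deriv \<beta> \<mu>" for \<beta>
  proof -
    have "?m \<beta> * 1 = ?m \<beta> * D \<kappa>"
      by (subst \<kappa>(2)) (simp only: distrib_left m_sum add_0)
    then have "fps_nth (?m \<beta> * 1) 0 = fps_nth (?m \<beta> * D \<kappa>) 0"
      by simp
    then show ?thesis
      by (simp add: tw_diff_nth k_def)
  qed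
  \<comment> \<open>Exchange \<alpha> and \<beta> by \<open>hnabla_commute\<close>, then
    differentiate \<open>mV\<close> along \<alpha>. The result is symmetric in \<alpha> and
    \<gamma>, which is why \<open>D y\<close> vanishes.\<close>
  have m_nab: "?m \<gamma> * nab \<beta> (?V \<alpha>) = - (fps_X * (fps_const (mps_deriv \<alpha> (mps_deriv \<gamma> \<mu>)) * ?V \<beta>))"
    for \<alpha> \<beta> \<gamma>
  proof -
    have "fps_map (mps_deriv \<alpha>) (?m \<gamma> * ?V \<beta>) = 0"
      unfolding mV by (rule fps_ext) simp
    then have *: "?m \<gamma> * fps_map (mps_deriv \<alpha>) (?V \<beta>) =
        - (fps_const (mps_deriv \<alpha> (mps_deriv \<gamma> \<mu>)) * ?V \<beta>)"
      by (simp add: fps_map_deriv_mult fps_map_deriv_const eq_neg_iff_add_eq_0 add.commute)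
    have "?m \<gamma> * (fps_const (mps_deriv \<alpha> \<Gamma>) * ?V \<beta>) = fps_const (mps_deriv \<alpha> \<Gamma>) * (?m \<gamma> * ?V \<beta>)"
      using hser_commute[OF hser_const[OF mser_deriv[OF \<Gamma>_in]] m_in, of \<alpha> \<gamma>]
      by (simp add: mult.assoc[symmetric])
    then show ?thesis
      using hnabla_commute[OF \<Gamma>_in, of \<beta> \<alpha> \<zeta>]
      by (simp add: hnabla_def[of \<Gamma> \<alpha> "?V \<beta>"] distrib_left X_left_commute[of "fps_const _"] * mV)
  qed
  define y where "y = ?m \<gamma> * \<Lambda> \<alpha> \<beta> - ?m \<alpha> * \<Lambda> \<gamma> \<beta>"
  have m_D\<Lambda>: "?m \<gamma> * D (\<Lambda> \<alpha> \<beta>) = ?m \<gamma> * nab \<beta> (?V \<alpha>)" for \<alpha> \<gamma>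
    by (simp add: structure_eq distrib_left m_sum)
  have m\<Lambda>_in: "?m \<gamma> * \<Lambda> \<alpha> \<beta> \<in> hser G 0" for \<alpha> \<gamma>
    using hser_mult[OF m_in \<Lambda>_in] by simp
  have "D y = ?m \<alpha> * D (\<Lambda> \<gamma> \<beta>) - ?m \<gamma> * D (\<Lambda> \<alpha> \<beta>)"
    by (simp add: y_def D_diff[OF m\<Lambda>_in m\<Lambda>_in] D_d\<mu>_mult[OF \<Lambda>_in])
  also have "\<dots> = 0"
    by (simp add: m_D\<Lambda> m_nab mps_deriv_commute[of \<alpha> \<gamma>])
  finally have "D y = 0" .
  moreover have "fps_nth y n \<in> \<mu>_ideal \<gamma> \<alpha> 0" for n
  proof -
    have "fps_nth y n = mps_deriv \<gamma> \<mu> * fps_nth (\<Lambda> \<alpha> \<beta>) n + mps_deriv \<alpha> \<mu> * (- fps_nth (\<Lambda> \<gamma> \<beta>) n)"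
      by (simp add: y_def)
    moreover have "fps_nth (\<Lambda> \<alpha> \<beta>) n \<in> mser G (0 - 1)" "- fps_nth (\<Lambda> \<gamma> \<beta>) n \<in> mser G (0 - 1)"
      using \<Lambda>_in by (simp_all add: hser_def mser_uminus)
    ultimately show ?thesis
      unfolding \<mu>_ideal_def by blast
  qed
  ultimately have "y \<in> N"
    using \<mu>_ideal_cocycle_exact[OF k_in unit] by blast
  then have "(fps_X - 1) * y \<in> N"
    using N_hact[of y "fps_X - 1"] by (simp add: hact_def hext_cst)
  moreover have "nab \<gamma> (D (\<Lambda> \<alpha> \<beta>)) - nab \<alpha> (D (\<Lambda> \<gamma> \<beta>)) =
      D (nab \<gamma> (\<Lambda> \<alpha> \<beta>)) - D (nab \<alpha> (\<Lambda> \<gamma> \<beta>)) - (fps_X - 1) * y"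
    by (simp add: D_nab[OF \<Lambda>_in] y_def right_diff_distrib)
  moreover have "D (nab \<gamma> (\<Lambda> \<alpha> \<beta>)) \<in> N" "D (nab \<alpha> (\<Lambda> \<gamma> \<beta>)) \<in> N"
    by (intro D_in_N hser_hnabla \<Gamma>_in \<Lambda>_in)+
  ultimately show ?thesis
    by (simp add: N_diff)
qed

end

section \<open>Application to dGBV algebras\<close>

lemma even_central_graded_superalgebra: "graded_superalgebra cst G \<Longrightarrow> even_central cst G"
proof -
  assume "graded_superalgebra cst G"
  then interpret graded_superalgebra cst G .
  show ?thesis
  proof
    show "a * b = b * a" if "a \<in> G 0" "b \<in> G j" for a b j
      using supercomm[OF that] by simp
  qed (fact cst_one cst_add cst_mult zero_in add_in scale_in one_in mult_in)+
qed

lemma mc_setting_dgbv: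
  fixes \<Gamma> :: "('i, 'b :: ring_1) mps"
  assumes dgbv: "dgbv_algebra cst G \<Delta> Q"
    and dgla: "shifted_dgla cst G (\<lambda>b. \<Delta> b + Q b) (ell2 (\<lambda>b. \<Delta> b + Q b))"
    and mc: "maurer_cartan cst G (\<lambda>b. \<Delta> b + Q b) \<Gamma>"
    and square: "\<forall>j. \<forall>w\<in>hser G j. tw_diff \<Delta> Q \<Gamma> (tw_diff \<Delta> Q \<Gamma> w) = 0"
  shows "mc_setting cst G \<Delta> Q \<Gamma>"
proof -
  interpret B: dgbv_algebra cst G \<Delta> Q
    by (rule dgbv)
  interpret even_central cst G
    by (rule even_central_graded_superalgebra) unfold_locales
  have \<Delta>: "degree_one_map cst G \<Delta>" and \<Delta>_square: "\<And>a j. a \<in> G j \<Longrightarrow> \<Delta> (\<Delta> a) = 0"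
    using B.dgla by (auto simp: shifted_dgla_def)
  have in1: "\<Delta> a \<in> G (j + 1)" "Q a \<in> G (j + 1)" if "a \<in> G j" for a j
    using that \<Delta> B.Q_map by (simp_all add: degree_one_map_def)
  have add: "\<Delta> (a + b) = \<Delta> a + \<Delta> b" "Q (a + b) = Q a + Q b" if "a \<in> G j" "b \<in> G j" for a b j
    using that \<Delta> B.Q_map unfolding degree_one_map_def by blast+
  have poisson: "ell2 \<Delta> 0 a (b * c) = ell2 \<Delta> 0 a b * c + sg j * (b * ell2 \<Delta> 0 a c)"
    if "a \<in> G 0" "b \<in> G j" "c \<in> G l" for a b c j l
  proof -
    have "bracket_poisson G (ell2 \<Delta>)"
      using B.gerstenhaber by (simp add: gerstenhaber_bracket_def)
    then have "ell2 \<Delta> 0 a (b * c) = ell2 \<Delta> 0 a b * c + sg ((0 + 1) * j) * (b * ell2 \<Delta> 0 a c)"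
      using that unfolding bracket_poisson_def by blast
    then show ?thesis
      by simp
  qed
  show ?thesis
  proof
    show "graded_linear cst G \<Delta>" "graded_linear cst G Q"
      by (rule degree_one_map_graded_linear, rule \<Delta> B.Q_map)+
    show "\<Gamma> \<in> mser G 0"
      using mc by (simp add: maurer_cartan_def)
    show "Q (\<Delta> a) = - \<Delta> (Q a)" if a: "a \<in> G j" for a j
    proof -
      \<comment> \<open>Only the cross terms of the square of \<Delta> + Q survive.\<close>
      have "\<Delta> (\<Delta> a + Q a) + Q (\<Delta> a + Q a) = 0"
        using dgla a by (simp add: shifted_dgla_def)
      then have "\<Delta> (Q a) + Q (\<Delta> a) = 0"
        unfolding add[OF in1(1)[OF a] in1(2)[OF a]] by (simp add: \<Delta>_square[OF a] B.Q_square[OF a])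
      then show ?thesis
        by (simp add: eq_neg_iff_add_eq_0 add.commute)
    qed
    show "\<Delta> a \<in> G 1" if "a \<in> G 0" for a
      using in1(1)[OF that] by simp
    show "ell2 \<Delta> 0 a (b * c) = ell2 \<Delta> 0 a b * c + b * ell2 \<Delta> 0 a c"
      if "a \<in> G 0" "b \<in> G 0" "c \<in> G j" for a b c j
      using poisson[OF that] by simp
    show "Q (b * c) = Q b * c + b * Q c" if "b \<in> G 0" "c \<in> G j" for b c j
      using B.Q_leibniz[OF that] by simp
    show "tw_diff \<Delta> Q \<Gamma> (tw_diff \<Delta> Q \<Gamma> w) = 0" if "w \<in> hser G j" for w j
      using square that by blast
  qed (fact in1 \<Delta>_square poisson B.Q_leibniz B.supercomm mc)+
qed

lemma connection_coeffs_primitive: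
  assumes "connection_coeffs cst G \<Delta> Q \<Gamma> \<zeta> A"
  shows "\<exists>\<Lambda>. (\<forall>\<alpha> \<beta>. \<Lambda> \<alpha> \<beta> \<in> hser G (- 1)) \<and>
    (\<forall>\<alpha> \<beta>. hnabla \<Gamma> \<beta> (hnabla \<Gamma> \<alpha> \<zeta>) =
      (\<Sum>\<rho> | A \<alpha> \<beta> \<rho> \<noteq> 0. hact cst (A \<alpha> \<beta> \<rho>) (hnabla \<Gamma> \<rho> \<zeta>)) + tw_diff \<Delta> Q \<Gamma> (\<Lambda> \<alpha> \<beta>))"
proof -
  have "\<forall>\<alpha> \<beta>. \<exists>\<Lambda>. \<Lambda> \<in> hser G (- 1) \<and> hnabla \<Gamma> \<beta> (hnabla \<Gamma> \<alpha> \<zeta>) =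
      (\<Sum>\<rho> | A \<alpha> \<beta> \<rho> \<noteq> 0. hact cst (A \<alpha> \<beta> \<rho>) (hnabla \<Gamma> \<rho> \<zeta>)) + tw_diff \<Delta> Q \<Gamma> \<Lambda>"
    using assms unfolding connection_coeffs_def by blast
  then show ?thesis
    unfolding choice_iff by blast
qed

lemma connection_coeffs_symmetric:
  fixes \<Gamma> :: "('i, 'b :: ring_1) mps"
  assumes "bv_setting cst G \<Delta> Q \<Gamma>"
    and primitive: "weak_primitive_form cst G \<Delta> Q \<Gamma> \<zeta>"
    and coeffs: "connection_coeffs cst G \<Delta> Q \<Gamma> \<zeta> A"
  shows "A \<alpha> \<beta> \<rho> = A \<beta> \<alpha> \<rho>"
proof -
  interpret bv_setting cst G \<Delta> Q \<Gamma>
    by fact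
  obtain \<Lambda> where "\<And>\<alpha> \<beta>. \<Lambda> \<alpha> \<beta> \<in> hser G (- 1)"
    "\<And>\<alpha> \<beta>. nab \<beta> (nab \<alpha> \<zeta>) = (\<Sum>\<rho> | A \<alpha> \<beta> \<rho> \<noteq> 0. hact cst (A \<alpha> \<beta> \<rho>) (nab \<rho> \<zeta>)) + D (\<Lambda> \<alpha> \<beta>)"
    using connection_coeffs_primitive[OF coeffs] by blast
  moreover have "finite {\<rho>. A \<alpha> \<beta> \<rho> \<noteq> 0}" for \<alpha> \<beta>
    using coeffs by (simp add: connection_coeffs_def)
  ultimately show ?thesis
    using primitive coeffs_symmetric[of \<zeta> A \<Lambda>] by (simp add: weak_primitive_form_def)
qed

lemma hbar_lin_0: "hbar_lin a 0 = fps_const a"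
  by (simp add: hbar_lin_def)

lemma dgbv_associativity_potential:
  fixes \<Gamma> :: "('i, 'b :: ring_1) mps"
  assumes "mc_setting cst G \<Delta> Q \<Gamma>"
    and primitive: "weak_primitive_form cst G \<Delta> Q \<Gamma> \<zeta>"
    and coeffs: "connection_coeffs cst G \<Delta> Q \<Gamma> \<zeta> (\<lambda>\<alpha> \<beta> \<rho>. fps_const (A0 \<alpha> \<beta> \<rho>))"
  shows "(\<Sum>\<rho> | A0 \<alpha> \<beta> \<rho> \<noteq> 0. A0 \<alpha> \<beta> \<rho> * A0 \<rho> \<gamma> \<delta>) =
         (\<Sum>\<rho> | A0 \<beta> \<gamma> \<rho> \<noteq> 0. A0 \<beta> \<gamma> \<rho> * A0 \<rho> \<alpha> \<delta>)"
    and "mps_deriv \<alpha> (A0 \<gamma> \<beta> \<rho>) = mps_deriv \<gamma> (A0 \<alpha> \<beta> \<rho>)"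
proof -
  interpret mc_setting cst G \<Delta> Q \<Gamma>
    by fact
  let ?A = "\<lambda>\<alpha> \<beta> \<rho>. fps_const (A0 \<alpha> \<beta> \<rho>)"
  obtain \<Lambda> where \<Lambda>: "\<And>\<alpha> \<beta>. \<Lambda> \<alpha> \<beta> \<in> hser G (- 1)"
    "\<And>\<alpha> \<beta>. nab \<beta> (nab \<alpha> \<zeta>) = (\<Sum>\<rho> | ?A \<alpha> \<beta> \<rho> \<noteq> 0. hact cst (?A \<alpha> \<beta> \<rho>) (nab \<rho> \<zeta>)) + D (\<Lambda> \<alpha> \<beta>)"
    using connection_coeffs_primitive[OF coeffs] by blast
  have fin: "finite {\<rho>. A0 \<alpha> \<beta> \<rho> \<noteq> 0}" for \<alpha> \<beta>
    using coeffs by (simp add: connection_coeffs_def)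
  have basis: "\<zeta> \<in> hser G 0" "basis_mod (hact cst) Z N (\<lambda>\<alpha>. nab \<alpha> \<zeta>)"
    using primitive by (simp_all add: weak_primitive_form_def)
  note hyps = basis fin \<Lambda>(1) \<Lambda>(2)[unfolded fps_const_eq_0_iff] obstruction_exact[OF basis \<Lambda>]
  show "(\<Sum>\<rho> | A0 \<alpha> \<beta> \<rho> \<noteq> 0. A0 \<alpha> \<beta> \<rho> * A0 \<rho> \<gamma> \<delta>) =
         (\<Sum>\<rho> | A0 \<beta> \<gamma> \<rho> \<noteq> 0. A0 \<beta> \<gamma> \<rho> * A0 \<rho> \<alpha> \<delta>)"
    by (rule associativity_potential(2)[OF hyps])
  show "mps_deriv \<alpha> (A0 \<gamma> \<beta> \<rho>) = mps_deriv \<gamma> (A0 \<alpha> \<beta> \<rho>)"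
    by (rule associativity_potential(3)[OF hyps])
qed

section \<open>Calabi-Yau complete intersections\<close>

lemma gcoeff_gconst_mult: "gcoeff (gconst p * a) K = p * gcoeff a K"
  for a :: "('v :: linorder, 'c :: comm_ring_1) grassmann"
proof (cases "finite K")
  case True
  have "gcoeff (gconst p * a) K = (\<Sum>I\<in>Pow K. if I = {} then p * gcoeff a K else 0)"
    unfolding gcoeff_mult by (rule sum.cong) (auto simp: gconst.rep_eq)
  then show ?thesis
    using True by simp
qed (simp add: gcoeff_infinite)

lemma gcoeff_mult_gconst: "gcoeff (a * gconst p) K = p * gcoeff a K"
  for a :: "('v :: linorder, 'c :: comm_ring_1) grassmann"
proof (cases "finite K")
  case True
  have "gcoeff (a * gconst p) K = (\<Sum>I\<in>Pow K. if I = K then p * gcoeff a K else 0)"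
    unfolding gcoeff_mult by (rule sum.cong) (auto simp: gconst.rep_eq mult.commute)
  then show ?thesis
    using True by simp
qed (simp add: gcoeff_infinite)

lemma gconst_mult: "gconst (p * r) = gconst p * gconst (r :: 'c :: comm_ring_1)"
  by (rule grassmann_eqI) (auto simp: gcoeff_gconst_mult gconst.rep_eq)

lemma gconst_add: "gconst (p + r) = gconst p + gconst (r :: 'c :: comm_ring_1)"
  by (rule grassmann_eqI) (auto simp: gconst.rep_eq)

lemma gconst_zero: "gconst 0 = 0"
  by (rule grassmann_eqI) (simp add: gconst.rep_eq)

lemma gconst_one: "gconst 1 = (1 :: ('v :: linorder, 'c :: comm_ring_1) grassmann)"
  by (rule grassmann_eqI) (auto simp: gconst.rep_eq gcoeff_one)

lemma eta_deriv_gconst: "eta_deriv v (gconst p) = 0"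
  by (rule grassmann_eqI) (simp add: eta_deriv.rep_eq gconst.rep_eq)

lemma eta_deriv_gconst_mult: "eta_deriv v (gconst p * a) = gconst p * eta_deriv v a"
  by (rule grassmann_eqI) (simp add: eta_deriv.rep_eq gcoeff_gconst_mult ac_simps)

lemma eta_deriv_add: "eta_deriv v (a + b) = eta_deriv v a + eta_deriv v b"
  by (rule grassmann_eqI) (simp add: eta_deriv.rep_eq distrib_left)

lemma pdiff_superset:
  assumes "finite M" "Poly_Mapping.keys f \<subseteq> M"
  shows "pdiff v f = (\<Sum>m\<in>M. Poly_Mapping.single (m - Poly_Mapping.single v 1)
    (of_nat (Poly_Mapping.lookup m v) * Poly_Mapping.lookup f m))"
  unfolding pdiff_def using assms
  by (intro sum.mono_neutral_left) (auto simp: in_keys_iff)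

lemma pdiff_add: "pdiff v (f + g) = pdiff v f + pdiff v g"
proof -
  let ?M = "Poly_Mapping.keys f \<union> Poly_Mapping.keys g"
  have "Poly_Mapping.keys (f + g) \<subseteq> ?M"
    by (rule Poly_Mapping.keys_add)
  then show ?thesis
    by (subst (1 2 3) pdiff_superset[of ?M])
      (auto simp: lookup_add distrib_left single_add sum.distrib)
qed

lemma pdiff_zero: "pdiff v 0 = 0"
  by (simp add: pdiff_def)

lemma pdiff_sum: "pdiff v (sum f S) = (\<Sum>x\<in>S. pdiff v (f x))"
  by (induction S rule: infinite_finite_induct) (simp_all add: pdiff_zero pdiff_add)

lemma pdiff_single:
  "pdiff v (Poly_Mapping.single m c) =
     Poly_Mapping.single (m - Poly_Mapping.single v 1) (of_nat (Poly_Mapping.lookup m v) * c)"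
  by (simp add: pdiff_def)

lemma poly_eq_sum_single: "(f :: cpoly) = (\<Sum>m\<in>Poly_Mapping.keys f. Poly_Mapping.single m (Poly_Mapping.lookup f m))"
proof (rule poly_mapping_eqI)
  fix k
  have "Poly_Mapping.lookup (\<Sum>m\<in>Poly_Mapping.keys f. Poly_Mapping.single m (Poly_Mapping.lookup f m)) k =
      (\<Sum>m\<in>Poly_Mapping.keys f. if m = k then Poly_Mapping.lookup f m else 0)"
    by (simp add: lookup_sum lookup_single when_def)
  then show "Poly_Mapping.lookup f k = Poly_Mapping.lookup (\<Sum>m\<in>Poly_Mapping.keys f. Poly_Mapping.single m (Poly_Mapping.lookup f m)) k"
    by (simp add: in_keys_iff)
qed

lemma pdiff_mult: "pdiff v (f * g) = pdiff v f * g + f * pdiff v g"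
proof -
  let ?s = "Poly_Mapping.single"
  let ?l = "Poly_Mapping.lookup"
  let ?e = "?s v (1 :: nat)"
  \<comment> \<open>Subtraction truncates, so the shift requires \<open>v\<close> to occur in
    \<open>m\<close>; otherwise the coefficient of the derivative is 0 and its exponent is
    irrelevant.\<close>
  have shift: "m + m' - ?e = (m - ?e) + m'" if "?l m v \<noteq> 0" for m m' :: "var \<Rightarrow>\<^sub>0 nat"
    using that by (intro poly_mapping_eqI) (auto simp: lookup_add lookup_minus lookup_single when_def)
  have single: "pdiff v (?s m c * ?s m' c') =
      pdiff v (?s m c) * ?s m' c' + ?s m c * pdiff v (?s m' c')"
    for m m' and c c' :: complex
  proof -
    have 1: "?s (m + m' - ?e) (of_nat (?l m v) * (c * c')) =
        ?s (m - ?e) (of_nat (?l m v) * c) * ?s m' c'"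
      by (cases "?l m v = 0") (simp_all add: shift[unfolded One_nat_def] mult_single mult.assoc)
    have "?s (m' + m - ?e) (of_nat (?l m' v) * (c * c')) =
        ?s m c * ?s (m' - ?e) (of_nat (?l m' v) * c')"
      by (cases "?l m' v = 0") (simp_all add: shift[unfolded One_nat_def] mult_single ac_simps)
    then show ?thesis
      using 1 by (simp add: mult_single pdiff_single lookup_add distrib_right single_add add.commute)
  qed
  let ?F = "\<lambda>f. \<Sum>m\<in>Poly_Mapping.keys f. ?s m (?l f m)"
  have "pdiff v (?F f * ?F g) = pdiff v (?F f) * ?F g + ?F f * pdiff v (?F g)"
    by (simp add: sum_product pdiff_sum single sum.distrib)
  then show ?thesis
    by (simp only: poly_eq_sum_single[symmetric])
qed

lemma q_deriv_gconst_mult: "q_deriv v (gconst p * a) =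
    gconst (pdiff v p) * a + gconst p * q_deriv v a"
  by (rule grassmann_eqI) (simp add: q_deriv.rep_eq gcoeff_gconst_mult pdiff_mult)

lemma q_deriv_add: "q_deriv v (a + b) = q_deriv v a + q_deriv v b"
  by (rule grassmann_eqI) (simp add: q_deriv.rep_eq pdiff_add)

lemma q_deriv_zero: "q_deriv v 0 = 0"
  by (rule grassmann_eqI) (simp add: q_deriv.rep_eq pdiff_zero)

lemma BV_Delta_gconst: "BV_Delta n k (gconst p) = 0"
  by (simp add: BV_Delta_def eta_deriv_gconst q_deriv_zero)

lemma BV_Delta_add: "BV_Delta n k (a + b) = BV_Delta n k a + BV_Delta n k b"
  by (simp add: BV_Delta_def eta_deriv_add q_deriv_add sum.distrib)

text \<open>\<open>eta_deriv\<close> passes a polynomial in the even variables, so the product rule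
  acts only in \<open>q_deriv\<close>. Hence the bracket with a polynomial \<open>p\<close> is the
  operator \<open>Q_of n k p\<close>.\<close>

lemma BV_Delta_gconst_mult: "BV_Delta n k (gconst p * a) = Q_of n k p a + gconst p * BV_Delta n k a"
  by (simp add: BV_Delta_def Q_of_def eta_deriv_gconst_mult q_deriv_gconst_mult sum.distrib sum_distrib_left)

lemma Q_of_gconst: "Q_of n k f (gconst p) = 0"
  by (simp add: Q_of_def eta_deriv_gconst)

lemma Q_of_add: "Q_of n k f (a + b) = Q_of n k f a + Q_of n k f b"
  by (simp add: Q_of_def eta_deriv_add distrib_left sum.distrib)

lemma Q_of_gconst_mult: "Q_of n k f (gconst p * a) = gconst p * Q_of n k f a"
proof -
  have "gconst g * (gconst p * b) = gconst p * (gconst g * b)" for g and b :: superpoly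
    by (simp only: mult.assoc[symmetric] gconst_mult[symmetric] mult.commute[of g])
  then show ?thesis
    by (simp add: Q_of_def eta_deriv_gconst_mult sum_distrib_left)
qed

section \<open>Gradings and the charge 0 subalgebra\<close>

lemma mono_deg_add:
  assumes "I \<inter> J = {}" "finite I" "finite J"
  shows "mono_deg g h (m + m') (I \<union> J) = mono_deg g h m I + mono_deg g h m' J"
proof -
  let ?K = "Poly_Mapping.keys m \<union> Poly_Mapping.keys m'"
  have sup: "(\<Sum>v\<in>Poly_Mapping.keys m. int (Poly_Mapping.lookup m v) * g v) =
      (\<Sum>v\<in>?K. int (Poly_Mapping.lookup m v) * g v)"
    if "Poly_Mapping.keys m \<subseteq> ?K" for m
    using that by (intro sum.mono_neutral_left) (auto simp: in_keys_iff)
  show ?thesis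
    using assms sup[of m] sup[of m'] sup[of "m + m'"] Poly_Mapping.keys_add[of m m']
    by (simp add: mono_deg_def sum.union_disjoint lookup_add distrib_right sum.distrib)
qed

lemma CY_algD:
  assumes "a \<in> CY_alg n k d j" "m \<in> Poly_Mapping.keys (gcoeff a I)"
  shows "I \<subseteq> qvars n k \<and> Poly_Mapping.keys m \<subseteq> qvars n k \<and>
    mono_deg (\<lambda>v. 0) (\<lambda>v. - 1) m I = j \<and> mono_deg (charge d) (\<lambda>v. - charge d v) m I = 0"
  using assms unfolding CY_alg_def by blast

text \<open>Each \<eta> has degree -1 and the even variables have degree 0, so no \<eta> can
  occur.\<close>

lemma CY_alg_even:
  assumes "a \<in> CY_alg n k d 0"
  shows "a = gconst (gcoeff a {})"
proof (rule grassmann_eqI)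
  fix I
  show "gcoeff a I = gcoeff (gconst (gcoeff a {})) I"
  \<comment> \<open>The degree sum over an infinite \<open>I\<close> would be 0 by convention; there
    the coefficients vanish by \<open>gcoeff_infinite\<close>.\<close>
  proof (cases "I = {} \<or> infinite I")
    case False
    have "Poly_Mapping.keys (gcoeff a I) = {}"
    proof (rule equals0I)
      fix m assume "m \<in> Poly_Mapping.keys (gcoeff a I)"
      then have "mono_deg (\<lambda>v. 0) (\<lambda>v. - 1) m I = 0"
        using CY_algD[OF assms] by blast
      then show False
        using False by (simp add: mono_deg_def)
    qed
    then show ?thesis
      using False by (simp add: gconst.rep_eq)
  qed (auto simp: gconst.rep_eq gcoeff_infinite)
qed

lemma finite_qvars: "finite (qvars n k)"
  by (simp add: qvars_def)

lemma CY_alg_mult: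
  assumes a: "a \<in> CY_alg n k d i" and b: "b \<in> CY_alg n k d j"
  shows "a * b \<in> CY_alg n k d (i + j)"
  unfolding CY_alg_def
proof (intro CollectI allI ballI)
  fix K m
  assume m: "m \<in> Poly_Mapping.keys (gcoeff (a * b) K)"
  have "Poly_Mapping.keys (\<Sum>I\<in>Pow K. shuffle_sign I (K - I) * (gcoeff a I * gcoeff b (K - I))) \<subseteq>
      (\<Union>I\<in>Pow K. Poly_Mapping.keys (shuffle_sign I (K - I) * (gcoeff a I * gcoeff b (K - I))))"
    by (rule keys_sum)
  then obtain I where I: "I \<subseteq> K" "m \<in> Poly_Mapping.keys (shuffle_sign I (K - I) * (gcoeff a I * gcoeff b (K - I)))"
    using m by (auto simp: gcoeff_mult)
  \<comment> \<open>A shuffle sign is 1 or -1 and leaves the set of monomials unchanged.\<close>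
  have "Poly_Mapping.keys (shuffle_sign I (K - I) * f) = Poly_Mapping.keys f" for f :: cpoly
    by (cases "even (inversions I (K - I))") (simp_all add: shuffle_sign_def)
  then obtain p r where pr: "m = p + r" "p \<in> Poly_Mapping.keys (gcoeff a I)"
      "r \<in> Poly_Mapping.keys (gcoeff b (K - I))"
    using I(2) Poly_Mapping.keys_mult[of "gcoeff a I" "gcoeff b (K - I)"] by auto
  have K: "K = I \<union> (K - I)"
    using I by blast
  have sub: "I \<subseteq> qvars n k" "K - I \<subseteq> qvars n k" "Poly_Mapping.keys p \<subseteq> qvars n k"
      "Poly_Mapping.keys r \<subseteq> qvars n k"
    using CY_algD[OF a pr(2)] CY_algD[OF b pr(3)] by blast+
  then have deg: "mono_deg g h m K = mono_deg g h p I + mono_deg g h r (K - I)" for g h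
    unfolding pr(1) using finite_subset[OF _ finite_qvars] by (subst K, subst mono_deg_add) auto
  have "K \<subseteq> qvars n k" "Poly_Mapping.keys m \<subseteq> qvars n k"
    using sub K Poly_Mapping.keys_add[of p r] unfolding pr(1) by blast+
  moreover have "mono_deg (\<lambda>v. 0) (\<lambda>v. - 1) p I = i" "mono_deg (charge d) (\<lambda>v. - charge d v) p I =
      0"
    "mono_deg (\<lambda>v. 0) (\<lambda>v. - 1) r (K - I) = j" "mono_deg (charge d) (\<lambda>v. - charge d v) r (K - I) =
        0"
    using CY_algD[OF a pr(2)] CY_algD[OF b pr(3)] by blast+
  ultimately show "K \<subseteq> qvars n k \<and> Poly_Mapping.keys m \<subseteq> qvars n k \<and>
      mono_deg (\<lambda>v. 0) (\<lambda>v. - 1) m K = i + j \<and> mono_deg (charge d) (\<lambda>v. - charge d v) m K = 0"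
    by (simp add: deg)
qed

lemma even_central_CY: "even_central sp_const (CY_alg n k d)"
proof
  show "sp_const 1 = 1"
    by (simp add: sp_const_def gconst_one)
  show "sp_const (c + c') = sp_const c + sp_const c'" for c c'
    by (simp add: sp_const_def single_add gconst_add)
  show "sp_const (c * c') = sp_const c * sp_const c'" for c c'
    by (simp add: sp_const_def gconst_mult[symmetric] mult_single)
  show "0 \<in> CY_alg n k d j" for j
    by (simp add: CY_alg_def)
  show "a + b \<in> CY_alg n k d j" if "a \<in> CY_alg n k d j" "b \<in> CY_alg n k d j" for a b j
    unfolding CY_alg_def
  proof (intro CollectI allI ballI)
    fix I m
    assume "m \<in> Poly_Mapping.keys (gcoeff (a + b) I)"
    then have "m \<in> Poly_Mapping.keys (gcoeff a I) \<or> m \<in> Poly_Mapping.keys (gcoeff b I)"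
      using Poly_Mapping.keys_add[of "gcoeff a I" "gcoeff b I"] by auto
    then show "I \<subseteq> qvars n k \<and> Poly_Mapping.keys m \<subseteq> qvars n k \<and>
      mono_deg (\<lambda>v. 0) (\<lambda>v. - 1) m I = j \<and> mono_deg (charge d) (\<lambda>v. - charge d v) m I = 0"
      using CY_algD that by blast
  qed
  show "sp_const c * a \<in> CY_alg n k d j" if "a \<in> CY_alg n k d j" for c a j
    unfolding CY_alg_def
  proof (intro CollectI allI ballI)
    fix I m
    assume "m \<in> Poly_Mapping.keys (gcoeff (sp_const c * a) I)"
    then have "m \<in> Poly_Mapping.keys (gcoeff a I)"
      using Poly_Mapping.keys_mult[of "Poly_Mapping.single 0 c" "gcoeff a I"]
      by (auto simp: sp_const_def gcoeff_gconst_mult split: if_splits)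
    then show "I \<subseteq> qvars n k \<and> Poly_Mapping.keys m \<subseteq> qvars n k \<and>
      mono_deg (\<lambda>v. 0) (\<lambda>v. - 1) m I = j \<and> mono_deg (charge d) (\<lambda>v. - charge d v) m I = 0"
      using CY_algD that by blast
  qed
  show "1 \<in> CY_alg n k d 0"
    by (auto simp: CY_alg_def gcoeff_one mono_deg_def split: if_splits)
  show "a * b = b * a" if "a \<in> CY_alg n k d 0" for a b
    by (subst (1 2) CY_alg_even[OF that]) (rule grassmann_eqI, simp add: gcoeff_gconst_mult gcoeff_mult_gconst)
qed (rule CY_alg_mult)

text \<open>Degree 0 elements are polynomials in the even variables, their brackets are operators
  \<open>Q_of\<close>, and these are linear over such polynomials and annihilate them. The
  derivation rules with degree 0 factors follow without signs.\<close>

lemma bv_setting_CY: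
  assumes "\<Gamma> \<in> mser (CY_alg n k d) 0"
  shows "bv_setting sp_const (CY_alg n k d) (BV_Delta n k) (Q_of n k f) \<Gamma>"
proof -
  interpret even_central sp_const "CY_alg n k d"
    by (rule even_central_CY)
  have ell2: "ell2 (BV_Delta n k) 0 (gconst p) a = Q_of n k p a" for p a
    by (simp add: ell2_def sg_def BV_Delta_gconst_mult BV_Delta_gconst)
  have pure: "\<exists>p. a = gconst p" if "a \<in> CY_alg n k d 0" for a
    using CY_alg_even[OF that] by blast
  show ?thesis
  proof
    show "graded_linear sp_const (CY_alg n k d) (BV_Delta n k)"
      by (auto simp: graded_linear_def BV_Delta_add sp_const_def BV_Delta_gconst_mult Q_of_def pdiff_single
          gconst_zero)
    show "graded_linear sp_const (CY_alg n k d) (Q_of n k f)"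
      by (simp add: graded_linear_def Q_of_add sp_const_def Q_of_gconst_mult)
    show "BV_Delta n k a \<in> CY_alg n k d 1" if "a \<in> CY_alg n k d 0" for a
      using pure[OF that] by (auto simp: BV_Delta_gconst zero_in)
    show "ell2 (BV_Delta n k) 0 a (b * c) = ell2 (BV_Delta n k) 0 a b * c +
        b * ell2 (BV_Delta n k) 0 a c"
      if "a \<in> CY_alg n k d 0" "b \<in> CY_alg n k d 0" for a b c
      using pure[OF that(1)] pure[OF that(2)] by (auto simp: ell2 Q_of_gconst_mult Q_of_gconst)
    show "Q_of n k f (b * c) = Q_of n k f b * c + b * Q_of n k f c" if "b \<in> CY_alg n k d 0" for b c
      using pure[OF that] by (auto simp: Q_of_gconst_mult Q_of_gconst)
  qed (fact assms)
qed

section \<open>Structure constants and the F-manifold\<close>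

lemma (in even_central) linear_deformation_in:
  assumes "\<And>\<rho>. u \<rho> \<in> G 0"
  shows "linear_deformation u \<in> mser G 0"
proof -
  have "mps_const (u \<rho>) \<in> mser G 0" "mps_var \<rho> \<in> mser G 0" for \<rho>
    using assms by (simp_all add: mser_def mps_nth_const mps_var_def zero_in one_in)
  then show ?thesis
    unfolding linear_deformation_def by (intro mser_sum mser_mult0)
qed

text \<open>Degree 0 series are free of \<eta> and annihilated by \<open>BV_Delta n k\<close> and
  \<open>Q_of n k f\<close>. Thus \<open>D\<close> kills the derivatives of
  \<open>linear_deformation u\<close>, \<open>nab\<close> preserves coboundaries, and both
  obstruction terms are exact separately.\<close>

lemma CY_coeffs:
  fixes u :: "'j :: finite \<Rightarrow> superpoly" and a0 :: "'j \<Rightarrow> 'j \<Rightarrow> 'j \<Rightarrow> ('j, complex) mps"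
  assumes u: "\<And>\<rho>. u \<rho> \<in> CY_alg n k d 0"
    and primitive: "weak_primitive_form sp_const (CY_alg n k d) (BV_Delta n k) (Q_of n k f)
        (linear_deformation u) \<zeta>"
    and \<Lambda>_in: "\<And>\<alpha> \<beta>. \<Lambda> \<alpha> \<beta> \<in> hser (CY_alg n k d) (- 1)"
    and eq: "\<And>\<alpha> \<beta>. hnabla (linear_deformation u) \<beta> (hnabla (linear_deformation u) \<alpha> \<zeta>) =
      (\<Sum>\<rho>\<in>UNIV. hact sp_const (fps_const (a0 \<alpha> \<beta> \<rho>)) (hnabla (linear_deformation u) \<rho> \<zeta>)) +
      tw_diff (BV_Delta n k) (Q_of n k f) (linear_deformation u) (\<Lambda> \<alpha> \<beta>)"
  shows "potential_structure a0"
proof -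
  interpret bv_setting sp_const "CY_alg n k d" "BV_Delta n k" "Q_of n k f" "linear_deformation u"
    by (rule bv_setting_CY, rule even_central.linear_deformation_in[OF even_central_CY u])
  have kill: "mps_map (BV_Delta n k) h = 0" "mps_map (Q_of n k f) h =
      0" if "h \<in> mser (CY_alg n k d) 0" for h :: "('j, superpoly) mps"
  proof -
    have "\<exists>p. mps_nth h m = gconst p" for m
      using that CY_alg_even unfolding mser_def by blast
    then show "mps_map (BV_Delta n k) h = 0" "mps_map (Q_of n k f) h = 0"
      by (metis (no_types, lifting) mps_eqI mps_nth_map mps_nth_simps(1) BV_Delta_gconst Q_of_gconst)+
  qed
  note g_in = mser_deriv[OF \<Gamma>_in]
  have "d0 (mps_deriv \<gamma> (linear_deformation u)) = 0" "d0 0 = 0" for \<gamma>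
    by (simp_all add: d0_eq kill g_in \<Gamma>_in mser_mult0[OF \<Gamma>_in g_in] mser_zero)
  then have "D (fps_const (mps_deriv \<gamma> (linear_deformation u))) = 0" for \<gamma>
    by (intro fps_ext) (simp add: tw_diff_nth kill g_in mser_zero)
  then have "nab \<gamma> (D (\<Lambda> \<alpha> \<beta>)) \<in> N" for \<alpha> \<beta> \<gamma>
    using D_hnabla[OF \<Lambda>_in, of \<gamma> \<alpha> \<beta>] D_in_N[OF hser_hnabla[OF \<Gamma>_in \<Lambda>_in], of \<gamma> \<alpha> \<beta>] by simp
  then have obstruction: "nab \<gamma> (D (\<Lambda> \<alpha> \<beta>)) - nab \<alpha> (D (\<Lambda> \<gamma> \<beta>)) \<in> N" for \<alpha> \<beta> \<gamma>
    by (intro N_diff)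
  have eq': "nab \<beta> (nab \<alpha> \<zeta>) =
      (\<Sum>\<rho> | a0 \<alpha> \<beta> \<rho> \<noteq> 0. hact sp_const (fps_const (a0 \<alpha> \<beta> \<rho>)) (nab \<rho> \<zeta>)) + D (\<Lambda> \<alpha> \<beta>)" for \<alpha> \<beta>
    unfolding eq by (auto intro!: sum.mono_neutral_right simp: hact_simps)
  have basis: "\<zeta> \<in> hser (CY_alg n k d) 0" "basis_mod (hact sp_const) Z N (\<lambda>\<alpha>. nab \<alpha> \<zeta>)"
    using primitive by (simp_all add: weak_primitive_form_def)
  note hyps = basis finite \<Lambda>_in eq' obstruction
  have UNIV: "(\<Sum>\<rho>\<in>UNIV. a0 \<alpha> \<beta> \<rho> * a0 \<rho> \<gamma> \<delta>) = (\<Sum>\<rho> | a0 \<alpha> \<beta> \<rho> \<noteq> 0. a0 \<alpha> \<beta> \<rho> * a0 \<rho> \<gamma> \<delta>)" for \<alpha> \<beta> \<gamma> \<delta>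
    by (rule sum.mono_neutral_right) auto
  show ?thesis
  proof
    show "a0 \<alpha> \<beta> \<rho> = a0 \<beta> \<alpha> \<rho>" for \<alpha> \<beta> \<rho>
      by (rule associativity_potential(1)[OF hyps])
    show "(\<Sum>\<rho>\<in>UNIV. a0 \<alpha> \<beta> \<rho> * a0 \<rho> \<gamma> \<delta>) = (\<Sum>\<rho>\<in>UNIV. a0 \<beta> \<gamma> \<rho> * a0 \<rho> \<alpha> \<delta>)" for \<alpha> \<beta> \<gamma> \<delta>
      unfolding UNIV by (rule associativity_potential(2)[OF hyps])
    show "mps_deriv \<alpha> (a0 \<gamma> \<beta> \<rho>) = mps_deriv \<gamma> (a0 \<alpha> \<beta> \<rho>)" for \<alpha> \<beta> \<gamma> \<rho>
      by (rule associativity_potential(3)[OF hyps])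
  qed
qed

text \<open>A transposition and a 3-cycle generate all permutations of three letters.\<close>

lemma symmetric3I:
  assumes "\<And>\<alpha> \<beta> \<gamma>. T \<alpha> \<beta> \<gamma> = T \<beta> \<alpha> \<gamma>" "\<And>\<alpha> \<beta> \<gamma>. T \<alpha> \<beta> \<gamma> = T \<beta> \<gamma> \<alpha>"
  shows "symmetric3 T"
  unfolding symmetric3_def using assms by metis

lemma potential_structure_F_manifold:
  assumes "potential_structure a"
  shows "symmetric3 (\<lambda>\<alpha> \<beta> \<gamma>. \<Sum>\<rho>\<in>UNIV. a \<alpha> \<beta> \<rho> * a \<gamma> \<rho> \<delta>)"
    and "symmetric3 (\<lambda>\<alpha> \<beta> \<gamma>. mps_deriv \<gamma> (a \<alpha> \<beta> \<delta>))"
    and "\<exists>!p. formal_F_manifold p \<and> (\<forall>\<alpha> \<beta>. p (vf_coord \<alpha>) (vf_coord \<beta>) = (\<lambda>\<rho>. a \<alpha> \<beta> \<rho>))"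
proof -
  interpret potential_structure a
    by fact
  show "symmetric3 (\<lambda>\<alpha> \<beta> \<gamma>. \<Sum>\<rho>\<in>UNIV. a \<alpha> \<beta> \<rho> * a \<gamma> \<rho> \<delta>)"
    using assoc by (intro symmetric3I) (simp_all add: sym)
  show "symmetric3 (\<lambda>\<alpha> \<beta> \<gamma>. mps_deriv \<gamma> (a \<alpha> \<beta> \<delta>))"
    by (intro symmetric3I) (metis sym, metis sym potential)
  show "\<exists>!p. formal_F_manifold p \<and> (\<forall>\<alpha> \<beta>. p (vf_coord \<alpha>) (vf_coord \<beta>) = (\<lambda>\<rho>. a \<alpha> \<beta> \<rho>))"
    using formal_F_manifold_vf_product p_coord formal_F_manifold_unique by blast
qed

theorem mainTheorem5:
  fixes cst :: "complex \<Rightarrow> 'b :: ring_1" and B :: "int \<Rightarrow> 'b set" and \<Delta> Q :: "'b \<Rightarrow> 'b"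
    and e :: "'i \<Rightarrow> 'b" and \<Gamma> :: "('i, 'b) mps" and \<xi> :: "('i, 'b) mps fps"
    and A0 A1 :: "'i \<Rightarrow> 'i \<Rightarrow> 'i \<Rightarrow> ('i, complex) mps"
    and n k :: nat and d :: "nat \<Rightarrow> nat" and F :: "nat \<Rightarrow> cpoly"
    and u :: "'j :: finite \<Rightarrow> superpoly" and wu :: "'j \<Rightarrow> int"
    and \<zeta>0 \<zeta>1 :: "('j, superpoly) mps"
    and a0 a1 :: "'j \<Rightarrow> 'j \<Rightarrow> 'j \<Rightarrow> ('j, complex) mps"
    and \<Lambda>0 \<Lambda>1 :: "'j \<Rightarrow> 'j \<Rightarrow> ('j, superpoly) mps"
  defines "A \<equiv> \<lambda>\<alpha> \<beta> \<rho>. hbar_lin (A0 \<alpha> \<beta> \<rho>) (A1 \<alpha> \<beta> \<rho>)"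
    and "G \<equiv> CY_alg n k d"
    and "D \<equiv> BV_Delta n k"
    and "QS \<equiv> Q_of n k (dwork_potential k F)"
    and "L \<equiv> linear_deformation u"
    and "\<zeta> \<equiv> hbar_lin \<zeta>0 \<zeta>1"
  shows
    "(dgbv_algebra cst B \<Delta> Q \<and>
      shifted_dgla cst B (\<lambda>b. \<Delta> b + Q b) (ell2 (\<lambda>b. \<Delta> b + Q b)) \<and>
      tangent_basis cst B (\<lambda>b. \<Delta> b + Q b) e \<and>
      maurer_cartan cst B (\<lambda>b. \<Delta> b + Q b) \<Gamma> \<and>
      weak_primitive_form cst B \<Delta> Q \<Gamma> \<xi> \<and>
      connection_coeffs cst B \<Delta> Q \<Gamma> \<xi> A
      \<longrightarrow>
      (\<forall>\<alpha> \<beta> \<rho>. A \<alpha> \<beta> \<rho> = A \<beta> \<alpha> \<rho>) \<and>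
      ((\<forall>\<alpha> \<beta> \<rho>. A1 \<alpha> \<beta> \<rho> = 0) \<longrightarrow>
        (\<forall>\<alpha> \<beta> \<gamma> \<delta>. (\<Sum>\<rho> | A0 \<alpha> \<beta> \<rho> \<noteq> 0. A0 \<alpha> \<beta> \<rho> * A0 \<rho> \<gamma> \<delta>) =
                     (\<Sum>\<rho> | A0 \<beta> \<gamma> \<rho> \<noteq> 0. A0 \<beta> \<gamma> \<rho> * A0 \<rho> \<alpha> \<delta>)) \<and>
        (\<forall>\<alpha> \<beta> \<gamma> \<rho>. mps_deriv \<alpha> (A0 \<gamma> \<beta> \<rho>) = mps_deriv \<gamma> (A0 \<alpha> \<beta> \<rho>))))
     \<and>
     (1 \<le> k \<and> k \<le> n \<and> (\<Sum>l\<in>{1..k}. d l) = n + 1 \<and>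
      smooth_complete_intersection n k d F \<and>
      basis_mod (\<lambda>c a. sp_const c * a) (G 0) (QS ` G (- 1)) u \<and>
      (\<forall>\<rho>. weight_homogeneous (wu \<rho>) (u \<rho>)) \<and>
      \<zeta>0 \<in> mser G 0 \<and> \<zeta>1 \<in> mser G 0 \<and>
      mps_nth \<zeta>0 0 = 1 \<and>
      series_weight (\<lambda>\<rho>. 1 - wu \<rho>) 0 \<zeta> \<and>
      weak_primitive_form sp_const G D QS L \<zeta> \<and>
      (\<forall>\<alpha> \<beta>. \<Lambda>0 \<alpha> \<beta> \<in> mser G (- 1) \<and> \<Lambda>1 \<alpha> \<beta> \<in> mser G (- 1) \<and>
        hnabla L \<beta> (hnabla L \<alpha> \<zeta>) =
          (\<Sum>\<rho>\<in>UNIV. hact sp_const (hbar_lin (a0 \<alpha> \<beta> \<rho>) (a1 \<alpha> \<beta> \<rho>)) (hnabla L \<rho> \<zeta>)) +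
          tw_diff D QS L (hbar_lin (\<Lambda>0 \<alpha> \<beta>) (\<Lambda>1 \<alpha> \<beta>))) \<and>
      (\<forall>\<alpha> \<beta> \<rho>. a1 \<alpha> \<beta> \<rho> = 0)
      \<longrightarrow>
      (\<forall>\<delta>. symmetric3 (\<lambda>\<alpha> \<beta> \<gamma>. \<Sum>\<rho>\<in>UNIV. a0 \<alpha> \<beta> \<rho> * a0 \<gamma> \<rho> \<delta>)) \<and>
      (\<forall>\<delta>. symmetric3 (\<lambda>\<alpha> \<beta> \<gamma>. mps_deriv \<gamma> (a0 \<alpha> \<beta> \<delta>))) \<and>
      (\<forall>\<alpha> \<beta> \<rho>. a0 \<alpha> \<beta> \<rho> = a0 \<beta> \<alpha> \<rho>) \<and>
      (\<exists>!p. formal_F_manifold p \<and>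
            (\<forall>\<alpha> \<beta>. p (vf_coord \<alpha>) (vf_coord \<beta>) = (\<lambda>\<rho>. a0 \<alpha> \<beta> \<rho>))))"
proof (rule conjI; rule impI)
  assume hyps: "dgbv_algebra cst B \<Delta> Q \<and>
      shifted_dgla cst B (\<lambda>b. \<Delta> b + Q b) (ell2 (\<lambda>b. \<Delta> b + Q b)) \<and>
      tangent_basis cst B (\<lambda>b. \<Delta> b + Q b) e \<and>
      maurer_cartan cst B (\<lambda>b. \<Delta> b + Q b) \<Gamma> \<and>
      weak_primitive_form cst B \<Delta> Q \<Gamma> \<xi> \<and>
      connection_coeffs cst B \<Delta> Q \<Gamma> \<xi> A"
  then have primitive: "weak_primitive_form cst B \<Delta> Q \<Gamma> \<xi>"
      and coeffs: "connection_coeffs cst B \<Delta> Q \<Gamma> \<xi> A"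
    by simp_all
  \<comment> \<open>That the twisted differential squares to zero is part of
    \<open>weak_primitive_form\<close>.\<close>
  have mc: "mc_setting cst B \<Delta> Q \<Gamma>"
    using hyps by (intro mc_setting_dgbv) (simp_all add: weak_primitive_form_def)
  have "A \<alpha> \<beta> \<rho> = A \<beta> \<alpha> \<rho>" for \<alpha> \<beta> \<rho>
    by (rule connection_coeffs_symmetric[OF mc_setting.axioms(1)[OF mc] primitive coeffs])
  moreover have "(\<Sum>\<rho> | A0 \<alpha> \<beta> \<rho> \<noteq> 0. A0 \<alpha> \<beta> \<rho> * A0 \<rho> \<gamma> \<delta>) =
        (\<Sum>\<rho> | A0 \<beta> \<gamma> \<rho> \<noteq> 0. A0 \<beta> \<gamma> \<rho> * A0 \<rho> \<alpha> \<delta>)"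
      "mps_deriv \<alpha> (A0 \<gamma> \<beta> \<delta>) = mps_deriv \<gamma> (A0 \<alpha> \<beta> \<delta>)"
    if "\<forall>\<alpha> \<beta> \<rho>. A1 \<alpha> \<beta> \<rho> = 0" for \<alpha> \<beta> \<gamma> \<delta>
  proof -
    have "connection_coeffs cst B \<Delta> Q \<Gamma> \<xi> (\<lambda>\<alpha> \<beta> \<rho>. fps_const (A0 \<alpha> \<beta> \<rho>))"
      using coeffs that by (simp add: A_def hbar_lin_0)
    note dgbv_associativity_potential[OF mc primitive this]
    then show "(\<Sum>\<rho> | A0 \<alpha> \<beta> \<rho> \<noteq> 0. A0 \<alpha> \<beta> \<rho> * A0 \<rho> \<gamma> \<delta>) =
        (\<Sum>\<rho> | A0 \<beta> \<gamma> \<rho> \<noteq> 0. A0 \<beta> \<gamma> \<rho> * A0 \<rho> \<alpha> \<delta>)"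
      "mps_deriv \<alpha> (A0 \<gamma> \<beta> \<delta>) = mps_deriv \<gamma> (A0 \<alpha> \<beta> \<delta>)"
      by blast+
  qed
  ultimately show "(\<forall>\<alpha> \<beta> \<rho>. A \<alpha> \<beta> \<rho> = A \<beta> \<alpha> \<rho>) \<and>
      ((\<forall>\<alpha> \<beta> \<rho>. A1 \<alpha> \<beta> \<rho> = 0) \<longrightarrow>
        (\<forall>\<alpha> \<beta> \<gamma> \<delta>. (\<Sum>\<rho> | A0 \<alpha> \<beta> \<rho> \<noteq> 0. A0 \<alpha> \<beta> \<rho> * A0 \<rho> \<gamma> \<delta>) =
                     (\<Sum>\<rho> | A0 \<beta> \<gamma> \<rho> \<noteq> 0. A0 \<beta> \<gamma> \<rho> * A0 \<rho> \<alpha> \<delta>)) \<and>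
        (\<forall>\<alpha> \<beta> \<gamma> \<rho>. mps_deriv \<alpha> (A0 \<gamma> \<beta> \<rho>) = mps_deriv \<gamma> (A0 \<alpha> \<beta> \<rho>)))"
    by blast
next
  assume hyps: "1 \<le> k \<and> k \<le> n \<and> (\<Sum>l\<in>{1..k}. d l) = n + 1 \<and>
      smooth_complete_intersection n k d F \<and>
      basis_mod (\<lambda>c a. sp_const c * a) (G 0) (QS ` G (- 1)) u \<and>
      (\<forall>\<rho>. weight_homogeneous (wu \<rho>) (u \<rho>)) \<and>
      \<zeta>0 \<in> mser G 0 \<and> \<zeta>1 \<in> mser G 0 \<and>
      mps_nth \<zeta>0 0 = 1 \<and>
      series_weight (\<lambda>\<rho>. 1 - wu \<rho>) 0 \<zeta> \<and>
      weak_primitive_form sp_const G D QS L \<zeta> \<and>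
      (\<forall>\<alpha> \<beta>. \<Lambda>0 \<alpha> \<beta> \<in> mser G (- 1) \<and> \<Lambda>1 \<alpha> \<beta> \<in> mser G (- 1) \<and>
        hnabla L \<beta> (hnabla L \<alpha> \<zeta>) =
          (\<Sum>\<rho>\<in>UNIV. hact sp_const (hbar_lin (a0 \<alpha> \<beta> \<rho>) (a1 \<alpha> \<beta> \<rho>)) (hnabla L \<rho> \<zeta>)) +
          tw_diff D QS L (hbar_lin (\<Lambda>0 \<alpha> \<beta>) (\<Lambda>1 \<alpha> \<beta>))) \<and>
      (\<forall>\<alpha> \<beta> \<rho>. a1 \<alpha> \<beta> \<rho> = 0)"
  have u: "u \<rho> \<in> G 0" for \<rho>
    using hyps by (simp add: basis_mod_def)
  have \<Lambda>_in: "hbar_lin (\<Lambda>0 \<alpha> \<beta>) (\<Lambda>1 \<alpha> \<beta>) \<in> hser G (- 1)" for \<alpha> \<beta>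
  proof -
    interpret even_central sp_const G
      unfolding G_def by (rule even_central_CY)
    show ?thesis
      using hyps by (simp add: hbar_lin_def fps_mult_fps_X_commute[symmetric] hser_add hser_const hser_X_mult)
  qed
  have "hnabla L \<beta> (hnabla L \<alpha> \<zeta>) =
      (\<Sum>\<rho>\<in>UNIV. hact sp_const (fps_const (a0 \<alpha> \<beta> \<rho>)) (hnabla L \<rho> \<zeta>)) +
      tw_diff D QS L (hbar_lin (\<Lambda>0 \<alpha> \<beta>) (\<Lambda>1 \<alpha> \<beta>))" for \<alpha> \<beta>
    using hyps by (simp add: hbar_lin_0)
  moreover have "weak_primitive_form sp_const G D QS L \<zeta>"
    using hyps by blast
  ultimately have pot: "potential_structure a0"
    using u \<Lambda>_in unfolding G_def D_def QS_def L_def by (intro CY_coeffs)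
  show "(\<forall>\<delta>. symmetric3 (\<lambda>\<alpha> \<beta> \<gamma>. \<Sum>\<rho>\<in>UNIV. a0 \<alpha> \<beta> \<rho> * a0 \<gamma> \<rho> \<delta>)) \<and>
      (\<forall>\<delta>. symmetric3 (\<lambda>\<alpha> \<beta> \<gamma>. mps_deriv \<gamma> (a0 \<alpha> \<beta> \<delta>))) \<and>
      (\<forall>\<alpha> \<beta> \<rho>. a0 \<alpha> \<beta> \<rho> = a0 \<beta> \<alpha> \<rho>) \<and>
      (\<exists>!p. formal_F_manifold p \<and>
            (\<forall>\<alpha> \<beta>. p (vf_coord \<alpha>) (vf_coord \<beta>) = (\<lambda>\<rho>. a0 \<alpha> \<beta> \<rho>)))"
    by (intro conjI allI potential_structure_F_manifold[OF pot] potential_structure.sym[OF pot])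
qed

end
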